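(* Let $k$ be an algebraically closed field of characteristic $0$, let $A$ be a local, Artinian, Gorenstein $k$-algebra, and let $s\ge 3$ and $1\le m\le n$ be integers. Then $H_A(1)=n$, $H_A(2)=m$, $H_A(3)=\dots=H_A(s)=1$ and $s=\mathrm{sdeg}(A)$ if and only if $$A\cong k[[x_1,\dots,x_n]]/\mathrm{Ann}(F)$$ for some polynomial of the form $F=y_1^s+F_3+\sum_{j=m+1}^n y_j^2\in k[y_1,\dots,y_n]$, where $F_3\in k[y_1,\dots,y_m]$ is a cubic form (a homogeneous polynomial of degree $3$, possibly zero) such that $x_1^2\circ F_3=0$ and $x_2\circ F_3,\dots,x_m\circ F_3$ are linearly independent over $k$.
   Context: A $k$-algebra is associative, commutative and unitary; Artinian $k$-algebras are finite-dimensional over $k$. For a local Artinian $k$-algebra $A$ with maximal ideal $\mathfrak M$, the Hilbert function is $H_A(i)=\dim_k(\mathfrak M^i/\mathfrak M^{i+1})$, and the socle degree $\mathrm{sdeg}(A)$ is the greatest integer $s$ with $\mathfrak M^s\neq 0$. The power series ring $k[[x_1,\dots,x_n]]$ acts on the polynomial ring $k[y_1,\dots,y_n]$ by partial differentiation, $x_i$ acting as $\partial/\partial y_i$; this action is denoted by $\circ$. For $F\in k[y_1,\dots,y_n]$, $\mathrm{Ann}(F)=\{g\in k[[x_1,\dots,x_n]] : g\circ F=0\}$. *)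

theory Defs
  imports
    "HOL-Algebra.QuotRing"
    "HOL-Algebra.Ideal_Product"
    "HOL-Algebra.Algebraic_Closure_Type"
    "HOL-Library.Poly_Mapping"
    "HOL-Computational_Algebra.Polynomial"
begin

section \<open>Local Artinian Gorenstein algebras\<close>

text \<open>
  An algebra over a field is a commutative unitary ring type together with a compatible
  scalar multiplication. (The zero ring is not a \<^class>\<open>comm_ring_1\<close>; it is not local anyway.)
\<close>

locale k_algebra = vector_space scale
  for scale :: "'k::field \<Rightarrow> 'a::comm_ring_1 \<Rightarrow> 'a" +
  assumes scale_mult_left: "scale c x * y = scale c (x * y)"

locale local_artinian_algebra = k_algebra scale
  for scale :: "'k::field \<Rightarrow> 'a::comm_ring_1 \<Rightarrow> 'a" +
  assumes finite_dim: "\<exists>B. finite B \<and> module.span scale B = UNIV"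
    and local: "\<exists>!M. maximalideal M (ring_of_type_algebra :: 'a ring)"

definition max_ideal :: "'a::comm_ring_1 set" where
  "max_ideal = (THE M. maximalideal M (ring_of_type_algebra :: 'a ring))"

text \<open>Powers are taken in the semiring of ideals, so the zeroth power is the whole ring.\<close>

definition max_ideal_pow :: "nat \<Rightarrow> 'a::comm_ring_1 set" where
  "max_ideal_pow i = max_ideal [^]\<^bsub>ideals_set (ring_of_type_algebra :: 'a ring)\<^esub> i"

definition sdeg :: "'a::comm_ring_1 itself \<Rightarrow> nat" where
  "sdeg _ = (GREATEST s. (max_ideal_pow s :: 'a set) \<noteq> {0})"

text \<open>
  The dimension of a quotient \<open>V / W\<close> of subspaces \<open>W \<subseteq> V\<close>: the number of elements of a
  set \<open>B \<subseteq> V\<close> whose residue classes are pairwise distinct and form a basis of \<open>V / W\<close>.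
\<close>

definition basis_mod :: "('k::field \<Rightarrow> 'a::ab_group_add \<Rightarrow> 'a) \<Rightarrow> 'a set \<Rightarrow> 'a set \<Rightarrow> 'a set \<Rightarrow> bool" where
  "basis_mod scale V W B \<longleftrightarrow> B \<subseteq> V \<and>
     (\<forall>t c. finite t \<longrightarrow> t \<subseteq> B \<longrightarrow> (\<Sum>b\<in>t. scale (c b) b) \<in> W \<longrightarrow> (\<forall>b\<in>t. c b = 0)) \<and>
     (\<forall>v\<in>V. \<exists>t c. finite t \<and> t \<subseteq> B \<and> v - (\<Sum>b\<in>t. scale (c b) b) \<in> W)"

definition quotient_dim :: "('k::field \<Rightarrow> 'a::ab_group_add \<Rightarrow> 'a) \<Rightarrow> 'a set \<Rightarrow> 'a set \<Rightarrow> nat" where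
  "quotient_dim scale V W = card (SOME B. basis_mod scale V W B)"

definition hilbert :: "('k::field \<Rightarrow> 'a::comm_ring_1 \<Rightarrow> 'a) \<Rightarrow> nat \<Rightarrow> nat" where
  "hilbert scale i = quotient_dim scale (max_ideal_pow i) (max_ideal_pow (Suc i))"

definition socle :: "'a::comm_ring_1 set" where
  "socle = {a. \<forall>x\<in>max_ideal. a * x = 0}"

text \<open>
  A local Artinian ring is Gorenstein iff its socle is one-dimensional over the residue field.
  The scalars are algebraically closed here, so the residue field is the field of scalars.
\<close>

locale gorenstein_local_artinian_algebra = local_artinian_algebra scale
  for scale :: "'k::alg_closed_field \<Rightarrow> 'a::comm_ring_1 \<Rightarrow> 'a" +
  assumes socle_dim: "vector_space.dim scale (socle :: 'a set) = 1"


section \<open>Polynomials and power series in several variables\<close>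

text \<open>
  Exponent vectors are finitely supported functions on \<^typ>\<open>nat\<close>, the \<open>i\<close>-th variable having
  index \<open>i\<close>. Polynomials are finitely supported families of coefficients and power series
  arbitrary ones; the restriction to the variables \<open>1, \<dots>, n\<close> is imposed on the exponents.
\<close>

type_synonym 'k mpoly = "(nat \<Rightarrow>\<^sub>0 nat) \<Rightarrow>\<^sub>0 'k"
type_synonym 'k mps = "(nat \<Rightarrow>\<^sub>0 nat) \<Rightarrow> 'k"

definition mpolys :: "nat \<Rightarrow> 'k::field mpoly set" where
  "mpolys n = {F. \<forall>\<alpha>\<in>Poly_Mapping.keys F. Poly_Mapping.keys \<alpha> \<subseteq> {1..n}}"

definition cst :: "'k::field \<Rightarrow> 'k mpoly" where
  "cst c = Poly_Mapping.single 0 c"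

definition yvar :: "nat \<Rightarrow> 'k::field mpoly" where
  "yvar i = Poly_Mapping.single (Poly_Mapping.single i 1) 1"

definition homogeneous :: "nat \<Rightarrow> 'k::field mpoly \<Rightarrow> bool" where
  "homogeneous d F \<longleftrightarrow>
     (\<forall>\<alpha>\<in>Poly_Mapping.keys F. (\<Sum>i\<in>Poly_Mapping.keys \<alpha>. Poly_Mapping.lookup \<alpha> i) = d)"

definition mps_ring :: "nat \<Rightarrow> 'k::field mps ring" where
  "mps_ring n = \<lparr>
     carrier = {f. \<forall>\<alpha>. f \<alpha> \<noteq> 0 \<longrightarrow> Poly_Mapping.keys \<alpha> \<subseteq> {1..n}},
     monoid.mult = (\<lambda>f g \<gamma>. \<Sum>(\<alpha>, \<beta>)\<in>{(\<alpha>, \<beta>). \<alpha> + \<beta> = \<gamma>}. f \<alpha> * g \<beta>),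
     monoid.one = (\<lambda>\<alpha>. if \<alpha> = 0 then 1 else 0),
     ring.zero = (\<lambda>_. 0),
     ring.add = (\<lambda>f g \<alpha>. f \<alpha> + g \<alpha>)\<rparr>"

definition mps_const :: "'k::field \<Rightarrow> 'k mps" where
  "mps_const c = (\<lambda>\<alpha>. if \<alpha> = 0 then c else 0)"

definition xvar :: "nat \<Rightarrow> 'k::field mps" where
  "xvar i = (\<lambda>\<alpha>. if \<alpha> = Poly_Mapping.single i 1 then 1 else 0)"

text \<open>The sums in \<^const>\<open>mps_ring\<close> are finite:\<close>

lemma finite_decompositions: "finite {(\<alpha>, \<beta>). \<alpha> + \<beta> = (\<gamma> :: nat \<Rightarrow>\<^sub>0 nat)}"
proof -
  let ?D = "{(\<alpha>, \<beta>). \<alpha> + \<beta> = \<gamma>}"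
  let ?N = "\<Sum>i\<in>Poly_Mapping.keys \<gamma>. Poly_Mapping.lookup \<gamma> i"
  let ?S = "{f. \<forall>i. (i \<in> Poly_Mapping.keys \<gamma> \<longrightarrow> f i \<in> {..?N}) \<and>
                 (i \<notin> Poly_Mapping.keys \<gamma> \<longrightarrow> f i = (0::nat))}"
  have fin: "finite ?S"
    by (rule finite_set_of_finite_funs) simp_all
  have le: "Poly_Mapping.lookup \<alpha> i \<le> Poly_Mapping.lookup \<gamma> i" if "\<alpha> + \<beta> = \<gamma>" for \<alpha> \<beta> i
    using that by (auto simp: lookup_add)
  have "(\<lambda>(\<alpha>, \<beta>). Poly_Mapping.lookup \<alpha>) ` ?D \<subseteq> ?S"
  proof clarsimp
    fix \<alpha> \<beta> :: "nat \<Rightarrow>\<^sub>0 nat" and i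
    let ?\<gamma> = "\<alpha> + \<beta>"
    have "Poly_Mapping.lookup \<alpha> i \<le> Poly_Mapping.lookup ?\<gamma> i"
      by (simp add: lookup_add)
    moreover have "Poly_Mapping.lookup ?\<gamma> i \<le>
        (\<Sum>i\<in>Poly_Mapping.keys ?\<gamma>. Poly_Mapping.lookup ?\<gamma> i)"
      if "i \<in> Poly_Mapping.keys ?\<gamma>"
      using that by (intro member_le_sum) auto
    ultimately show "(i \<in> Poly_Mapping.keys ?\<gamma> \<longrightarrow> Poly_Mapping.lookup \<alpha> i \<le>
          (\<Sum>i\<in>Poly_Mapping.keys ?\<gamma>. Poly_Mapping.lookup ?\<gamma> i)) \<and>
        (i \<notin> Poly_Mapping.keys ?\<gamma> \<longrightarrow> Poly_Mapping.lookup \<alpha> i = 0)"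
      by (auto simp: in_keys_iff intro: order_trans)
  qed
  moreover have "inj_on (\<lambda>(\<alpha>, \<beta>). Poly_Mapping.lookup \<alpha>) ?D"
    by (auto simp: inj_on_def)
  ultimately show ?thesis
    using fin by (meson finite_imageD finite_subset)
qed


section \<open>The action by partial differentiation\<close>

definition pdiff :: "nat \<Rightarrow> 'k::field mpoly \<Rightarrow> 'k mpoly" where
  "pdiff i F = (\<Sum>\<beta>\<in>Poly_Mapping.keys F. Poly_Mapping.single (\<beta> - Poly_Mapping.single i 1)
                  (of_nat (Poly_Mapping.lookup \<beta> i) * Poly_Mapping.lookup F \<beta>))"

text \<open>The iterated partial derivative belonging to an exponent vector.\<close>

definition mono_diff :: "(nat \<Rightarrow>\<^sub>0 nat) \<Rightarrow> 'k::field mpoly \<Rightarrow> 'k mpoly" where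
  "mono_diff \<alpha> F =
     fold (\<lambda>i. pdiff i ^^ Poly_Mapping.lookup \<alpha> i) (sorted_list_of_set (Poly_Mapping.keys \<alpha>)) F"

text \<open>
  A power series acts as the corresponding infinite combination of the operators
  \<^const>\<open>mono_diff\<close>; only finitely many summands are nonzero, see \<open>finite_mono_diff\<close> below.
\<close>

definition act :: "'k::field mps \<Rightarrow> 'k mpoly \<Rightarrow> 'k mpoly" (infixr \<open>\<circ>\<^sub>\<partial>\<close> 75) where
  "g \<circ>\<^sub>\<partial> F = Sum_any (\<lambda>\<alpha>. cst (g \<alpha>) * mono_diff \<alpha> F)"

lemma keys_pdiff:
  assumes "\<gamma> \<in> Poly_Mapping.keys (pdiff i F)"
  shows "\<gamma> + Poly_Mapping.single i 1 \<in> Poly_Mapping.keys F"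
proof -
  have "Poly_Mapping.lookup (pdiff i F) \<gamma> \<noteq> 0"
    using assms by (simp add: in_keys_iff)
  then obtain \<beta> where \<beta>: "\<beta> \<in> Poly_Mapping.keys F" and
    nz: "Poly_Mapping.lookup (Poly_Mapping.single (\<beta> - Poly_Mapping.single i 1)
          (of_nat (Poly_Mapping.lookup \<beta> i) * Poly_Mapping.lookup F \<beta>)) \<gamma> \<noteq> 0"
    unfolding pdiff_def lookup_sum by (meson sum.not_neutral_contains_not_neutral)
  have eq: "\<gamma> = \<beta> - Poly_Mapping.single i 1" and pos: "Poly_Mapping.lookup \<beta> i \<noteq> 0"
    using nz by (cases "Poly_Mapping.lookup \<beta> i = 0";
        auto simp: lookup_single when_def split: if_splits)+
  have "\<gamma> + Poly_Mapping.single i 1 = \<beta>"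
    using pos unfolding eq
    by (intro poly_mapping_eqI) (auto simp: lookup_add lookup_minus lookup_single when_def)
  with \<beta> show ?thesis by simp
qed

lemma keys_pdiff_funpow:
  "\<gamma> \<in> Poly_Mapping.keys ((pdiff i ^^ k) F) \<Longrightarrow> \<gamma> + Poly_Mapping.single i k \<in> Poly_Mapping.keys F"
proof (induction k arbitrary: \<gamma>)
  case (Suc k)
  from Suc.prems have "\<gamma> + Poly_Mapping.single i 1 \<in> Poly_Mapping.keys ((pdiff i ^^ k) F)"
    using keys_pdiff by simp
  from Suc.IH[OF this] show ?case
    by (simp add: add.assoc flip: single_add)
qed simp

lemma keys_mono_diff:
  assumes "\<gamma> \<in> Poly_Mapping.keys (mono_diff \<alpha> F)"
  shows "\<gamma> + \<alpha> \<in> Poly_Mapping.keys F"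
proof -
  have *: "\<gamma> + (\<Sum>i\<leftarrow>xs. Poly_Mapping.single i (Poly_Mapping.lookup \<alpha> i)) \<in> Poly_Mapping.keys F"
    if "\<gamma> \<in> Poly_Mapping.keys (fold (\<lambda>i. pdiff i ^^ Poly_Mapping.lookup \<alpha> i) xs F)" for xs
    using that
  proof (induction xs arbitrary: F)
    case (Cons i xs)
    from Cons.IH[of "(pdiff i ^^ Poly_Mapping.lookup \<alpha> i) F"] Cons.prems keys_pdiff_funpow
    show ?case by (fastforce simp: ac_simps)
  qed simp
  have "(\<Sum>i\<leftarrow>sorted_list_of_set (Poly_Mapping.keys \<alpha>).
          Poly_Mapping.single i (Poly_Mapping.lookup \<alpha> i)) = \<alpha>"
    by (subst sum_list_distinct_conv_sum_set)
       (auto intro!: poly_mapping_eqI simp: lookup_sum lookup_single when_def in_keys_iff)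
  with *[OF assms[unfolded mono_diff_def]] show ?thesis by simp
qed

lemma finite_mono_diff: "finite {\<alpha>. mono_diff \<alpha> F \<noteq> 0}"
proof (rule finite_subset)
  show "{\<alpha>. mono_diff \<alpha> F \<noteq> 0} \<subseteq> (\<Union>\<beta>\<in>Poly_Mapping.keys F. snd ` {(\<gamma>, \<alpha>). \<gamma> + \<alpha> = \<beta>})"
  proof
    fix \<alpha> assume "\<alpha> \<in> {\<alpha>. mono_diff \<alpha> F \<noteq> 0}"
    then obtain \<gamma> where "\<gamma> \<in> Poly_Mapping.keys (mono_diff \<alpha> F)"
      by fastforce
    from keys_mono_diff[OF this]
    show "\<alpha> \<in> (\<Union>\<beta>\<in>Poly_Mapping.keys F. snd ` {(\<gamma>, \<alpha>). \<gamma> + \<alpha> = \<beta>})"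
      by (force simp: image_iff)
  qed
  show "finite (\<Union>\<beta>\<in>Poly_Mapping.keys F. snd ` {(\<gamma>, \<alpha>). \<gamma> + \<alpha> = \<beta>})"
    by (intro finite_UN_I finite_imageI finite_decompositions) simp
qed

lemma act_xvar: "xvar i \<circ>\<^sub>\<partial> F = pdiff i F"
proof -
  have "xvar i \<circ>\<^sub>\<partial> F = Sum_any (\<lambda>\<alpha>. mono_diff \<alpha> F when \<alpha> = Poly_Mapping.single i 1)"
    unfolding act_def
    by (intro arg_cong[where f = Sum_any] ext) (simp add: xvar_def cst_def when_def)
  also have "\<dots> = mono_diff (Poly_Mapping.single i 1) F"
    by simp
  also have "\<dots> = pdiff i F"
    by (simp add: mono_diff_def)
  finally show ?thesis .
qed

definition Ann :: "nat \<Rightarrow> 'k::field mpoly \<Rightarrow> 'k mps set" where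
  "Ann n F = {g \<in> carrier (mps_ring n). g \<circ>\<^sub>\<partial> F = 0}"

text \<open>
  Isomorphism of algebras with the quotient of the power series ring in \<open>n\<close> variables by an
  ideal \<open>I\<close>: the scalars act on the quotient through the classes of the constant power series.
\<close>

definition iso_mps_quotient ::
    "('k::field \<Rightarrow> 'a::comm_ring_1 \<Rightarrow> 'a) \<Rightarrow> nat \<Rightarrow> 'k mps set \<Rightarrow> bool" where
  "iso_mps_quotient scale n I \<longleftrightarrow>
     (\<exists>\<phi> \<in> ring_iso (ring_of_type_algebra :: 'a ring) (mps_ring n Quot I).
        \<forall>c a. \<phi> (scale c a) = (I +>\<^bsub>mps_ring n\<^esub> mps_const c) \<otimes>\<^bsub>mps_ring n Quot I\<^esub> \<phi> a)"

definition lin_indep_family :: "(nat \<Rightarrow> 'k::field mpoly) \<Rightarrow> nat set \<Rightarrow> bool" where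
  "lin_indep_family G J \<longleftrightarrow>
     (\<forall>c. (\<Sum>j\<in>J. cst (c j) * G j) = 0 \<longrightarrow> (\<forall>j\<in>J. c j = 0))"

end

theory Submission
  imports Defs
begin

text \<open>
  A surjection \<open>k[[x\<^sub>1, \<dots>, x\<^sub>n]] \<rightarrow> A\<close> with kernel \<open>Ann F\<close> is the same thing as a system of generators
  \<open>a\<^sub>1, \<dots>, a\<^sub>n\<close> of the maximal ideal together with a functional \<open>\<lambda>\<close> on \<open>A\<close> such that the form
  \<open>(x, y) \<mapsto> \<lambda>(x y)\<close> is nondegenerate and \<open>\<lambda>(a\<^sup>\<alpha>)\<close> is \<open>\<alpha>!\<close> times the coefficient of \<open>F\<close> at \<open>y\<^sup>\<alpha>\<close>.
  If \<open>F\<close> has the normal form, the Hilbert function is read off from the orthogonality relations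
  among the monomials \<open>a\<^sup>\<alpha>\<close>.

  Conversely, choose \<open>x\<close> in the maximal ideal \<open>M\<close> with \<open>x\<^sup>s \<noteq> 0\<close>, so that \<open>M\<^sup>3\<close> is spanned by \<open>x\<^sup>3, \<dots>, x\<^sup>s\<close>,
  and any functional \<open>\<lambda>\<close> with \<open>\<lambda>(x\<^sup>s) = s!\<close> vanishing on the lower powers of \<open>x\<close>. Let \<open>V\<close> be the
  orthogonal complement of the powers of \<open>x\<close>. Then \<open>U = V \<inter> M\<^sup>2\<close> is isotropic. The generators
  \<open>a\<^sub>2, \<dots>, a\<^sub>m\<close> span an isotropic complement dual to \<open>U\<close>, and \<open>a\<^bsub>m+1\<^esub>, \<dots>, a\<^sub>n\<close> is an orthogonal basis of
  the orthogonal complement of both in \<open>V\<close>, normalised by \<open>\<lambda>(a\<^sub>j\<^sup>2) = 2\<close>. All values of \<open>\<lambda>\<close> on monomials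
  containing some \<open>a\<^sub>j\<close> with \<open>j \<ge> 2\<close>, apart from these squares, are then concentrated in degree 3.
\<close>

text \<open>In divided powers differentiation merely shifts exponents, so \<open>F\<close> is a
  table of the values of the functional on monomials, and everything becomes a question about the
  symmetric form (y, z) |-> lam(y z). "Any functional" suffices because in a Gorenstein algebra
  every nonzero ideal contains the socle, here the line through x^s. Vanishing on lower powers makes
  x^i and x^(s-i) dual up to s!, so A is the orthogonal sum of V and the powers of x. As M^3
  consists of powers of x, it is orthogonal to V; this kills all monomials of degree at least 4
  containing some a_j with j \<ge> 2. The obstacle is U: being isotropic (U x lies in V \<inter> M^3
  = 0), it admits no orthogonal basis. It is completed to hyperbolic pairs, and the partners of U
  become a_2, ..., a_m: isotropy removes their quadratic terms, and duality with U, which lies in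
  M^2, is the independence of the derivatives of F_3. The values s! and 2 are \<alpha>! for y_1^s
  and y_j^2. Algebraic closedness yields scalar residues and the square roots for the normalisation;
  characteristic 0 yields division by \<alpha>! and polarisation.\<close>

abbreviation "keys \<equiv> Poly_Mapping.keys"
abbreviation "lookup \<equiv> Poly_Mapping.lookup"
abbreviation "single \<equiv> Poly_Mapping.single"


section \<open>Dimensions of quotients\<close>

context vector_space
begin

lemma sum_scale_mem: "subspace S \<Longrightarrow> (\<And>i. i \<in> I \<Longrightarrow> f i \<in> S) \<Longrightarrow> (\<Sum>i\<in>I. scale (c i) (f i)) \<in> S"
  by (intro subspace_sum subspace_scale)

text \<open>Adjoining a basis \<open>C\<close> of \<open>W\<close> to \<open>B\<close> gives a basis
  of \<open>V\<close>. Hence all bases of \<open>V\<close> modulo \<open>W\<close> have the same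
  cardinality, and the choice operator in \<open>quotient_dim\<close> is harmless.\<close>

lemma basis_mod_card:
  assumes V: "subspace V" and W: "subspace W" and WV: "W \<subseteq> V"
    and fin: "finite D" "V \<subseteq> span D" and B: "basis_mod scale V W B"
  shows "finite B" "card B + dim W = dim V"
proof -
  have BV: "B \<subseteq> V"
    and indep: "\<And>t c. finite t \<Longrightarrow> t \<subseteq> B \<Longrightarrow> (\<Sum>b\<in>t. scale (c b) b) \<in> W \<Longrightarrow> \<forall>b\<in>t. c b = 0"
    and gen: "\<And>v. v \<in> V \<Longrightarrow> \<exists>t c. finite t \<and> t \<subseteq> B \<and> v - (\<Sum>b\<in>t. scale (c b) b) \<in> W"
    using B unfolding basis_mod_def by blast+
  obtain C where C: "C \<subseteq> W" "independent C" "W \<subseteq> span C" "card C = dim W"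
    using basis_exists by blast
  have disj: "B \<inter> C = {}"
  proof (rule ccontr)
    assume "B \<inter> C \<noteq> {}"
    then obtain b where "b \<in> B" "b \<in> C" by blast
    with indep[of "{b}" "\<lambda>_. 1"] C(1) show False by auto
  qed
  have ind: "independent (B \<union> C)"
    unfolding independent_explicit_finite_subsets
  proof (intro allI impI)
    fix S u assume S: "S \<subseteq> B \<union> C" "finite S" and 0: "(\<Sum>v\<in>S. scale (u v) v) = 0"
    have split: "(\<Sum>v\<in>S. scale (u v) v) = (\<Sum>v\<in>S \<inter> B. scale (u v) v) + (\<Sum>v\<in>S \<inter> C. scale (u v) v)"
      using S disj by (subst sum.union_disjoint[symmetric]) (auto intro!: sum.cong)
    have "(\<Sum>v\<in>S \<inter> C. scale (u v) v) \<in> W"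
      using C(1) by (intro sum_scale_mem W) auto
    then have "(\<Sum>v\<in>S \<inter> B. scale (u v) v) \<in> W"
      using 0 split subspace_neg[OF W] by (metis add_eq_0_iff2)
    then have uB: "\<forall>b\<in>S \<inter> B. u b = 0"
      using indep[of "S \<inter> B" u] S by auto
    then have "(\<Sum>v\<in>S \<inter> C. scale (u v) v) = 0"
      using 0 split by simp
    then have "\<forall>b\<in>S \<inter> C. u b = 0"
      using C(2) S unfolding independent_explicit_finite_subsets by (meson finite_Int inf_le2)
    with uB S show "\<forall>v\<in>S. u v = 0" by blast
  qed
  have sp: "V \<subseteq> span (B \<union> C)"
  proof
    fix v assume "v \<in> V"
    then obtain t c where t: "finite t" "t \<subseteq> B" "v - (\<Sum>b\<in>t. scale (c b) b) \<in> W"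
      using gen by blast
    have "v - (\<Sum>b\<in>t. scale (c b) b) \<in> span (B \<union> C)"
      using t(3) C(3) span_mono[of C "B \<union> C"] by auto
    moreover have "(\<Sum>b\<in>t. scale (c b) b) \<in> span (B \<union> C)"
      using t(2) by (intro sum_scale_mem subspace_span) (auto intro: span_base)
    ultimately show "v \<in> span (B \<union> C)"
      by (metis span_add diff_add_cancel)
  qed
  have f: "finite (B \<union> C)"
    using independent_span_bound[OF fin(1) ind] BV C(1) WV fin(2) by blast
  then show "finite B" by simp
  have "card (B \<union> C) = dim V"
    using basis_card_eq_dim[OF _ sp ind] BV C(1) WV by blast
  then show "card B + dim W = dim V"
    using f disj C(4) by (simp add: card_Un_disjoint)
qed

text \<open>A basis \<open>C\<close> of \<open>W\<close> extends to a basis \<open>D\<close> of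
  \<open>V\<close>, and \<open>D - C\<close> is a basis modulo \<open>W\<close>.\<close>

lemma basis_mod_exists:
  assumes W: "subspace W" and WV: "W \<subseteq> V"
  shows "\<exists>B. basis_mod scale V W B"
proof -
  obtain C where C: "C \<subseteq> W" "independent C" "W \<subseteq> span C" "card C = dim W"
    using basis_exists by blast
  obtain D where D: "C \<subseteq> D" "D \<subseteq> V" "independent D" "V \<subseteq> span D"
    using maximal_independent_subset_extend[of C V] C WV by blast
  have WC: "W = span C"
    using C W by (simp add: span_minimal subset_antisym)
  have "basis_mod scale V W (D - C)"
    unfolding basis_mod_def
  proof (intro conjI allI impI ballI)
    fix t c b assume t: "finite t" "t \<subseteq> D - C" "(\<Sum>b\<in>t. scale (c b) b) \<in> W" "b \<in> t"
    then obtain r d where r: "finite r" "r \<subseteq> C" "(\<Sum>b\<in>t. scale (c b) b) = (\<Sum>b\<in>r. scale (d b) b)"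
      unfolding WC span_explicit by blast
    define u where "u = (\<lambda>b. if b \<in> t then c b else - d b)"
    have tr: "t \<inter> r = {}" using t r by blast
    have "(\<Sum>b\<in>t \<union> r. scale (u b) b) = (\<Sum>b\<in>t. scale (u b) b) + (\<Sum>b\<in>r. scale (u b) b)"
      using t r tr by (intro sum.union_disjoint)
    also have "(\<Sum>b\<in>t. scale (u b) b) = (\<Sum>b\<in>t. scale (c b) b)"
      by (intro sum.cong) (auto simp: u_def)
    also have "(\<Sum>b\<in>r. scale (u b) b) = (\<Sum>b\<in>r. - scale (d b) b)"
      using tr by (intro sum.cong) (auto simp: u_def)
    finally have "(\<Sum>b\<in>t \<union> r. scale (u b) b) = 0"
      using r(3) by (simp add: sum_negf)
    then have "\<forall>b\<in>t \<union> r. u b = 0"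
      using D(3) t r D(1) unfolding independent_explicit_finite_subsets
      by (meson Diff_subset Un_least finite_UnI order_trans)
    from bspec[OF this, of b] show "c b = 0" using t(4) by (simp add: u_def)
  next
    fix v assume "v \<in> V"
    then obtain r d where r: "finite r" "r \<subseteq> D" "v = (\<Sum>b\<in>r. scale (d b) b)"
      using D(4) unfolding span_explicit by blast
    have "v = (\<Sum>b\<in>r - C. scale (d b) b) + (\<Sum>b\<in>r \<inter> C. scale (d b) b)"
      unfolding r(3) using r(1) by (subst sum.union_disjoint[symmetric]) (auto intro!: sum.cong)
    moreover have "(\<Sum>b\<in>r \<inter> C. scale (d b) b) \<in> W"
      unfolding WC by (intro sum_scale_mem subspace_span) (auto intro: span_base)
    ultimately have "v - (\<Sum>b\<in>r - C. scale (d b) b) \<in> W"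
      by (metis add_diff_cancel_left')
    then show "\<exists>t c. finite t \<and> t \<subseteq> D - C \<and> v - (\<Sum>b\<in>t. scale (c b) b) \<in> W"
      using r by blast
  qed (use D in auto)
  then show ?thesis ..
qed

text \<open>Hilbert functions are computed with indexed families, whereas \<open>basis_mod\<close>
  speaks of sets. Independence modulo \<open>W\<close> excludes repetitions: if two members agree,
  the coefficients 1 and -1 give a relation with value 0.\<close>

lemma basis_mod_family:
  assumes J: "finite J" and f: "\<And>j. j \<in> J \<Longrightarrow> f j \<in> V" and W: "0 \<in> W"
    and indep: "\<And>c j. (\<Sum>j\<in>J. scale (c j) (f j)) \<in> W \<Longrightarrow> j \<in> J \<Longrightarrow> c j = 0"
    and gen: "\<And>v. v \<in> V \<Longrightarrow> \<exists>c. v - (\<Sum>j\<in>J. scale (c j) (f j)) \<in> W"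
  shows "inj_on f J" "basis_mod scale V W (f ` J)"
proof -
  show inj: "inj_on f J"
  proof (rule inj_onI, rule ccontr)
    fix i j assume ij: "i \<in> J" "j \<in> J" "f i = f j" "i \<noteq> j"
    define c where "c = (\<lambda>l. if l = i then 1 else if l = j then -1 else 0 :: 'a)"
    have "(\<Sum>l\<in>J. scale (c l) (f l)) = (\<Sum>l\<in>{i,j}. scale (c l) (f l))"
      using ij J by (intro sum.mono_neutral_right) (auto simp: c_def)
    also have "\<dots> = 0" using ij by (simp add: c_def)
    finally show False using indep[of c i] ij W by (simp add: c_def)
  qed
  show "basis_mod scale V W (f ` J)"
    unfolding basis_mod_def
  proof (intro conjI allI impI ballI)
    show "f ` J \<subseteq> V" using f by blast
  next
    fix t c b assume t: "finite t" "t \<subseteq> f ` J" "(\<Sum>b\<in>t. scale (c b) b) \<in> W" "b \<in> t"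
    define d where "d = (\<lambda>j. if f j \<in> t then c (f j) else 0)"
    have "(\<Sum>b\<in>t. scale (c b) b) = (\<Sum>b\<in>f ` J. scale (if b \<in> t then c b else 0) b)"
      using t(2) J by (intro sum.mono_neutral_cong_left) auto
    also have "\<dots> = (\<Sum>j\<in>J. scale (d j) (f j))"
      by (subst sum.reindex[OF inj]) (simp add: d_def o_def)
    finally have "\<forall>j\<in>J. d j = 0" using indep[of d] t(3) by auto
    moreover obtain j where "j \<in> J" "b = f j" using t(2,4) by blast
    ultimately show "c b = 0" using t(4) unfolding d_def by force
  next
    fix v assume "v \<in> V"
    then obtain c where c: "v - (\<Sum>j\<in>J. scale (c j) (f j)) \<in> W" using gen by blast
    have "(\<Sum>j\<in>J. scale (c j) (f j)) = (\<Sum>b\<in>f ` J. scale (c (the_inv_into J f b)) b)"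
      by (subst sum.reindex[OF inj]) (auto intro!: sum.cong simp: the_inv_into_f_f[OF inj])
    with c show "\<exists>t c. finite t \<and> t \<subseteq> f ` J \<and> v - (\<Sum>b\<in>t. scale (c b) b) \<in> W"
      by (metis J finite_imageI subset_refl)
  qed
qed

lemma quotient_dim_family:
  assumes V: "subspace V" and W: "subspace W" and WV: "W \<subseteq> V"
    and fin: "finite D" "V \<subseteq> span D"
    and J: "finite J" and f: "\<And>j. j \<in> J \<Longrightarrow> f j \<in> V"
    and indep: "\<And>c j. (\<Sum>j\<in>J. scale (c j) (f j)) \<in> W \<Longrightarrow> j \<in> J \<Longrightarrow> c j = 0"
    and gen: "\<And>v. v \<in> V \<Longrightarrow> \<exists>c. v - (\<Sum>j\<in>J. scale (c j) (f j)) \<in> W"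
  shows "quotient_dim scale V W = card J"
proof -
  have b: "basis_mod scale V W (f ` J)" and inj: "inj_on f J"
    using basis_mod_family[of J f V W] assms by (auto simp: subspace_0)
  have "basis_mod scale V W (SOME B. basis_mod scale V W B)"
    using b by (rule someI)
  from basis_mod_card(2)[OF V W WV fin this] basis_mod_card(2)[OF V W WV fin b]
  show ?thesis
    unfolding quotient_dim_def using card_image[OF inj] by simp
qed

text \<open>Both \<open>x\<close> and \<open>v\<close> are congruent to multiples of a single
  element, and the multiple for \<open>x\<close> is nonzero. Applied to M^i modulo M^(i+1), it shows
  that a power x^i outside M^(i+1) generates the quotient.\<close>

lemma quotient_dim_eq_1D:
  assumes V: "subspace V" and W: "subspace W" and WV: "W \<subseteq> V"
    and 1: "quotient_dim scale V W = 1" and x: "x \<in> V" "x \<notin> W" and v: "v \<in> V"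
  shows "\<exists>c. v - scale c x \<in> W"
proof -
  define B where "B = (SOME B. basis_mod scale V W B)"
  have "basis_mod scale V W B"
    unfolding B_def using basis_mod_exists[OF W WV] by (rule someI_ex)
  moreover obtain b where Bb: "B = {b}"
    using 1 unfolding quotient_dim_def B_def[symmetric] by (auto simp: card_1_singleton_iff)
  ultimately have gen: "\<And>v. v \<in> V \<Longrightarrow> \<exists>t c. finite t \<and> t \<subseteq> {b} \<and> v - (\<Sum>b\<in>t. scale (c b) b) \<in> W"
    unfolding basis_mod_def by blast
  have g: "\<exists>c. v - scale c b \<in> W" if "v \<in> V" for v
  proof -
    obtain t c where t: "t \<subseteq> {b}" "v - (\<Sum>b\<in>t. scale (c b) b) \<in> W" using gen \<open>v \<in> V\<close> by blast
    then have "t = {} \<or> t = {b}" by blast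
    then show ?thesis
    proof
      assume "t = {}"
      then have "v - scale 0 b \<in> W" using t by simp
      then show ?thesis ..
    qed (use t in auto)
  qed
  obtain c where c: "x - scale c b \<in> W" using g x by blast
  then have c0: "c \<noteq> 0" using x by auto
  obtain d where d: "v - scale d b \<in> W" using g v by blast
  have "(v - scale d b) - scale (d / c) (x - scale c b) \<in> W"
    by (intro subspace_diff[OF W] subspace_scale[OF W] c d)
  also have "(v - scale d b) - scale (d / c) (x - scale c b) = v - scale (d / c) x"
    using c0 by (simp add: scale_right_diff_distrib)
  finally show ?thesis ..
qed

text \<open>Lets the generating property of a basis modulo \<open>W\<close> be checked on monomials
  only, since a subspace containing them contains their span.\<close>

lemma subspace_mod_family:
  assumes W: "subspace W"
  shows "subspace {v. \<exists>c. v - (\<Sum>j\<in>J. scale (c j) (f j)) \<in> W}"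
proof (rule subspaceI, goal_cases)
  case 1
  then show ?case by (auto intro!: exI[of _ "\<lambda>_. 0"] simp: subspace_0[OF W])
next
  case (2 v w)
  then obtain c d where "v - (\<Sum>j\<in>J. scale (c j) (f j)) \<in> W" "w - (\<Sum>j\<in>J. scale (d j) (f j)) \<in> W" by blast
  from subspace_add[OF W this] have "v + w - (\<Sum>j\<in>J. scale (c j + d j) (f j)) \<in> W"
    by (simp add: scale_left_distrib sum.distrib algebra_simps)
  then show ?case by (intro CollectI exI[of _ "\<lambda>j. c j + d j"])
next
  case (3 e v)
  then obtain c where "v - (\<Sum>j\<in>J. scale (c j) (f j)) \<in> W" by blast
  from subspace_scale[OF W this, of e] have "scale e v - (\<Sum>j\<in>J. scale (e * c j) (f j)) \<in> W"
    by (simp add: scale_right_diff_distrib scale_sum_right)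
  then show ?case by (intro CollectI exI[of _ "\<lambda>j. e * c j"])
qed

lemma span_familyE:
  assumes "finite J" "x \<in> span (f ` J)"
  obtains c where "x = (\<Sum>j\<in>J. scale (c j) (f j))"
proof -
  have "\<exists>c. x = (\<Sum>j\<in>J. scale (c j) (f j))"
    using assms(2)
  proof (induction rule: span_induct_alt)
    case base
    show ?case by (rule exI[of _ "\<lambda>_. 0"]) simp
  next
    case (step c y z)
    then obtain j d where j: "j \<in> J" "y = f j" and d: "z = (\<Sum>j\<in>J. scale (d j) (f j))" by blast
    have "scale c y + z = (\<Sum>i\<in>J. scale ((if i = j then c else 0) + d i) (f i))"
      using j assms(1) d by (simp add: scale_left_distrib sum.distrib if_distrib[of "\<lambda>c. scale c _"] cong: if_cong)
    then show ?case by (rule exI[where x = "\<lambda>i. (if i = j then c else 0) + d i"])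
  qed
  then show ?thesis using that by blast
qed

end

section \<open>Finite-dimensional local algebras\<close>

text \<open>Bridge from ideals of the ring record to arithmetic in the type class. Additive inverses
  come from multiplication by -1.\<close>

lemma ideal_ring_of_type_algebra_iff:
  "ideal I (ring_of_type_algebra :: 'a::comm_ring_1 ring) \<longleftrightarrow>
     0 \<in> I \<and> (\<forall>x\<in>I. \<forall>y\<in>I. x + y \<in> I) \<and> (\<forall>x\<in>I. \<forall>y. y * x \<in> I)"
  (is "ideal I ?R \<longleftrightarrow> ?P")
proof
  assume "ideal I ?R"
  then interpret ideal I ?R .
  show ?P
    using additive_subgroup.zero_closed[OF is_additive_subgroup]
      additive_subgroup.a_closed[OF is_additive_subgroup] I_l_closed
    by (auto simp: ring_of_type_algebra_def)
next
  assume P: ?P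
  interpret R: cring ?R by (rule cring_from_type_algebra)
  have neg: "- x \<in> I" if "x \<in> I" for x
    using P that by (metis mult_minus1)
  have inv: "inv\<^bsub>add_monoid ?R\<^esub> x = - x" for x
    using R.add.inv_equality[of "- x" x] unfolding a_inv_def
    by (simp add: ring_of_type_algebra_def)
  show "ideal I ?R"
  proof (rule idealI)
    show "subgroup I (add_monoid ?R)"
      unfolding subgroup_def using P neg inv by (auto simp: ring_of_type_algebra_def)
  qed (use P R.ring_axioms in \<open>auto simp: ring_of_type_algebra_def mult.commute\<close>)
qed

lemma max_ideal_pow_0 [simp]: "max_ideal_pow 0 = (UNIV :: 'a::comm_ring_1 set)"
  by (simp add: max_ideal_pow_def nat_pow_def ideals_set_def ring_of_type_algebra_def)

lemma max_ideal_pow_Suc: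
  "max_ideal_pow (Suc i) =
     ideal_prod (ring_of_type_algebra :: 'a::comm_ring_1 ring) (max_ideal_pow i) max_ideal"
  by (simp add: max_ideal_pow_def nat_pow_def ideals_set_def)

lemma max_ideal_pow_Suc_induct [consumes 1, case_names prod sum]:
  assumes "x \<in> (max_ideal_pow (Suc i) :: 'a::comm_ring_1 set)"
    and "\<And>y z :: 'a. y \<in> max_ideal_pow i \<Longrightarrow> z \<in> max_ideal \<Longrightarrow> P (y * z)"
    and "\<And>y z :: 'a. P y \<Longrightarrow> P z \<Longrightarrow> P (y + z)"
  shows "P x"
  using assms(1) unfolding max_ideal_pow_Suc
  by (induction rule: ideal_prod.induct) (use assms(2,3) in \<open>auto simp: ring_of_type_algebra_def\<close>)

lemma max_ideal_pow_prod:
  "x \<in> max_ideal_pow i \<Longrightarrow> y \<in> max_ideal \<Longrightarrow> x * y \<in> (max_ideal_pow (Suc i) :: 'a::comm_ring_1 set)"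
  unfolding max_ideal_pow_Suc
  using ideal_prod.prod[of x _ y _ "ring_of_type_algebra :: 'a ring"]
  by (simp add: ring_of_type_algebra_def)

section \<open>Scalars inside the algebra and evaluation of polynomials\<close>

context k_algebra
begin

lemma scale_mult_right: "x * scale c y = scale c (x * y)"
  by (metis mult.commute scale_mult_left)

lemma scale_one_mult: "scale c x = scale c 1 * x"
  by (simp add: scale_mult_left)

definition poly_at :: "'k poly \<Rightarrow> 'a \<Rightarrow> 'a" where
  "poly_at p x = poly (map_poly (\<lambda>c. scale c 1) p) x"

lemma poly_at_0 [simp]: "poly_at 0 x = 0"
  by (simp add: poly_at_def)

lemma poly_at_pCons [simp]: "poly_at (pCons c p) x = scale c 1 + x * poly_at p x"
  by (simp add: poly_at_def map_poly_pCons)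

lemma poly_at_add: "poly_at (p + q) x = poly_at p x + poly_at q x"
  by (induction p q rule: poly_induct2) (simp_all add: scale_left_distrib algebra_simps)

lemma poly_at_smult: "poly_at (smult c p) x = scale c (poly_at p x)"
  by (induction p) (simp_all add: scale_right_distrib scale_mult_right)

lemma poly_at_linear_mult: "poly_at ([:- c, 1:] * p) x = (x - scale c 1) * poly_at p x"
proof -
  have "[:- c, 1:] * p = smult (- c) p + pCons 0 p" by simp
  then show ?thesis
    by (simp only: poly_at_add poly_at_smult) (simp add: scale_mult_left algebra_simps)
qed

lemma poly_at_monom: "poly_at (monom c i) x = scale c (x ^ i)"
  by (induction i) (simp_all add: monom_0 monom_Suc scale_mult_right)

lemma poly_at_sum: "poly_at (\<Sum>i\<in>I. f i) x = (\<Sum>i\<in>I. poly_at (f i) x)"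
  by (induction I rule: infinite_finite_induct) (simp_all add: poly_at_add)

end

section \<open>Units, nilpotents and powers of the maximal ideal\<close>

context local_artinian_algebra
begin

abbreviation M :: "'a set" where "M \<equiv> max_ideal"
abbreviation Mpow :: "nat \<Rightarrow> 'a set" where "Mpow \<equiv> max_ideal_pow"

lemma maximalideal_M: "maximalideal M (ring_of_type_algebra :: 'a ring)"
  unfolding max_ideal_def using local by (rule theI')

lemma finite_spanning: obtains D where "finite D" "span D = UNIV"
  using finite_dim by blast

lemma finite_dimensional: "\<exists>Basis. finite_dimensional_vector_space scale Basis"
proof -
  obtain D where D: "finite D" "span D = UNIV" by (rule finite_spanning)
  obtain B where B: "B \<subseteq> UNIV" "independent B" "UNIV \<subseteq> span B"
    using basis_exists[of UNIV] by metis
  then have "finite B" using independent_span_bound[OF D(1) B(2)] D by simp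
  with B have "finite_dimensional_vector_space scale B" by unfold_locales auto
  then show ?thesis ..
qed

lemma subspace_dim_eqI:
  "subspace S \<Longrightarrow> subspace T \<Longrightarrow> S \<subseteq> T \<Longrightarrow> dim T \<le> dim S \<Longrightarrow> S = T"
proof -
  assume *: "subspace S" "subspace T" "S \<subseteq> T" "dim T \<le> dim S"
  obtain Basis where "finite_dimensional_vector_space scale Basis" using finite_dimensional by blast
  then interpret finite_dimensional_vector_space scale Basis .
  show ?thesis using * by (rule subspace_dim_equal)
qed

lemma dim_bound: obtains d where "\<And>S. dim S \<le> d"
proof -
  obtain Basis where "finite_dimensional_vector_space scale Basis" using finite_dimensional by blast
  then interpret finite_dimensional_vector_space scale Basis .
  show ?thesis using that dim_subset_UNIV by blast
qed

lemma ideal_subspace: "ideal I (ring_of_type_algebra :: 'a ring) \<Longrightarrow> subspace I"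
  unfolding ideal_ring_of_type_algebra_iff subspace_def by (metis scale_one_mult)

text \<open>Among the sets with property \<open>P\<close> that contain \<open>I\<close>, one of
  greatest dimension is maximal; finite dimension takes the place of a chain condition.\<close>

lemma maximal_element:
  assumes "P I" and "\<And>I. P I \<Longrightarrow> subspace I"
  shows "\<exists>J. P J \<and> I \<subseteq> J \<and> (\<forall>K. P K \<longrightarrow> J \<subseteq> K \<longrightarrow> K = J)"
proof -
  obtain d where d: "\<And>S. dim S \<le> d" using dim_bound by blast
  obtain J where J: "P J \<and> I \<subseteq> J" "\<And>K. P K \<and> I \<subseteq> K \<Longrightarrow> dim K \<le> dim J"
    using ex_has_greatest_nat[of "\<lambda>K. P K \<and> I \<subseteq> K" I dim "Suc d"] assms(1) d by (auto simp: le_imp_less_Suc)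
  have "K = J" if "P K" "J \<subseteq> K" for K
    using subspace_dim_eqI[of J K] assms(2) J that by (metis order_trans)
  with J show ?thesis by blast
qed

text \<open>A nonunit generates a proper ideal. A maximal ideal above it has to be \<open>M\<close>,
  because there is only one.\<close>

lemma unit_if_not_in_M: assumes "x \<notin> M" shows "\<exists>y. x * y = 1"
proof (rule ccontr)
  assume nu: "\<nexists>y. x * y = 1"
  let ?R = "ring_of_type_algebra :: 'a ring"
  let ?P = "\<lambda>I. ideal I ?R \<and> 1 \<notin> I"
  have "?P (range ((*) x))"
    unfolding ideal_ring_of_type_algebra_iff
  proof (intro conjI ballI allI)
    show "0 \<in> range ((*) x)" by (metis mult_zero_right rangeI)
    show "y + z \<in> range ((*) x)" if "y \<in> range ((*) x)" "z \<in> range ((*) x)" for y z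
      using that by (auto simp: image_iff) (metis distrib_left)
    show "z * y \<in> range ((*) x)" if "y \<in> range ((*) x)" for y z
      using that by (auto simp: image_iff) (metis mult.left_commute)
    show "1 \<notin> range ((*) x)" using nu by (metis imageE)
  qed
  then have "\<exists>J. ?P J \<and> range ((*) x) \<subseteq> J \<and> (\<forall>K. ?P K \<longrightarrow> J \<subseteq> K \<longrightarrow> K = J)"
    by (rule maximal_element[where P = ?P]) (erule conjE, rule ideal_subspace)
  then obtain J where J: "?P J" "range ((*) x) \<subseteq> J" and mx: "\<And>K. ?P K \<Longrightarrow> J \<subseteq> K \<Longrightarrow> K = J"
    by (elim exE conjE) metis
  have "maximalideal J ?R"
  proof (rule maximalidealI)
    show "ideal J ?R" using J by blast
    show "carrier ?R \<noteq> J" using J by (auto simp: ring_of_type_algebra_def)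
    fix K assume K: "ideal K ?R" "J \<subseteq> K" "K \<subseteq> carrier ?R"
    show "K = J \<or> K = carrier ?R"
    proof (cases "1 \<in> K")
      case True
      then have "y \<in> K" for y
        using K(1) unfolding ideal_ring_of_type_algebra_iff by (metis mult.right_neutral)
      then show ?thesis by (auto simp: ring_of_type_algebra_def)
    qed (use mx K in blast)
  qed
  then have "J = M" using local maximalideal_M by blast
  moreover have "x \<in> J" using J(2) by (metis mult.right_neutral rangeI subsetD)
  ultimately show False using assms by blast
qed

lemma ideal_M: "ideal M (ring_of_type_algebra :: 'a ring)"
  using maximalideal_M by (rule maximalideal.axioms(1))

lemma M_mult: "x \<in> M \<Longrightarrow> y * x \<in> M" "x \<in> M \<Longrightarrow> x * y \<in> M"
  using ideal_M unfolding ideal_ring_of_type_algebra_iff by (auto simp: mult.commute)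

lemma one_not_in_M: "1 \<notin> M"
proof
  assume "1 \<in> M"
  then have "M = UNIV" using M_mult(1) by (metis UNIV_eq_I mult.right_neutral)
  then show False
    using maximalideal.I_notcarr[OF maximalideal_M] by (simp add: ring_of_type_algebra_def)
qed

lemma subspace_M: "subspace M"
  using ideal_M by (rule ideal_subspace)

lemma scale_one_in_M_iff: "scale c 1 \<in> M \<longleftrightarrow> c = 0"
proof
  assume "scale c 1 \<in> M"
  then show "c = 0"
    using subspace_scale[OF subspace_M, of "scale c 1" "1 / c"] one_not_in_M by (cases "c = 0") auto
qed (simp add: subspace_0 subspace_M)

text \<open>\<open>card D + 1\<close> powers of \<open>x\<close> cannot be independent in a space
  spanned by \<open>D\<close>. Independence is a property of sets, so coinciding powers are treated
  separately: there X^i - X^j annihilates \<open>x\<close>.\<close>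

lemma annihilating_poly: obtains p where "p \<noteq> 0" "poly_at p x = 0"
proof -
  obtain D where D: "finite D" "span D = UNIV" by (rule finite_spanning)
  have "\<exists>p. p \<noteq> 0 \<and> poly_at p x = 0"
  proof (cases "inj_on (\<lambda>i. x ^ i) {..card D}")
    case True
    let ?S = "(\<lambda>i. x ^ i) ` {..card D}"
    have "card ?S = Suc (card D)" using True by (simp add: card_image)
    then have "dependent ?S"
      using independent_span_bound[OF D(1), of ?S] D(2) by (metis Suc_n_not_le_n top_greatest)
    then obtain u v where uv: "v \<in> ?S" "u v \<noteq> 0" "(\<Sum>v\<in>?S. scale (u v) v) = 0"
      using dependent_finite[of ?S] by auto
    define p where "p = (\<Sum>i\<le>card D. monom (u (x ^ i)) i)"
    have "poly_at p x = (\<Sum>v\<in>?S. scale (u v) v)"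
      unfolding p_def poly_at_sum poly_at_monom using True by (simp add: sum.reindex)
    moreover obtain i where i: "i \<le> card D" "v = x ^ i" using uv(1) by blast
    then have "coeff p i = u v"
      unfolding p_def coeff_sum by (simp add: sum.delta)
    ultimately show ?thesis using uv by (metis coeff_0)
  next
    case False
    then obtain i j where ij: "i \<noteq> j" "x ^ i = x ^ j" unfolding inj_on_def by blast
    define p where "p = (monom 1 i + monom (-1) j :: 'k poly)"
    have "coeff p i = 1" using ij by (simp add: p_def)
    then have "p \<noteq> 0" by force
    moreover have "poly_at p x = 0"
      using ij by (simp add: p_def poly_at_add poly_at_monom)
    ultimately show ?thesis by blast
  qed
  with that show ?thesis by blast
qed

text \<open>Write p = X^r q with q(0) \<noteq> 0. Then q(x) differs from a nonzero scalar by an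
  element of \<open>M\<close>, so it is a unit, and p(x) = 0 forces x^r = 0.\<close>

lemma M_nilpotent: assumes "x \<in> M" shows "\<exists>r. x ^ r = 0"
proof -
  have *: "\<exists>r u. p \<noteq> 0 \<longrightarrow> u \<notin> M \<and> poly_at p x = x ^ r * u" for p
  proof (induction p)
    case (pCons c p)
    show ?case
    proof (cases "c = 0")
      case True
      then have "p \<noteq> 0" using pCons by auto
      then obtain r u where "u \<notin> M" "poly_at p x = x ^ r * u" using pCons by blast
      then have "u \<notin> M" "poly_at (pCons c p) x = x ^ Suc r * u"
        using True by (simp_all add: mult.assoc)
      then show ?thesis by blast
    next
      case False
      have "scale c 1 + x * poly_at p x \<notin> M"
      proof
        assume "scale c 1 + x * poly_at p x \<in> M"
        from subspace_diff[OF subspace_M this M_mult(2)[OF assms, of "poly_at p x"]]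
        show False using False by (simp add: scale_one_in_M_iff)
      qed
      moreover have "poly_at (pCons c p) x = x ^ 0 * (scale c 1 + x * poly_at p x)" by simp
      ultimately show ?thesis by blast
    qed
  qed simp
  obtain p where "p \<noteq> 0" "poly_at p x = 0" by (rule annihilating_poly)
  with *[of p] obtain r u where u: "u \<notin> M" "x ^ r * u = 0" by metis
  then obtain v where "u * v = 1" using unit_if_not_in_M by blast
  then have "x ^ r = (x ^ r * u) * v" by (simp add: mult.assoc)
  with u show ?thesis by auto
qed

lemma nilpotent_in_M: assumes "x ^ r = 0" shows "x \<in> M"
proof (rule ccontr)
  assume "x \<notin> M"
  then obtain y where "x * y = 1" using unit_if_not_in_M by blast
  then have "1 = x ^ r * y ^ r" by (metis power_mult_distrib power_one)
  with assms show False by simp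
qed

lemma ideal_Mpow: "ideal (Mpow i) (ring_of_type_algebra :: 'a ring)"
proof (induction i)
  case 0
  show ?case by (simp add: ideal_ring_of_type_algebra_iff)
next
  case (Suc i)
  interpret R: cring "ring_of_type_algebra :: 'a ring" by (rule cring_from_type_algebra)
  show ?case unfolding max_ideal_pow_Suc using Suc ideal_M by (rule R.ideal_prod_is_ideal)
qed

lemma subspace_Mpow: "subspace (Mpow i)"
  using ideal_Mpow by (rule ideal_subspace)

lemma Mpow_absorb: "x \<in> Mpow i \<Longrightarrow> y * x \<in> Mpow i" "x \<in> Mpow i \<Longrightarrow> x * y \<in> Mpow i"
  using ideal_Mpow[of i] unfolding ideal_ring_of_type_algebra_iff by (auto simp: mult.commute)

lemma Mpow_Suc_subset: "Mpow (Suc i) \<subseteq> Mpow i"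
proof
  fix x assume "x \<in> Mpow (Suc i)"
  then show "x \<in> Mpow i"
    by (induction rule: max_ideal_pow_Suc_induct)
      (auto intro: Mpow_absorb subspace_add[OF subspace_Mpow])
qed

lemma Mpow_antimono: "i \<le> j \<Longrightarrow> Mpow j \<subseteq> Mpow i"
  using Mpow_Suc_subset by (rule lift_Suc_antimono_le)

lemma Mpow_1: "Mpow (Suc 0) = M"
proof
  show "Mpow (Suc 0) \<subseteq> M"
  proof
    fix x assume "x \<in> Mpow (Suc 0)"
    then show "x \<in> M"
      by (induction rule: max_ideal_pow_Suc_induct) (auto intro: M_mult subspace_add[OF subspace_M])
  qed
  show "M \<subseteq> Mpow (Suc 0)" using max_ideal_pow_prod[of 1 0] by auto
qed

lemma Mpow_mult: "x \<in> Mpow i \<Longrightarrow> y \<in> Mpow j \<Longrightarrow> x * y \<in> Mpow (i + j)"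
proof (induction j arbitrary: y)
  case 0
  then show ?case by (simp add: Mpow_absorb)
next
  case (Suc j)
  from Suc.prems(2) show ?case
  proof (induction rule: max_ideal_pow_Suc_induct)
    case (prod y z)
    from max_ideal_pow_prod[OF Suc.IH[OF Suc.prems(1) prod(1)] prod(2)]
    show ?case by (simp add: mult.assoc)
  next
    case (sum y z)
    then show ?case by (simp add: distrib_left subspace_add[OF subspace_Mpow])
  qed
qed

lemma M_power: "x \<in> M \<Longrightarrow> x ^ i \<in> Mpow i"
proof (induction i)
  case (Suc i)
  then show ?case using max_ideal_pow_prod[of "x ^ i" i x] by (simp add: mult.commute)
qed simp

text \<open>If the descending powers of \<open>M\<close> became stationary at some \<open>I \<noteq> 0\<close>, take a maximal proper
  subideal \<open>J\<close> of \<open>I\<close>. For \<open>x \<in> M\<close> the ideal \<open>x I + J\<close> is \<open>J\<close> since \<open>x\<close> is nilpotent,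
  whence \<open>I = M I \<subseteq> J\<close>.\<close>

lemma Mpow_eventually_0: "\<exists>N. Mpow N = {0}"
proof -
  obtain N where N: "\<And>i. dim (Mpow N) \<le> dim (Mpow i)"
    using ex_has_least_nat[of "\<lambda>_. True" 0 "\<lambda>i. dim (Mpow i)"] by auto
  define I where "I = Mpow N"
  have stable: "Mpow (Suc N) = I"
    unfolding I_def using N by (intro subspace_dim_eqI subspace_Mpow Mpow_Suc_subset)
  have "I = {0}"
  proof (rule ccontr)
    assume "I \<noteq> {0}"
    let ?R = "ring_of_type_algebra :: 'a ring"
    let ?P = "\<lambda>J. ideal J ?R \<and> J \<subseteq> I \<and> J \<noteq> I"
    have sub: "\<And>J. ?P J \<Longrightarrow> subspace J" using ideal_subspace by blast
    have "?P {0}"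
      using \<open>I \<noteq> {0}\<close> subspace_0[OF subspace_Mpow, of N]
      unfolding I_def ideal_ring_of_type_algebra_iff by auto
    then have "\<exists>J. ?P J \<and> {0} \<subseteq> J \<and> (\<forall>K. ?P K \<longrightarrow> J \<subseteq> K \<longrightarrow> K = J)"
      by (rule maximal_element[where P = ?P]) (fact sub)
    then obtain J where J: "?P J" and mx: "\<And>K. ?P K \<Longrightarrow> J \<subseteq> K \<Longrightarrow> K = J"
      by (elim exE conjE) metis
    have idI: "ideal I ?R" unfolding I_def by (rule ideal_Mpow)
    have xI: "x * y \<in> J" if x: "x \<in> M" and y: "y \<in> I" for x y
    proof -
      define K where "K = {x * z + j | z j. z \<in> I \<and> j \<in> J}"
      have J': "0 \<in> J" "\<And>x y. x \<in> J \<Longrightarrow> y \<in> J \<Longrightarrow> x + y \<in> J" "\<And>x y. x \<in> J \<Longrightarrow> y * x \<in> J" "J \<subseteq> I"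
        using J unfolding ideal_ring_of_type_algebra_iff by auto
      have I': "0 \<in> I" "\<And>x y. x \<in> I \<Longrightarrow> y \<in> I \<Longrightarrow> x + y \<in> I" "\<And>x y. x \<in> I \<Longrightarrow> y * x \<in> I"
        using idI unfolding ideal_ring_of_type_algebra_iff by auto
      have JK: "J \<subseteq> K"
      proof
        fix j assume "j \<in> J"
        then have "x * 0 + j \<in> K" unfolding K_def using I' by blast
        then show "j \<in> K" by simp
      qed
      have idK: "ideal K ?R"
        unfolding ideal_ring_of_type_algebra_iff
      proof (intro conjI ballI allI)
        show "0 \<in> K" using JK J' by blast
        show "a + b \<in> K" if ab: "a \<in> K" "b \<in> K" for a b
        proof -
          obtain z j w l where "a = x * z + j" "z \<in> I" "j \<in> J" "b = x * w + l" "w \<in> I" "l \<in> J"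
            using ab unfolding K_def by blast
          then have "a + b = x * (z + w) + (j + l)" "z + w \<in> I" "j + l \<in> J"
            using I' J' by (auto simp: algebra_simps)
          then show ?thesis unfolding K_def by blast
        qed
        show "b * a \<in> K" if a: "a \<in> K" for a b
        proof -
          obtain z j where "a = x * z + j" "z \<in> I" "j \<in> J"
            using a unfolding K_def by blast
          then have "b * a = x * (b * z) + b * j" "b * z \<in> I" "b * j \<in> J"
            using I'(3)[of z b] J'(3)[of j b] by (auto simp: algebra_simps)
          then show ?thesis unfolding K_def by blast
        qed
      qed
      have KI: "K \<subseteq> I"
      proof
        fix a assume "a \<in> K"
        then obtain z j where "a = x * z + j" "z \<in> I" "j \<in> J" unfolding K_def by blast
        then show "a \<in> I" using I'(2)[of "x * z" j] I'(3)[of z x] J'(4) by auto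
      qed
      have "K \<noteq> I"
      proof
        assume "K = I"
        have "\<exists>z\<in>I. v - x ^ r * z \<in> J" if "v \<in> I" for v r
        proof (induction r)
          case 0
          show ?case using that J'(1) by (intro bexI[of _ v]) auto
        next
          case (Suc r)
          then obtain z where z: "z \<in> I" "v - x ^ r * z \<in> J" by blast
          then obtain w j where w: "z = x * w + j" "w \<in> I" "j \<in> J"
            using \<open>K = I\<close> unfolding K_def by blast
          have "v - x ^ Suc r * w = (v - x ^ r * z) + x ^ r * j"
            using w by (simp add: algebra_simps)
          moreover have "(v - x ^ r * z) + x ^ r * j \<in> J"
            using J'(2)[OF z(2) J'(3)[OF w(3)]] .
          ultimately have "v - x ^ Suc r * w \<in> J" by (rule ssubst)
          then show ?case using w by blast
        qed
        moreover obtain r where "x ^ r = 0" using M_nilpotent x by blast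
        ultimately have "I \<subseteq> J" by (metis diff_zero mult_zero_left subsetI)
        then show False using J by blast
      qed
      then have "K = J" using mx idK KI JK by blast
      moreover have "x * y + 0 \<in> K" unfolding K_def using y J' by blast
      ultimately show ?thesis by simp
    qed
    have "I \<subseteq> J"
    proof
      fix v assume "v \<in> I"
      then have "v \<in> Mpow (Suc N)" using stable by simp
      then show "v \<in> J"
      proof (induction rule: max_ideal_pow_Suc_induct)
        case (prod y z)
        then show ?case using xI[of z y] by (simp add: I_def mult.commute)
      next
        case (sum y z)
        then show ?case using J unfolding ideal_ring_of_type_algebra_iff by blast
      qed
    qed
    then show False using J by blast
  qed
  then show ?thesis unfolding I_def by blast
qed

text \<open>The powers of \<open>M\<close> decrease and reach 0, so the exponents of the nonzero
  ones form a finite initial segment, whose greatest element is recognised by one step.\<close>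

lemma sdeg_iff: "s = sdeg TYPE('a) \<longleftrightarrow> Mpow s \<noteq> {0} \<and> Mpow (Suc s) = {0}"
proof -
  let ?P = "\<lambda>i. Mpow i \<noteq> {0}"
  obtain N where N: "Mpow N = {0}" using Mpow_eventually_0 by blast
  have mono: "Mpow i = {0}" if "i \<ge> j" "Mpow j = {0}" for i j
    using Mpow_antimono[OF that(1)] that(2) subspace_0[OF subspace_Mpow, of i] by blast
  have P0: "?P 0" using one_not_in_M subspace_0[OF subspace_M] by (metis UNIV_I max_ideal_pow_0 singletonD)
  have b: "\<forall>i. ?P i \<longrightarrow> i \<le> N" using mono N by (meson nat_le_linear)
  have G: "?P (sdeg TYPE('a))" unfolding sdeg_def by (rule GreatestI_nat[of ?P, OF P0]) (use b in blast)
  have Gle: "i \<le> sdeg TYPE('a)" if "?P i" for i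
    unfolding sdeg_def by (rule Greatest_le_nat[of ?P, OF that]) (use b in blast)
  show ?thesis
  proof
    assume "s = sdeg TYPE('a)"
    then show "Mpow s \<noteq> {0} \<and> Mpow (Suc s) = {0}" using G Gle[of "Suc s"] by auto
  next
    assume s: "Mpow s \<noteq> {0} \<and> Mpow (Suc s) = {0}"
    then show "s = sdeg TYPE('a)"
      using Gle[of s] mono[of "Suc s" "sdeg TYPE('a)"] G by (meson le_antisym not_less_eq_eq)
  qed
qed

lemma hilbert_family:
  assumes "finite J" and "\<And>j. j \<in> J \<Longrightarrow> f j \<in> Mpow i"
    and "\<And>c j. (\<Sum>j\<in>J. scale (c j) (f j)) \<in> Mpow (Suc i) \<Longrightarrow> j \<in> J \<Longrightarrow> c j = 0"
    and "\<And>v. v \<in> Mpow i \<Longrightarrow> \<exists>c. v - (\<Sum>j\<in>J. scale (c j) (f j)) \<in> Mpow (Suc i)"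
  shows "hilbert scale i = card J"
proof -
  obtain D where D: "finite D" "span D = UNIV" by (rule finite_spanning)
  then have "Mpow i \<subseteq> span D" by simp
  with D(1) show ?thesis
    unfolding hilbert_def
    by (rule quotient_dim_family[OF subspace_Mpow subspace_Mpow Mpow_Suc_subset]) (fact assms)+
qed

end

text \<open>An annihilating polynomial of \<open>x\<close> has a root c. Either x - c lies in
  \<open>M\<close>, or it is a unit and the factor X - c cancels. This cannot go on down to degree
  0, as a nonzero constant annihilates nothing.\<close>

lemma (in gorenstein_local_artinian_algebra) residue:
  "\<exists>c. x - scale c 1 \<in> M"
proof -
  have "\<exists>c. x - scale c 1 \<in> M" if "p \<noteq> 0" "poly_at p x = 0" for p
    using that
  proof (induction "degree p" arbitrary: p rule: less_induct)
    case less
    show ?case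
    proof (cases "degree p > 0")
      case True
      then obtain c where c: "poly p c = 0" using alg_closed_imp_poly_has_root by blast
      then obtain q where q: "p = [:- c, 1:] * q" by (auto simp: poly_eq_0_iff_dvd)
      show ?thesis
      proof (cases "x - scale c 1 \<in> M")
        case False
        then obtain y where "(x - scale c 1) * y = 1" using unit_if_not_in_M by blast
        then have "poly_at q x = y * ((x - scale c 1) * poly_at q x)"
          by (simp add: mult.assoc[symmetric] mult.commute)
        also have "\<dots> = 0" using less.prems(2) q by (simp only: poly_at_linear_mult mult_zero_right)
        finally have "poly_at q x = 0" .
        moreover have "q \<noteq> 0" using q less.prems by auto
        moreover have "degree q < degree p" using degree_mult_eq[of "[:- c, 1:]" q] q \<open>q \<noteq> 0\<close> by (simp del: mult_pCons_left)
        ultimately show ?thesis using less.hyps by blast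
      qed blast
    next
      case False
      then obtain c where "p = [:c:]" using degree_eq_zeroE[of p] by auto
      then show ?thesis using less.prems by simp
    qed
  qed
  then show ?thesis using annihilating_poly by metis
qed

section \<open>Power series and contraction\<close>

definition expo_deg :: "(nat \<Rightarrow>\<^sub>0 nat) \<Rightarrow> nat" where
  "expo_deg \<alpha> = (\<Sum>i\<in>keys \<alpha>. lookup \<alpha> i)"

lemma keys_add_nat: "keys (\<alpha> + \<beta>) = keys \<alpha> \<union> keys (\<beta> :: 'i \<Rightarrow>\<^sub>0 nat)"
  by (auto simp: in_keys_iff lookup_add)

lemma expo_deg_superset:
  "finite S \<Longrightarrow> keys \<alpha> \<subseteq> S \<Longrightarrow> expo_deg \<alpha> = (\<Sum>i\<in>S. lookup \<alpha> i)"
  unfolding expo_deg_def by (rule sum.mono_neutral_left) (auto simp: in_keys_iff)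

lemma expo_deg_add: "expo_deg (\<alpha> + \<beta>) = expo_deg \<alpha> + expo_deg \<beta>"
proof -
  let ?S = "keys \<alpha> \<union> keys \<beta>"
  have "expo_deg (\<alpha> + \<beta>) = (\<Sum>i\<in>?S. lookup \<alpha> i + lookup \<beta> i)"
    by (subst expo_deg_superset[of ?S]) (auto simp: keys_add_nat lookup_add)
  also have "\<dots> = expo_deg \<alpha> + expo_deg \<beta>"
    by (simp add: sum.distrib expo_deg_superset[of ?S \<alpha>] expo_deg_superset[of ?S \<beta>])
  finally show ?thesis .
qed

lemma expo_deg_0 [simp]: "expo_deg 0 = 0"
  by (simp add: expo_deg_def)

lemma expo_deg_single [simp]: "expo_deg (single i k) = k"
  by (simp add: expo_deg_def)

lemma expo_deg_eq_0_iff [simp]: "expo_deg \<alpha> = 0 \<longleftrightarrow> \<alpha> = 0"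
proof
  assume "expo_deg \<alpha> = 0"
  then show "\<alpha> = 0"
    unfolding expo_deg_def by (intro poly_mapping_eqI) (auto simp: in_keys_iff)
qed simp

lemma expo_split:
  assumes "i \<in> keys \<alpha>"
  obtains \<beta> :: "nat \<Rightarrow>\<^sub>0 nat" where "\<alpha> = single i 1 + \<beta>"
proof
  show "\<alpha> = single i 1 + (\<alpha> - single i 1)"
    using assms by (intro poly_mapping_eqI) (auto simp: lookup_add lookup_minus lookup_single when_def in_keys_iff)
qed

lemma expo_nonzero_split:
  assumes "\<alpha> \<noteq> 0"
  obtains i and \<beta> :: "nat \<Rightarrow>\<^sub>0 nat" where "\<alpha> = single i 1 + \<beta>"
proof -
  obtain i where "i \<in> keys \<alpha>" using assms by fastforce
  then show ?thesis using expo_split that by metis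
qed

text \<open>With i = 1 this is the recurring case distinction: a monomial is a power of the first
  variable, or another variable can be split off.\<close>

lemma expo_single_or_split:
  obtains "\<alpha> = single i (expo_deg \<alpha>)"
  | j and \<beta> :: "nat \<Rightarrow>\<^sub>0 nat" where "j \<noteq> i" "\<alpha> = single j 1 + \<beta>"
proof (cases "keys \<alpha> \<subseteq> {i}")
  case True
  then have "\<alpha> = single i (lookup \<alpha> i)"
    by (intro poly_mapping_eqI) (auto simp: lookup_single when_def in_keys_iff)
  then show ?thesis using that(1) expo_deg_single by metis
next
  case False
  then obtain j where "j \<in> keys \<alpha>" "j \<noteq> i" by blast
  then show ?thesis using that(2) expo_split by metis
qed

lemma finite_bounded_expos: "finite {\<alpha>. keys \<alpha> \<subseteq> {1..n} \<and> expo_deg \<alpha> \<le> N}"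
proof -
  let ?S = "{f. \<forall>i. (i \<in> {1..n} \<longrightarrow> f i \<in> {..N}) \<and> (i \<notin> {1..n} \<longrightarrow> f i = (0::nat))}"
  have "finite ?S" by (rule finite_set_of_finite_funs) simp_all
  moreover have "lookup ` {\<alpha>. keys \<alpha> \<subseteq> {1..n} \<and> expo_deg \<alpha> \<le> N} \<subseteq> ?S"
  proof clarify
    fix \<alpha> :: "nat \<Rightarrow>\<^sub>0 nat" and i assume a: "keys \<alpha> \<subseteq> {1..n}" "expo_deg \<alpha> \<le> N"
    have "lookup \<alpha> i \<le> expo_deg \<alpha>" if "i \<in> {1..n}"
      using a(1) that by (subst expo_deg_superset[of "{1..n}"]) (auto intro: member_le_sum)
    with a show "(i \<in> {1..n} \<longrightarrow> lookup \<alpha> i \<in> {..N}) \<and>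
        (i \<notin> {1..n} \<longrightarrow> lookup \<alpha> i = 0)"
      by (auto simp: in_keys_iff)
  qed
  moreover have "inj_on lookup {\<alpha>. keys \<alpha> \<subseteq> {1..n} \<and> expo_deg \<alpha> \<le> N}"
    by (simp add: inj_on_def)
  ultimately show ?thesis by (meson finite_imageD finite_subset)
qed

section \<open>Divided powers and the differentiation action in these coordinates\<close>

definition expo_fact :: "(nat \<Rightarrow>\<^sub>0 nat) \<Rightarrow> 'k::field_char_0" where
  "expo_fact \<alpha> = (\<Prod>i\<in>keys \<alpha>. fact (lookup \<alpha> i))"

lemma expo_fact_nonzero [simp]: "expo_fact \<alpha> \<noteq> 0"
  by (simp add: expo_fact_def)

lemma expo_fact_superset:
  "finite S \<Longrightarrow> keys \<alpha> \<subseteq> S \<Longrightarrow> expo_fact \<alpha> = (\<Prod>i\<in>S. fact (lookup \<alpha> i))"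
  unfolding expo_fact_def by (rule prod.mono_neutral_left) (auto simp: in_keys_iff)

lemma expo_fact_single [simp]: "expo_fact (single i k) = fact k"
  by (simp add: expo_fact_def)

text \<open>Differentiating y^(\<gamma> + e_i) by y_i produces the same factor; this is why no
  factor is left in \<open>dcoeff_pdiff\<close>.\<close>

lemma expo_fact_add_single:
  "expo_fact (\<gamma> + single i 1) = of_nat (Suc (lookup \<gamma> i)) * expo_fact \<gamma>"
proof -
  let ?S = "insert i (keys \<gamma>)"
  have "expo_fact (\<gamma> + single i 1) =
      (\<Prod>j\<in>?S. fact (lookup (\<gamma> + single i 1) j))"
    by (rule expo_fact_superset) (auto simp: keys_add_nat)
  also have "\<dots> = fact (Suc (lookup \<gamma> i)) *
      (\<Prod>j\<in>keys \<gamma> - {i}. fact (lookup (\<gamma> + single i 1) j))"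
    by (subst prod.insert_remove) (simp_all add: lookup_add)
  also have "(\<Prod>j\<in>keys \<gamma> - {i}. fact (lookup (\<gamma> + single i 1) j)) =
      (\<Prod>j\<in>keys \<gamma> - {i}. fact (lookup \<gamma> j))"
    by (intro prod.cong) (auto simp: lookup_add lookup_single when_def)
  also have "fact (Suc (lookup \<gamma> i)) * \<dots> = of_nat (Suc (lookup \<gamma> i)) *
      (\<Prod>j\<in>?S. fact (lookup \<gamma> j))"
    by (subst prod.insert_remove) (simp_all add: mult.assoc)
  also have "(\<Prod>j\<in>?S. fact (lookup \<gamma> j)) = expo_fact \<gamma>"
    by (rule expo_fact_superset[symmetric]) auto
  finally show ?thesis .
qed

text \<open>The coefficients with respect to the divided powers \<open>y\<^sup>\<alpha> / \<alpha>!\<close>: in these coordinates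
  differentiation by \<open>x\<^sup>\<beta>\<close> just shifts the exponent.\<close>

definition dcoeff :: "'k::field_char_0 mpoly \<Rightarrow> (nat \<Rightarrow>\<^sub>0 nat) \<Rightarrow> 'k" where
  "dcoeff F \<alpha> = expo_fact \<alpha> * lookup F \<alpha>"

lemma dcoeff_eqI: "(\<And>\<alpha>. dcoeff F \<alpha> = dcoeff G \<alpha>) \<Longrightarrow> F = G"
  by (intro poly_mapping_eqI) (simp add: dcoeff_def)

lemma dcoeff_0 [simp]: "dcoeff 0 \<alpha> = 0"
  by (simp add: dcoeff_def)

lemma dcoeff_eq_0_iff: "dcoeff F \<alpha> = 0 \<longleftrightarrow> \<alpha> \<notin> keys F"
  by (simp add: dcoeff_def in_keys_iff)

lemma dcoeff_add: "dcoeff (F + G) \<alpha> = dcoeff F \<alpha> + dcoeff G \<alpha>"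
  by (simp add: dcoeff_def lookup_add algebra_simps)

lemma dcoeff_sum: "dcoeff (\<Sum>i\<in>I. F i) \<alpha> = (\<Sum>i\<in>I. dcoeff (F i) \<alpha>)"
  by (simp add: dcoeff_def lookup_sum sum_distrib_left)

lemma lookup_cst_mult: "lookup (cst c * F) \<alpha> = c * lookup F \<alpha>"
proof (cases "c = 0")
  case False
  have "cst c * F = Poly_Mapping.map ((*) c) F"
    unfolding cst_def by (rule mult_map_scale_conv_mult[symmetric])
  then show ?thesis by (simp add: Poly_Mapping.map.rep_eq when_def)
qed (simp add: cst_def)

lemma dcoeff_cst_mult: "dcoeff (cst c * F) \<alpha> = c * dcoeff F \<alpha>"
  by (simp add: dcoeff_def lookup_cst_mult)

lemma dcoeff_pdiff: "dcoeff (pdiff i F) \<gamma> = dcoeff F (\<gamma> + single i 1)"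
proof -
  have "lookup (pdiff i F) \<gamma> =
      (\<Sum>\<beta>\<in>keys F. if \<beta> = \<gamma> + single i 1
         then of_nat (lookup \<beta> i) * lookup F \<beta> else 0)"
    unfolding pdiff_def lookup_sum
  proof (intro sum.cong refl)
    fix \<beta>
    show "lookup (single (\<beta> - single i 1)
        (of_nat (lookup \<beta> i) * lookup F \<beta>)) \<gamma> =
        (if \<beta> = \<gamma> + single i 1
         then of_nat (lookup \<beta> i) * lookup F \<beta> else 0)"
    proof (cases "lookup \<beta> i = 0")
      case False
      then obtain \<delta> where "\<beta> = single i 1 + \<delta>"
        using expo_split[of i \<beta>] by (auto simp: in_keys_iff)
      then show ?thesis by (auto simp: lookup_single when_def add.commute)
    qed (auto simp: lookup_add)
  qed
  also have "\<dots> = of_nat (Suc (lookup \<gamma> i)) *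
      lookup F (\<gamma> + single i 1)"
    by (simp add: sum.delta lookup_add in_keys_iff)
  finally show ?thesis
    unfolding dcoeff_def expo_fact_add_single by simp
qed

lemma dcoeff_mono_diff: "dcoeff (mono_diff \<alpha> F) \<gamma> = dcoeff F (\<gamma> + \<alpha>)"
proof -
  have pow: "dcoeff ((pdiff i ^^ k) F) \<gamma> = dcoeff F (\<gamma> + single i k)" for i k \<gamma> F
  proof (induction k arbitrary: \<gamma>)
    case (Suc k)
    show ?case
      using Suc[of "\<gamma> + single i 1"]
      by (simp add: dcoeff_pdiff add.assoc flip: single_add)
  qed simp
  have *: "dcoeff (fold (\<lambda>i. pdiff i ^^ lookup \<alpha> i) xs F) \<gamma> =
      dcoeff F (\<gamma> + (\<Sum>i\<leftarrow>xs. single i (lookup \<alpha> i)))" for xs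
    by (induction xs arbitrary: F) (simp_all add: pow ac_simps)
  have "(\<Sum>i\<leftarrow>sorted_list_of_set (keys \<alpha>).
          single i (lookup \<alpha> i)) = \<alpha>"
    by (subst sum_list_distinct_conv_sum_set)
       (auto intro!: poly_mapping_eqI simp: lookup_sum lookup_single when_def in_keys_iff)
  with * show ?thesis unfolding mono_diff_def by simp
qed

text \<open>The finite set \<open>T\<close> is left open because different ones suit different uses:
  the divisors of monomials of \<open>F\<close>, or the exponents whose monomials survive in the
  algebra.\<close>

lemma dcoeff_act:
  assumes T: "finite T" "\<And>\<alpha>. \<alpha> \<notin> T \<Longrightarrow> dcoeff F (\<gamma> + \<alpha>) = 0"
  shows "dcoeff (g \<circ>\<^sub>\<partial> F) \<gamma> = (\<Sum>\<alpha>\<in>T. g \<alpha> * dcoeff F (\<gamma> + \<alpha>))"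
proof -
  let ?S = "T \<union> {\<alpha>. mono_diff \<alpha> F \<noteq> 0}"
  have fin: "finite ?S" using T finite_mono_diff by blast
  have "g \<circ>\<^sub>\<partial> F = (\<Sum>\<alpha>\<in>?S. cst (g \<alpha>) * mono_diff \<alpha> F)"
    unfolding act_def by (rule Sum_any.expand_superset[OF fin]) auto
  then have "dcoeff (g \<circ>\<^sub>\<partial> F) \<gamma> = (\<Sum>\<alpha>\<in>?S. g \<alpha> * dcoeff F (\<gamma> + \<alpha>))"
    by (simp add: dcoeff_sum dcoeff_cst_mult dcoeff_mono_diff)
  also have "\<dots> = (\<Sum>\<alpha>\<in>T. g \<alpha> * dcoeff F (\<gamma> + \<alpha>))"
    using fin T by (intro sum.mono_neutral_right) auto
  finally show ?thesis .
qed

lemma finite_divisors: "finite {\<alpha>. \<exists>\<beta>. \<alpha> + \<beta> \<in> keys (F :: 'k::field mpoly)}"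
proof (rule finite_subset)
  show "{\<alpha>. \<exists>\<beta>. \<alpha> + \<beta> \<in> keys F} \<subseteq>
      (\<Union>\<gamma>\<in>keys F. fst ` {(\<alpha>, \<beta>). \<alpha> + \<beta> = \<gamma>})"
    by (force simp: image_iff)
qed (intro finite_UN_I finite_imageI finite_decompositions, simp)

abbreviation mps_mult :: "'k::field mps \<Rightarrow> 'k mps \<Rightarrow> 'k mps" where
  "mps_mult f g \<equiv> (\<lambda>\<gamma>. \<Sum>(\<alpha>, \<beta>)\<in>{(\<alpha>, \<beta>). \<alpha> + \<beta> = \<gamma>}. f \<alpha> * g \<beta>)"

lemma dcoeff_act_divisors:
  "dcoeff (g \<circ>\<^sub>\<partial> F) \<gamma> =
     (\<Sum>\<alpha>\<in>{\<alpha>. \<exists>\<beta>. \<alpha> + \<beta> \<in> keys F}. g \<alpha> * dcoeff F (\<gamma> + \<alpha>))"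
  by (rule dcoeff_act[OF finite_divisors]) (auto simp: dcoeff_eq_0_iff add.commute)

text \<open>Both sides sum f(\<beta>) g(\<delta>) times the divided coefficient of \<open>F\<close>
  at \<gamma> + \<beta> + \<delta>. The set \<open>T\<close> of divisors of monomials of
  \<open>F\<close> is closed under divisors, so pairs with sum in \<open>T\<close> lie in T \<times>
  T, and the other pairs in there contribute 0.\<close>

lemma act_mult: "mps_mult f g \<circ>\<^sub>\<partial> F = f \<circ>\<^sub>\<partial> (g \<circ>\<^sub>\<partial> (F :: 'k::field_char_0 mpoly))"
proof (rule dcoeff_eqI)
  fix \<gamma>
  define T where "T = {\<alpha>. \<exists>\<beta>. \<alpha> + \<beta> \<in> keys F}"
  have fin: "finite T" unfolding T_def by (rule finite_divisors)
  have act_T: "dcoeff (g \<circ>\<^sub>\<partial> F) \<gamma> = (\<Sum>\<alpha>\<in>T. g \<alpha> * dcoeff F (\<gamma> + \<alpha>))" for g \<gamma>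
    unfolding T_def by (rule dcoeff_act_divisors)
  have down: "\<alpha> \<in> T" "\<beta> \<in> T" if T: "\<alpha> + \<beta> \<in> T" for \<alpha> \<beta>
  proof -
    obtain \<delta> where d: "(\<alpha> + \<beta>) + \<delta> \<in> keys F" using T unfolding T_def by blast
    then have "\<alpha> + (\<beta> + \<delta>) \<in> keys F" "\<beta> + (\<alpha> + \<delta>) \<in> keys F"
      by (simp_all add: ac_simps)
    then show "\<alpha> \<in> T" "\<beta> \<in> T" unfolding T_def by blast+
  qed
  have z: "dcoeff F (\<gamma> + \<alpha>) = 0" if "\<alpha> \<notin> T" for \<alpha> \<gamma>
    using that unfolding T_def by (auto simp: dcoeff_eq_0_iff add.commute)
  let ?D = "\<lambda>\<alpha>. {(\<beta>, \<delta>). \<beta> + \<delta> = (\<alpha> :: nat \<Rightarrow>\<^sub>0 nat)}"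
  have "dcoeff (mps_mult f g \<circ>\<^sub>\<partial> F) \<gamma> =
      (\<Sum>\<alpha>\<in>T. \<Sum>p\<in>?D \<alpha>. f (fst p) * g (snd p) * dcoeff F (\<gamma> + \<alpha>))"
    unfolding act_T by (simp add: sum_distrib_right case_prod_unfold)
  also have "\<dots> = (\<Sum>(\<alpha>, p)\<in>(SIGMA \<alpha>:T. ?D \<alpha>). f (fst p) * g (snd p) * dcoeff F (\<gamma> + \<alpha>))"
    using fin finite_decompositions by (intro sum.Sigma) auto
  also have "\<dots> = (\<Sum>p\<in>{p. fst p + snd p \<in> T}. f (fst p) * g (snd p) * dcoeff F (\<gamma> + (fst p + snd p)))"
    by (rule sum.reindex_bij_witness[of _ "\<lambda>p. (fst p + snd p, p)" snd]) auto
  also have "\<dots> = (\<Sum>p\<in>T \<times> T. f (fst p) * g (snd p) * dcoeff F (\<gamma> + (fst p + snd p)))"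
  proof (rule sum.mono_neutral_left)
    show "{p. fst p + snd p \<in> T} \<subseteq> T \<times> T"
      using down by (metis (mono_tags, lifting) mem_Collect_eq mem_Times_iff subsetI)
  qed (use fin z in auto)
  also have "\<dots> = (\<Sum>\<beta>\<in>T. \<Sum>\<delta>\<in>T. f \<beta> * g \<delta> * dcoeff F (\<gamma> + (\<beta> + \<delta>)))"
    by (simp add: sum.cartesian_product case_prod_unfold)
  also have "\<dots> = (\<Sum>\<beta>\<in>T. f \<beta> * dcoeff (g \<circ>\<^sub>\<partial> F) (\<gamma> + \<beta>))"
    unfolding act_T[of g] sum_distrib_left by (simp add: ac_simps)
  also have "\<dots> = dcoeff (f \<circ>\<^sub>\<partial> (g \<circ>\<^sub>\<partial> F)) \<gamma>"
  proof (rule dcoeff_act[symmetric])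
    fix \<alpha> assume "\<alpha> \<notin> T"
    then have "\<alpha> + \<beta> \<notin> T" for \<beta> using down(1) by metis
    then show "dcoeff (g \<circ>\<^sub>\<partial> F) (\<gamma> + \<alpha>) = 0"
      unfolding act_T using z by (simp add: add.assoc)
  qed (rule fin)
  finally show "dcoeff (mps_mult f g \<circ>\<^sub>\<partial> F) \<gamma> = dcoeff (f \<circ>\<^sub>\<partial> (g \<circ>\<^sub>\<partial> F)) \<gamma>" .
qed

lemma act_add: "(\<lambda>\<alpha>. f \<alpha> + g \<alpha>) \<circ>\<^sub>\<partial> F = f \<circ>\<^sub>\<partial> F + g \<circ>\<^sub>\<partial> (F :: 'k::field_char_0 mpoly)"
  by (rule dcoeff_eqI) (simp add: dcoeff_act_divisors dcoeff_add algebra_simps sum.distrib)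

lemma act_0 [simp]: "g \<circ>\<^sub>\<partial> (0 :: 'k::field_char_0 mpoly) = 0" "(\<lambda>_. 0) \<circ>\<^sub>\<partial> (F :: 'k::field_char_0 mpoly) = 0"
  by (rule dcoeff_eqI, simp add: dcoeff_act_divisors)+

section \<open>The power series ring and its annihilator ideals\<close>

lemma mps_mult_commute: "mps_mult f g = mps_mult g f"
proof
  fix \<gamma>
  show "mps_mult f g \<gamma> = mps_mult g f \<gamma>"
    by (rule sum.reindex_bij_witness[of _ "\<lambda>(\<alpha>, \<beta>). (\<beta>, \<alpha>)" "\<lambda>(\<alpha>, \<beta>). (\<beta>, \<alpha>)"]) (auto simp: ac_simps)
qed

lemma mps_mult_assoc: "mps_mult (mps_mult f g) h = mps_mult f (mps_mult g h)"
proof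
  fix \<gamma>
  let ?D = "\<lambda>\<gamma>. {(\<alpha>, \<beta>). \<alpha> + \<beta> = (\<gamma> :: nat \<Rightarrow>\<^sub>0 nat)}"
  have "mps_mult (mps_mult f g) h \<gamma> = (\<Sum>p\<in>?D \<gamma>. \<Sum>q\<in>?D (fst p). f (fst q) * g (snd q) * h (snd p))"
    by (simp add: case_prod_unfold sum_distrib_right)
  also have "\<dots> = (\<Sum>(p, q)\<in>(SIGMA p:?D \<gamma>. ?D (fst p)). f (fst q) * g (snd q) * h (snd p))"
    using finite_decompositions by (subst sum.Sigma) auto
  also have "\<dots> = (\<Sum>(p, q)\<in>(SIGMA p:?D \<gamma>. ?D (snd p)). f (fst p) * (g (fst q) * h (snd q)))"
    by (rule sum.reindex_bij_witness[of _
          "\<lambda>(p, q). ((fst p + fst q, snd q), (fst p, fst q))"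
          "\<lambda>(p, q). ((fst q, snd q + snd p), (snd q, snd p))"])
       (auto simp: ac_simps)
  also have "\<dots> = mps_mult f (mps_mult g h) \<gamma>"
    using finite_decompositions by (subst sum.Sigma[symmetric]) (auto simp: case_prod_unfold sum_distrib_left)
  finally show "mps_mult (mps_mult f g) h \<gamma> = mps_mult f (mps_mult g h) \<gamma>" .
qed

lemma mps_mult_delta:
  "mps_mult (\<lambda>\<alpha>. if \<alpha> = \<delta> then c else 0) (\<lambda>\<alpha>. if \<alpha> = \<epsilon> then d else 0) =
     (\<lambda>\<alpha>. if \<alpha> = \<delta> + \<epsilon> then c * d else 0)"
proof
  fix \<gamma>
  have "(\<Sum>(\<alpha>, \<beta>)\<in>{(\<alpha>, \<beta>). \<alpha> + \<beta> = \<gamma>}. (if \<alpha> = \<delta> then c else 0) * (if \<beta> = \<epsilon> then d else 0)) =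
      (\<Sum>p\<in>{(\<alpha>, \<beta>). \<alpha> + \<beta> = \<gamma>}. if p = (\<delta>, \<epsilon>) then c * d else 0)"
    by (intro sum.cong) (auto split: if_splits)
  then show "(\<Sum>(\<alpha>, \<beta>)\<in>{(\<alpha>, \<beta>). \<alpha> + \<beta> = \<gamma>}. (if \<alpha> = \<delta> then c else 0) * (if \<beta> = \<epsilon> then d else 0)) =
      (if \<gamma> = \<delta> + \<epsilon> then c * d else 0)"
    using finite_decompositions[of \<gamma>] by (auto simp: sum.delta)
qed

lemma mps_mult_const: "mps_mult (\<lambda>\<alpha>. if \<alpha> = 0 then c else 0) g = (\<lambda>\<alpha>. c * g \<alpha>)"
proof
  fix \<gamma>
  have "(\<Sum>(\<alpha>, \<beta>)\<in>{(\<alpha>, \<beta>). \<alpha> + \<beta> = \<gamma>}. (if \<alpha> = 0 then c else 0) * g \<beta>) =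
      (\<Sum>p\<in>{(\<alpha>, \<beta>). \<alpha> + \<beta> = \<gamma>}. if p = (0, \<gamma>) then c * g \<gamma> else 0)"
    by (intro sum.cong) (auto split: if_splits)
  then show "(\<Sum>(\<alpha>, \<beta>)\<in>{(\<alpha>, \<beta>). \<alpha> + \<beta> = \<gamma>}. (if \<alpha> = 0 then c else 0) * g \<beta>) = c * g \<gamma>"
    using finite_decompositions[of \<gamma>] by (auto simp: sum.delta)
qed

lemma mps_ring_sel [simp]:
  "carrier (mps_ring n) = {f. \<forall>\<alpha>. f \<alpha> \<noteq> 0 \<longrightarrow> keys \<alpha> \<subseteq> {1..n}}"
  "f \<otimes>\<^bsub>mps_ring n\<^esub> g = mps_mult f g"
  "\<one>\<^bsub>mps_ring n\<^esub> = (\<lambda>\<alpha>. if \<alpha> = 0 then 1 else 0)"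
  "\<zero>\<^bsub>mps_ring n\<^esub> = (\<lambda>_. 0)"
  "f \<oplus>\<^bsub>mps_ring n\<^esub> g = (\<lambda>\<alpha>. f \<alpha> + g \<alpha>)"
  by (simp_all add: mps_ring_def)

lemma cring_mps_ring: "cring (mps_ring n :: 'k::field mps ring)"
proof (rule cringI)
  show "abelian_group (mps_ring n :: 'k mps ring)"
  proof (rule abelian_groupI)
    fix f :: "'k mps" assume f: "f \<in> carrier (mps_ring n)"
    then show "\<exists>g\<in>carrier (mps_ring n). g \<oplus>\<^bsub>mps_ring n\<^esub> f = \<zero>\<^bsub>mps_ring n\<^esub>"
      by (intro bexI[of _ "\<lambda>\<alpha>. - f \<alpha>"]) auto
  next
    fix f g :: "'k mps" assume "f \<in> carrier (mps_ring n)" "g \<in> carrier (mps_ring n)"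
    then show "f \<oplus>\<^bsub>mps_ring n\<^esub> g \<in> carrier (mps_ring n)"
      by simp (metis add.right_neutral)
  qed (auto simp: ac_simps)
  show "comm_monoid (mps_ring n :: 'k mps ring)"
  proof (rule comm_monoidI)
    fix f g :: "'k mps" assume fg: "f \<in> carrier (mps_ring n)" "g \<in> carrier (mps_ring n)"
    have "keys \<gamma> \<subseteq> {1..n}" if nz: "mps_mult f g \<gamma> \<noteq> 0" for \<gamma>
    proof -
      obtain \<alpha> \<beta> where eq: "\<alpha> + \<beta> = \<gamma>" and "f \<alpha> * g \<beta> \<noteq> 0"
        using sum.not_neutral_contains_not_neutral[OF nz] by (metis (mono_tags, lifting) case_prodE mem_Collect_eq prod.case)
      with fg have "keys \<alpha> \<subseteq> {1..n}" "keys \<beta> \<subseteq> {1..n}" by auto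
      then show ?thesis unfolding eq[symmetric] keys_add_nat by (rule Un_least)
    qed
    then show "f \<otimes>\<^bsub>mps_ring n\<^esub> g \<in> carrier (mps_ring n)" by simp
  next
    fix f g h :: "'k mps"
    show "f \<otimes>\<^bsub>mps_ring n\<^esub> g \<otimes>\<^bsub>mps_ring n\<^esub> h = f \<otimes>\<^bsub>mps_ring n\<^esub> (g \<otimes>\<^bsub>mps_ring n\<^esub> h)"
      unfolding mps_ring_sel by (rule mps_mult_assoc)
    show "f \<otimes>\<^bsub>mps_ring n\<^esub> g = g \<otimes>\<^bsub>mps_ring n\<^esub> f"
      unfolding mps_ring_sel by (rule mps_mult_commute)
    show "\<one>\<^bsub>mps_ring n\<^esub> \<otimes>\<^bsub>mps_ring n\<^esub> f = f"
      unfolding mps_ring_sel by (simp only: mps_mult_const) simp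
  qed simp
qed (simp add: algebra_simps sum.distrib case_prod_unfold)

lemma ideal_Ann:
  fixes F :: "'k::field_char_0 mpoly"
  shows "ideal (Ann n F) (mps_ring n)"
proof -
  interpret R: cring "mps_ring n :: 'k mps ring" by (rule cring_mps_ring)
  have mult: "f \<otimes>\<^bsub>mps_ring n\<^esub> g \<in> Ann n F" if "f \<in> carrier (mps_ring n)" "g \<in> Ann n F" for f g
    using that R.m_closed[of f g] by (simp add: Ann_def act_mult del: mps_ring_sel(1))
  have add: "f \<oplus>\<^bsub>mps_ring n\<^esub> g \<in> Ann n F" if "f \<in> Ann n F" "g \<in> Ann n F" for f g
    using that R.a_closed[of f g] by (simp add: Ann_def act_add)
  have neg: "\<ominus>\<^bsub>mps_ring n\<^esub> f \<in> Ann n F" if "f \<in> Ann n F" for f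
    using mult[OF _ that, of "\<ominus>\<^bsub>mps_ring n\<^esub> \<one>\<^bsub>mps_ring n\<^esub>"] that R.l_minus[of "\<one>\<^bsub>mps_ring n\<^esub>" f]
    by (simp add: Ann_def del: mps_ring_sel)
  show ?thesis
  proof (rule idealI)
    show "subgroup (Ann n F) (add_monoid (mps_ring n))"
      unfolding subgroup_def
    proof (intro conjI ballI allI impI)
      show "Ann n F \<subseteq> carrier (add_monoid (mps_ring n))" by (auto simp: Ann_def)
      show "\<one>\<^bsub>add_monoid (mps_ring n)\<^esub> \<in> Ann n F" by (simp add: Ann_def)
      show "f \<otimes>\<^bsub>add_monoid (mps_ring n)\<^esub> g \<in> Ann n F" if "f \<in> Ann n F" "g \<in> Ann n F" for f g
        using add that by simp
      show "inv\<^bsub>add_monoid (mps_ring n)\<^esub> f \<in> Ann n F" if "f \<in> Ann n F" for f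
        using neg[OF that] by (simp add: a_inv_def)
    qed
    fix f g :: "'k mps" assume "f \<in> Ann n F" "g \<in> carrier (mps_ring n)"
    then show "g \<otimes>\<^bsub>mps_ring n\<^esub> f \<in> Ann n F" "f \<otimes>\<^bsub>mps_ring n\<^esub> g \<in> Ann n F"
      using mult[of g f] R.m_comm[of f g] by (auto simp: Ann_def simp del: mps_ring_sel)
  qed (rule R.ring_axioms)
qed

section \<open>Quotients by annihilators and dual functionals\<close>

definition mono_at :: "(nat \<Rightarrow> 'a::comm_ring_1) \<Rightarrow> (nat \<Rightarrow>\<^sub>0 nat) \<Rightarrow> 'a" where
  "mono_at a \<alpha> = (\<Prod>i\<in>keys \<alpha>. a i ^ lookup \<alpha> i)"

lemma mono_at_superset:
  "finite S \<Longrightarrow> keys \<alpha> \<subseteq> S \<Longrightarrow> mono_at a \<alpha> = (\<Prod>i\<in>S. a i ^ lookup \<alpha> i)"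
  unfolding mono_at_def by (rule prod.mono_neutral_left) (auto simp: in_keys_iff)

lemma mono_at_add: "mono_at a (\<alpha> + \<beta>) = mono_at a \<alpha> * mono_at a \<beta>"
proof -
  let ?S = "keys \<alpha> \<union> keys \<beta>"
  have "mono_at a (\<alpha> + \<beta>) = (\<Prod>i\<in>?S. a i ^ lookup \<alpha> i * a i ^ lookup \<beta> i)"
    by (subst mono_at_superset[of ?S]) (auto simp: keys_add_nat lookup_add power_add)
  also have "\<dots> = mono_at a \<alpha> * mono_at a \<beta>"
    by (simp add: prod.distrib mono_at_superset[of ?S \<alpha>] mono_at_superset[of ?S \<beta>])
  finally show ?thesis .
qed

lemma mono_at_0 [simp]: "mono_at a 0 = 1"
  by (simp add: mono_at_def)

lemma mono_at_single [simp]: "mono_at a (single i k) = a i ^ k"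
  by (cases "k = 0") (simp_all add: mono_at_def)

context local_artinian_algebra
begin

lemma mono_at_Mpow:
  assumes "\<And>i. i \<in> {1..n} \<Longrightarrow> a i \<in> M"
  shows "keys \<alpha> \<subseteq> {1..n} \<Longrightarrow> mono_at a \<alpha> \<in> Mpow (expo_deg \<alpha>)"
proof (induction "expo_deg \<alpha>" arbitrary: \<alpha>)
  case (Suc k)
  then have "\<alpha> \<noteq> 0" by auto
  then obtain i \<beta> where \<beta>: "\<alpha> = single i 1 + \<beta>" by (rule expo_nonzero_split)
  then have k: "k = expo_deg \<beta>" "keys \<beta> \<subseteq> {1..n}" "i \<in> {1..n}"
    using Suc.hyps(2) Suc.prems by (auto simp: expo_deg_add keys_add_nat)
  then have "mono_at a \<beta> * a i \<in> Mpow (Suc (expo_deg \<beta>))"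
    using Suc.hyps(1)[of \<beta>] assms[of i] by (auto intro: max_ideal_pow_prod)
  then show ?case
    by (simp add: \<beta> mono_at_add expo_deg_add mult.commute)
qed simp

end

text \<open>Macaulay duality in coordinates: \<open>F\<close> is the generating function, in divided
  powers, of the values of \<open>lam\<close> on monomials. Nondegeneracy makes the kernel of
  evaluation at \<open>a\<close> equal to \<open>Ann n F\<close>. As \<open>lam_mono\<close> is
  silent about exponents outside the first \<open>n\<close> variables, \<open>poly_F\<close> fixes
  those coefficients.\<close>

locale inverse_system = local_artinian_algebra scale
  for scale :: "'k::field_char_0 \<Rightarrow> 'a::comm_ring_1 \<Rightarrow> 'a" +
  fixes n :: nat and a :: "nat \<Rightarrow> 'a" and lam :: "'a \<Rightarrow> 'k" and F :: "'k mpoly"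
  assumes lam_add: "lam (x + y) = lam x + lam y"
    and lam_scale: "lam (scale c x) = c * lam x"
    and gen_in_M: "i \<in> {1..n} \<Longrightarrow> a i \<in> M"
    and lam_mono: "keys \<alpha> \<subseteq> {1..n} \<Longrightarrow> lam (mono_at a \<alpha>) = dcoeff F \<alpha>"
    and nondegenerate: "(\<And>y. lam (x * y) = 0) \<Longrightarrow> x = 0"
    and span_mono: "span {mono_at a \<alpha> |\<alpha>. keys \<alpha> \<subseteq> {1..n}} = UNIV"
    and poly_F: "F \<in> mpolys n"
begin

lemma lam_0 [simp]: "lam 0 = 0"
  using lam_scale[of 0 0] by simp

lemma lam_sum: "lam (\<Sum>i\<in>I. f i) = (\<Sum>i\<in>I. lam (f i))"
  by (induction I rule: infinite_finite_induct) (simp_all add: lam_add)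

lemma mono_Mpow: "keys \<alpha> \<subseteq> {1..n} \<Longrightarrow> mono_at a \<alpha> \<in> Mpow (expo_deg \<alpha>)"
  using mono_at_Mpow gen_in_M .

lemma mono_induct [case_names add scale mono]:
  assumes "\<And>x y. P x \<Longrightarrow> P y \<Longrightarrow> P (x + y)" "\<And>c x. P x \<Longrightarrow> P (scale c x)"
    and "\<And>\<alpha>. keys \<alpha> \<subseteq> {1..n} \<Longrightarrow> P (mono_at a \<alpha>)"
  shows "P x"
proof -
  have "P (scale 0 (mono_at a 0))" using assms(2)[OF assms(3)[of 0], of 0] by simp
  then have "subspace (Collect P)"
    unfolding subspace_def using assms(1,2) by auto
  then have "span {mono_at a \<alpha> |\<alpha>. keys \<alpha> \<subseteq> {1..n}} \<subseteq> Collect P"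
    by (intro span_minimal) (use assms(3) in blast)
  then show ?thesis using span_mono by blast
qed

lemma zero_if_lam_mono:
  assumes "\<And>\<alpha>. keys \<alpha> \<subseteq> {1..n} \<Longrightarrow> lam (x * mono_at a \<alpha>) = 0"
  shows "x = 0"
proof (rule nondegenerate)
  fix y
  show "lam (x * y) = 0"
    by (induction y rule: mono_induct) (simp_all add: distrib_left lam_add scale_mult_right lam_scale assms)
qed

lemma dcoeff_outside: "\<not> keys \<alpha> \<subseteq> {1..n} \<Longrightarrow> dcoeff F \<alpha> = 0"
  using poly_F unfolding mpolys_def by (auto simp: dcoeff_eq_0_iff)

text \<open>Nilpotency of \<open>M\<close> confines the monomials with nonzero value to the finite
  set \<open>D\<close>, so a power series is evaluated by a finite sum.\<close>

definition N where "N = (SOME N. Mpow N = {0})"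
definition D where "D = {\<alpha>. keys \<alpha> \<subseteq> {1..n} \<and> expo_deg \<alpha> \<le> N}"

lemma Mpow_N: "Mpow N = {0}"
  unfolding N_def using Mpow_eventually_0 by (rule someI_ex)

lemma finite_D: "finite D"
  unfolding D_def by (rule finite_bounded_expos)

lemma mono_not_D: "keys \<alpha> \<subseteq> {1..n} \<Longrightarrow> \<alpha> \<notin> D \<Longrightarrow> mono_at a \<alpha> = 0"
  using mono_Mpow[of \<alpha>] Mpow_antimono[of N "expo_deg \<alpha>"] Mpow_N unfolding D_def by auto

definition ev :: "'k mps \<Rightarrow> 'a" where
  "ev g = (\<Sum>\<alpha>\<in>D. scale (g \<alpha>) (mono_at a \<alpha>))"

lemma ev_add: "ev (\<lambda>\<alpha>. f \<alpha> + g \<alpha>) = ev f + ev g"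
  by (simp add: ev_def scale_left_distrib sum.distrib)

lemma ev_delta:
  assumes "keys \<beta> \<subseteq> {1..n}"
  shows "ev (\<lambda>\<alpha>. if \<alpha> = \<beta> then c else 0) = scale c (mono_at a \<beta>)"
proof -
  have "ev (\<lambda>\<alpha>. if \<alpha> = \<beta> then c else 0) =
      (\<Sum>\<alpha>\<in>D. if \<alpha> = \<beta> then scale c (mono_at a \<beta>) else 0)"
    unfolding ev_def by (intro sum.cong) auto
  then show ?thesis
    using mono_not_D[OF assms] finite_D by simp
qed

text \<open>\<open>D\<close> is closed under divisors, and a monomial whose exponent leaves
  \<open>D\<close> is 0 in the algebra. So the convolution over pairs with sum in \<open>D\<close>
  may be extended to all of D \<times> D.\<close>

lemma ev_mult: "ev (mps_mult f g) = ev f * ev g"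
proof -
  let ?T = "\<lambda>p. scale (f (fst p) * g (snd p)) (mono_at a (fst p + snd p))"
  have "ev (mps_mult f g) = (\<Sum>\<gamma>\<in>D. \<Sum>p\<in>{(\<alpha>, \<beta>). \<alpha> + \<beta> = \<gamma>}. ?T p)"
    unfolding ev_def scale_sum_left by (intro sum.cong) auto
  also have "\<dots> = (\<Sum>(\<gamma>, p)\<in>(SIGMA \<gamma>:D. {(\<alpha>, \<beta>). \<alpha> + \<beta> = \<gamma>}). ?T p)"
    using finite_D finite_decompositions by (intro sum.Sigma) auto
  also have "\<dots> = (\<Sum>p\<in>{p. fst p + snd p \<in> D}. ?T p)"
    by (rule sum.reindex_bij_witness[of _ "\<lambda>p. (fst p + snd p, p)" snd]) auto
  also have "\<dots> = (\<Sum>p\<in>D \<times> D. ?T p)"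
  proof (rule sum.mono_neutral_left)
    show "{p. fst p + snd p \<in> D} \<subseteq> D \<times> D"
      unfolding D_def by (auto simp: keys_add_nat expo_deg_add)
    show "\<forall>p\<in>D \<times> D - {p. fst p + snd p \<in> D}. ?T p = 0"
    proof
      fix p assume p: "p \<in> D \<times> D - {p. fst p + snd p \<in> D}"
      then have "keys (fst p + snd p) \<subseteq> {1..n}"
        unfolding D_def by (auto simp: keys_add_nat)
      then have "mono_at a (fst p + snd p) = 0" using mono_not_D p by blast
      then show "?T p = 0" by simp
    qed
  qed (simp add: finite_D)
  also have "\<dots> = (\<Sum>\<alpha>\<in>D. \<Sum>\<beta>\<in>D. scale (f \<alpha>) (mono_at a \<alpha>) * scale (g \<beta>) (mono_at a \<beta>))"
    by (simp add: sum.cartesian_product case_prod_unfold mono_at_add scale_mult_left scale_mult_right mult.commute)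
  also have "\<dots> = ev f * ev g"
    by (simp add: ev_def sum_product)
  finally show ?thesis .
qed

lemma ev_surj: "\<exists>g\<in>carrier (mps_ring n). ev g = x"
proof (induction x rule: mono_induct)
  case (add x y)
  then obtain f g where fg: "f \<in> carrier (mps_ring n)" "g \<in> carrier (mps_ring n)" "ev f = x" "ev g = y"
    by blast
  then have "(\<lambda>\<alpha>. f \<alpha> + g \<alpha>) \<in> carrier (mps_ring n)" "ev (\<lambda>\<alpha>. f \<alpha> + g \<alpha>) = x + y"
    by (simp_all add: ev_add) (metis add.right_neutral)
  then show ?case by blast
next
  case (scale c x)
  then obtain f where f: "f \<in> carrier (mps_ring n)" "ev f = x" by blast
  then have "(\<lambda>\<alpha>. c * f \<alpha>) \<in> carrier (mps_ring n)" "ev (\<lambda>\<alpha>. c * f \<alpha>) = scale c x"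
    by (auto simp add: ev_def scale_sum_right)
  then show ?case by blast
next
  case (mono \<alpha>)
  then show ?case
    using ev_delta[of \<alpha> 1] by (intro bexI[of _ "\<lambda>\<beta>. if \<beta> = \<alpha> then 1 else 0"]) auto
qed

text \<open>Shifting exponents in \<open>F\<close> corresponds to multiplying by monomials inside
  \<open>lam\<close>; this identifies the action of \<open>g\<close> with multiplication by
  \<open>ev g\<close>. Outside \<open>D\<close> the coefficients of \<open>F\<close> are
  \<open>lam\<close> of a vanishing monomial, or involve a foreign variable.\<close>

lemma dcoeff_act_ev:
  assumes \<gamma>: "keys \<gamma> \<subseteq> {1..n}"
  shows "dcoeff (g \<circ>\<^sub>\<partial> F) \<gamma> = lam (ev g * mono_at a \<gamma>)"
proof -
  have "dcoeff (g \<circ>\<^sub>\<partial> F) \<gamma> = (\<Sum>\<alpha>\<in>D. g \<alpha> * dcoeff F (\<gamma> + \<alpha>))"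
  proof (rule dcoeff_act[OF finite_D])
    fix \<alpha> assume "\<alpha> \<notin> D"
    show "dcoeff F (\<gamma> + \<alpha>) = 0"
    proof (cases "keys (\<gamma> + \<alpha>) \<subseteq> {1..n}")
      case True
      then have "mono_at a (\<gamma> + \<alpha>) = 0"
        using mono_not_D[of \<alpha>] \<open>\<alpha> \<notin> D\<close> by (simp add: mono_at_add keys_add_nat)
      then show ?thesis using lam_mono[OF True] by simp
    qed (rule dcoeff_outside)
  qed
  also have "\<dots> = (\<Sum>\<alpha>\<in>D. g \<alpha> * lam (mono_at a \<gamma> * mono_at a \<alpha>))"
    using \<gamma> by (intro sum.cong) (auto simp: D_def keys_add_nat mono_at_add lam_mono[symmetric])
  also have "\<dots> = lam (ev g * mono_at a \<gamma>)"
  proof -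
    have "ev g * mono_at a \<gamma> = (\<Sum>\<alpha>\<in>D. scale (g \<alpha>) (mono_at a \<gamma> * mono_at a \<alpha>))"
      unfolding ev_def sum_distrib_right scale_mult_left by (simp add: mult.commute)
    then show ?thesis by (simp add: lam_sum lam_scale)
  qed
  finally show ?thesis .
qed

lemma ev_eq_0_iff:
  assumes g: "g \<in> carrier (mps_ring n)"
  shows "ev g = 0 \<longleftrightarrow> g \<in> Ann n F"
proof
  assume 0: "ev g = 0"
  have "g \<circ>\<^sub>\<partial> F = 0"
  proof (rule dcoeff_eqI)
    fix \<gamma>
    show "dcoeff (g \<circ>\<^sub>\<partial> F) \<gamma> = dcoeff 0 \<gamma>"
    proof (cases "keys \<gamma> \<subseteq> {1..n}")
      case True
      then show ?thesis using 0 by (simp add: dcoeff_act_ev)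
    next
      case False
      then have "dcoeff F (\<gamma> + \<alpha>) = 0" for \<alpha>
        by (intro dcoeff_outside) (simp add: keys_add_nat)
      then show ?thesis by (simp add: dcoeff_act_divisors)
    qed
  qed
  then show "g \<in> Ann n F" using g by (simp add: Ann_def)
next
  assume "g \<in> Ann n F"
  then have "g \<circ>\<^sub>\<partial> F = 0" by (simp add: Ann_def)
  then show "ev g = 0"
    using dcoeff_act_ev[of _ g] by (intro zero_if_lam_mono) auto
qed

text \<open>\<open>ev\<close> is a surjective homomorphism with kernel \<open>Ann n F\<close>. The
  isomorphism theorem gives a map out of the quotient, the definition asks for one into it;
  compatibility with scalars is therefore checked after applying the injective
  \<open>\<psi>\<close>.\<close>

lemma iso_mps_quotient: "iso_mps_quotient scale n (Ann n F)"
proof -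
  let ?R = "mps_ring n :: 'k mps ring" and ?A = "ring_of_type_algebra :: 'a ring"
  interpret R: cring ?R by (rule cring_mps_ring)
  interpret A: cring ?A by (rule cring_from_type_algebra)
  interpret h: ring_hom_ring ?R ?A ev
  proof (rule ring_hom_ringI2[OF R.ring_axioms A.ring_axioms], rule ring_hom_memI)
    show "ev \<one>\<^bsub>?R\<^esub> = \<one>\<^bsub>?A\<^esub>"
      using ev_delta[of 0 1] by (simp add: ring_of_type_algebra_def)
  qed (simp_all add: ring_of_type_algebra_def ev_add ev_mult)
  have ker: "a_kernel ?R ?A ev = Ann n F"
    unfolding a_kernel_def kernel_def using ev_eq_0_iff
    by (auto simp: ring_of_type_algebra_def Ann_def simp del: mps_ring_sel(1))
  define \<psi> where "\<psi> = (\<lambda>C. the_elem (ev ` C))"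
  have \<psi>: "\<psi> \<in> ring_iso (?R Quot Ann n F) ?A"
  proof -
    have "ev ` carrier ?R = UNIV" using ev_surj by (metis UNIV_eq_I image_eqI)
    then have "ev ` carrier ?R = carrier ?A" by (simp add: ring_of_type_algebra_def)
    from h.FactRing_iso_set[OF this] show ?thesis unfolding \<psi>_def ker .
  qed
  have \<psi>_coset: "\<psi> (Ann n F +>\<^bsub>?R\<^esub> g) = ev g" if "g \<in> carrier ?R" for g
    using h.the_elem_simp[OF that] unfolding \<psi>_def ker .
  define \<phi> where "\<phi> = inv_into (carrier (?R Quot Ann n F)) \<psi>"
  interpret Q: ring "?R Quot Ann n F" by (rule ideal.quotient_is_ring[OF ideal_Ann])
  have \<phi>: "\<phi> \<in> ring_iso ?A (?R Quot Ann n F)"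
    unfolding \<phi>_def using Q.ring_axioms \<psi> by (rule ring_iso_set_sym)
  have bij: "bij_betw \<psi> (carrier (?R Quot Ann n F)) UNIV"
    using ring_iso_memE(5)[OF \<psi>] by (simp add: ring_of_type_algebra_def)
  have \<phi>_in: "\<phi> x \<in> carrier (?R Quot Ann n F)" for x
    using ring_iso_memE(1)[OF \<phi>, of x] by (simp add: ring_of_type_algebra_def)
  have \<psi>\<phi>: "\<psi> (\<phi> x) = x" for x
    unfolding \<phi>_def using bij by (intro f_inv_into_f) (simp add: bij_betw_def)
  have "\<phi> (scale c x) = (Ann n F +>\<^bsub>?R\<^esub> mps_const c) \<otimes>\<^bsub>?R Quot Ann n F\<^esub> \<phi> x" for c x
  proof (rule inj_onD[OF bij_betw_imp_inj_on[OF bij]])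
    have c: "mps_const c \<in> carrier ?R" by (simp add: mps_const_def)
    then have cq: "Ann n F +>\<^bsub>?R\<^esub> mps_const c \<in> carrier (?R Quot Ann n F)"
      using ring_hom_closed[OF ideal.rcos_ring_hom[OF ideal_Ann]] by blast
    then show "(Ann n F +>\<^bsub>?R\<^esub> mps_const c) \<otimes>\<^bsub>?R Quot Ann n F\<^esub> \<phi> x \<in> carrier (?R Quot Ann n F)"
      using \<phi>_in by (rule Q.m_closed)
    have "\<psi> ((Ann n F +>\<^bsub>?R\<^esub> mps_const c) \<otimes>\<^bsub>?R Quot Ann n F\<^esub> \<phi> x) = ev (mps_const c) * x"
      using ring_iso_memE(2)[OF \<psi> cq \<phi>_in, of x] \<psi>_coset[OF c] \<psi>\<phi>
      by (simp add: ring_of_type_algebra_def)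
    also have "ev (mps_const c) = scale c 1"
      using ev_delta[of 0 c] by (simp add: mps_const_def)
    finally show "\<psi> (\<phi> (scale c x)) = \<psi> ((Ann n F +>\<^bsub>?R\<^esub> mps_const c) \<otimes>\<^bsub>?R Quot Ann n F\<^esub> \<phi> x)"
      by (simp add: \<psi>\<phi> scale_mult_left)
  qed (rule \<phi>_in)
  with \<phi> show ?thesis unfolding iso_mps_quotient_def by blast
qed

end

text \<open>The quotient map followed by the inverse of the given isomorphism; in this form no
  cosets remain.\<close>

lemma (in local_artinian_algebra) mps_quotient_hom:
  assumes iso: "iso_mps_quotient scale n I" and I: "ideal I (mps_ring n)"
  obtains \<pi> where
    "\<And>x. \<exists>g\<in>carrier (mps_ring n). \<pi> g = x"
    "\<And>f g. f \<in> carrier (mps_ring n) \<Longrightarrow> g \<in> carrier (mps_ring n) \<Longrightarrow>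
       \<pi> (\<lambda>\<alpha>. f \<alpha> + g \<alpha>) = \<pi> f + \<pi> g"
    "\<And>f g. f \<in> carrier (mps_ring n) \<Longrightarrow> g \<in> carrier (mps_ring n) \<Longrightarrow>
       \<pi> (mps_mult f g) = \<pi> f * \<pi> g"
    "\<And>c. \<pi> (mps_const c) = scale c 1"
    "\<And>g. g \<in> carrier (mps_ring n) \<Longrightarrow> \<pi> g = 0 \<longleftrightarrow> g \<in> I"
proof -
  let ?R = "mps_ring n :: 'k mps ring" and ?A = "ring_of_type_algebra :: 'a ring"
  interpret I: ideal I ?R by (rule I)
  interpret A: cring ?A by (rule cring_from_type_algebra)
  interpret Q: ring "?R Quot I" by (rule I.quotient_is_ring)
  obtain \<phi> where \<phi>: "\<phi> \<in> ring_iso ?A (?R Quot I)"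
    and \<phi>_scale: "\<And>c x. \<phi> (scale c x) = (I +>\<^bsub>?R\<^esub> mps_const c) \<otimes>\<^bsub>?R Quot I\<^esub> \<phi> x"
    using iso unfolding iso_mps_quotient_def by blast
  have bij: "bij_betw \<phi> UNIV (carrier (?R Quot I))"
    using ring_iso_memE(5)[OF \<phi>] by (simp add: ring_of_type_algebra_def)
  note inj = bij_betw_imp_inj_on[OF bij]
  let ?q = "\<lambda>g. I +>\<^bsub>?R\<^esub> g"
  have q: "?q \<in> ring_hom ?R (?R Quot I)" by (rule I.rcos_ring_hom)
  define \<pi> where "\<pi> = (\<lambda>g. inv_into UNIV \<phi> (?q g))"
  have \<phi>\<pi>: "\<phi> (\<pi> g) = ?q g" if "g \<in> carrier ?R" for g
    unfolding \<pi>_def using bij ring_hom_closed[OF q that]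
    by (intro f_inv_into_f) (simp add: bij_betw_def)
  have \<phi>_add: "\<phi> (x + y) = \<phi> x \<oplus>\<^bsub>?R Quot I\<^esub> \<phi> y" for x y
    using ring_iso_memE(3)[OF \<phi>, of x y] by (simp add: ring_of_type_algebra_def)
  have \<phi>_mult: "\<phi> (x * y) = \<phi> x \<otimes>\<^bsub>?R Quot I\<^esub> \<phi> y" for x y
    using ring_iso_memE(2)[OF \<phi>, of x y] by (simp add: ring_of_type_algebra_def)
  have \<phi>_in: "\<phi> x \<in> carrier (?R Quot I)" for x
    using bij by (simp add: bij_betw_apply)
  have \<phi>_1: "\<phi> 1 = \<one>\<^bsub>?R Quot I\<^esub>"
    using ring_iso_memE(4)[OF \<phi>] by (simp add: ring_of_type_algebra_def)
  have \<phi>_0: "\<phi> 0 = \<zero>\<^bsub>?R Quot I\<^esub>"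
    using \<phi>_add[of 0 0] \<phi>_in[of 0] Q.add.l_cancel_one by fastforce
  show ?thesis
  proof
    show "\<exists>g\<in>carrier ?R. \<pi> g = x" for x
    proof -
      obtain g where g: "g \<in> carrier ?R" "\<phi> x = ?q g"
        using \<phi>_in[of x] by (auto simp: FactRing_def A_RCOSETS_def' simp del: mps_ring_sel)
      then have "\<phi> (\<pi> g) = \<phi> x" using \<phi>\<pi> by simp
      then show ?thesis using g inj by (metis UNIV_I inj_onD)
    qed
    show "\<pi> (\<lambda>\<alpha>. f \<alpha> + g \<alpha>) = \<pi> f + \<pi> g" if fg: "f \<in> carrier ?R" "g \<in> carrier ?R" for f g
    proof (rule inj_onD[OF inj])
      have "\<phi> (\<pi> (f \<oplus>\<^bsub>?R\<^esub> g)) = \<phi> (\<pi> f + \<pi> g)"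
        using fg ring_hom_add[OF q fg] by (simp only: \<phi>_add \<phi>\<pi> I.a_closed)
      then show "\<phi> (\<pi> (\<lambda>\<alpha>. f \<alpha> + g \<alpha>)) = \<phi> (\<pi> f + \<pi> g)" by simp
    qed simp_all
    show "\<pi> (mps_mult f g) = \<pi> f * \<pi> g" if fg: "f \<in> carrier ?R" "g \<in> carrier ?R" for f g
    proof (rule inj_onD[OF inj])
      have "\<phi> (\<pi> (f \<otimes>\<^bsub>?R\<^esub> g)) = \<phi> (\<pi> f * \<pi> g)"
        using fg ring_hom_mult[OF q fg] by (simp only: \<phi>_mult \<phi>\<pi> I.m_closed)
      then show "\<phi> (\<pi> (mps_mult f g)) = \<phi> (\<pi> f * \<pi> g)" by simp
    qed simp_all
    show "\<pi> (mps_const c) = scale c 1" for c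
    proof (rule inj_onD[OF inj])
      have c: "mps_const c \<in> carrier ?R" by (simp add: mps_const_def)
      then show "\<phi> (\<pi> (mps_const c)) = \<phi> (scale c 1)"
        using ring_hom_closed[OF q c] by (simp only: \<phi>\<pi> \<phi>_scale \<phi>_1 Q.r_one)
    qed simp_all
    show "\<pi> g = 0 \<longleftrightarrow> g \<in> I" if g: "g \<in> carrier ?R" for g
    proof -
      have "\<pi> g = 0 \<longleftrightarrow> ?q g = I"
        using \<phi>\<pi>[OF g] \<phi>_0 inj_eq[OF inj, of "\<pi> g" 0] by (simp add: FactRing_def)
      also have "\<dots> \<longleftrightarrow> g \<in> I"
        using I.rcos_const_imp_mem[OF g] I.a_rcos_zero[OF I, of g] by blast
      finally show ?thesis .
    qed
  qed
qed

lemma delta_act: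
  fixes F :: "'k::field_char_0 mpoly"
  shows "dcoeff ((\<lambda>\<alpha>. if \<alpha> = \<beta> then c else 0) \<circ>\<^sub>\<partial> F) \<gamma> = c * dcoeff F (\<gamma> + \<beta>)"
proof -
  let ?T = "{\<alpha>. \<exists>\<beta>. \<alpha> + \<beta> \<in> keys F}"
  have "dcoeff ((\<lambda>\<alpha>. if \<alpha> = \<beta> then c else 0) \<circ>\<^sub>\<partial> F) \<gamma> =
      (\<Sum>\<alpha>\<in>insert \<beta> ?T. (if \<alpha> = \<beta> then c else 0) * dcoeff F (\<gamma> + \<alpha>))"
    by (rule dcoeff_act) (auto intro: finite_divisors simp: dcoeff_eq_0_iff add.commute)
  also have "\<dots> = (\<Sum>\<alpha>\<in>insert \<beta> ?T. if \<alpha> = \<beta> then c * dcoeff F (\<gamma> + \<alpha>) else 0)"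
    by (intro sum.cong) auto
  also have "\<dots> = c * dcoeff F (\<gamma> + \<beta>)"
    using finite_divisors[of F] by (subst sum.delta) auto
  finally show ?thesis .
qed

text \<open>The functional is forced: on the class of \<open>g\<close> it is the constant
  coefficient of \<open>g \<circ>\<^sub>\<partial> F\<close>. This is well defined because two
  representatives differ by an annihilator of \<open>F\<close>.\<close>

lemma iso_imp_inverse_system:
  fixes scale :: "'k::field_char_0 \<Rightarrow> 'a::comm_ring_1 \<Rightarrow> 'a" and F :: "'k mpoly"
  assumes "local_artinian_algebra scale" and iso: "iso_mps_quotient scale n (Ann n F)"
    and F: "F \<in> mpolys n"
  shows "\<exists>a lam. inverse_system scale n a lam F"
proof -
  interpret local_artinian_algebra scale by fact
  let ?C = "carrier (mps_ring n) :: 'k mps set"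
  show ?thesis
  proof (rule mps_quotient_hom[OF iso ideal_Ann])
    fix \<pi> assume
      surj: "\<And>x. \<exists>g\<in>?C. \<pi> g = x" and
      add: "\<And>f g. f \<in> ?C \<Longrightarrow> g \<in> ?C \<Longrightarrow> \<pi> (\<lambda>\<alpha>. f \<alpha> + g \<alpha>) = \<pi> f + \<pi> g" and
      mult: "\<And>f g. f \<in> ?C \<Longrightarrow> g \<in> ?C \<Longrightarrow> \<pi> (mps_mult f g) = \<pi> f * \<pi> g" and
      const: "\<And>c. \<pi> (mps_const c) = scale c 1" and
      ker: "\<And>g. g \<in> ?C \<Longrightarrow> \<pi> g = 0 \<longleftrightarrow> g \<in> Ann n F"
    define \<delta> :: "(nat \<Rightarrow>\<^sub>0 nat) \<Rightarrow> 'k mps" where "\<delta> = (\<lambda>\<beta> \<alpha>. if \<alpha> = \<beta> then 1 else 0)"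
    define a where "a = (\<lambda>i. \<pi> (\<delta> (single i 1)))"
    define lam where "lam = (\<lambda>x. dcoeff ((SOME g. g \<in> ?C \<and> \<pi> g = x) \<circ>\<^sub>\<partial> F) 0)"
    have C_add: "(\<lambda>\<alpha>. f \<alpha> + g \<alpha>) \<in> ?C" if "f \<in> ?C" "g \<in> ?C" for f g
      using that by simp (metis add.right_neutral)
    have C_scale: "(\<lambda>\<alpha>. c * f \<alpha>) \<in> ?C" if "f \<in> ?C" for c f
      using that by simp
    have C_const: "mps_const c \<in> ?C" for c
      by (simp add: mps_const_def)
    have C_\<delta>: "\<delta> \<beta> \<in> ?C" if "keys \<beta> \<subseteq> {1..n}" for \<beta>
      using that by (auto simp: \<delta>_def)
    have \<pi>_scale: "\<pi> (\<lambda>\<alpha>. c * f \<alpha>) = scale c (\<pi> f)" if "f \<in> ?C" for c f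
      using mult[OF C_const that, of c] const[of c] by (simp add: mps_const_def mps_mult_const scale_mult_left)
    have \<pi>_\<delta>: "\<pi> (\<delta> \<alpha>) = mono_at a \<alpha>" if "keys \<alpha> \<subseteq> {1..n}" for \<alpha>
      using that
    proof (induction "expo_deg \<alpha>" arbitrary: \<alpha>)
      case 0
      then have "\<delta> \<alpha> = mps_const 1" by (simp add: \<delta>_def mps_const_def)
      then show ?case using 0 const[of 1] by simp
    next
      case (Suc k)
      then have "\<alpha> \<noteq> 0" by auto
      then obtain i \<beta> where \<beta>: "\<alpha> = single i 1 + \<beta>" by (rule expo_nonzero_split)
      have k: "k = expo_deg \<beta>" "keys \<beta> \<subseteq> {1..n}" "keys (single i (1::nat)) \<subseteq> {1..n}"
        using Suc.hyps(2) Suc.prems \<beta> by (auto simp: expo_deg_add keys_add_nat)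
      have "\<pi> (\<delta> \<alpha>) = \<pi> (mps_mult (\<delta> (single i 1)) (\<delta> \<beta>))"
        unfolding \<delta>_def \<beta> mps_mult_delta mult_1 ..
      also have "\<dots> = a i * mono_at a \<beta>"
        using mult[OF C_\<delta>[OF k(3)] C_\<delta>[OF k(2)]] Suc.hyps(1)[OF k(1,2)] by (simp add: a_def)
      also have "\<dots> = mono_at a \<alpha>" by (simp add: \<beta> mono_at_add)
      finally show ?case .
    qed
    have lam_\<pi>: "lam (\<pi> g) = dcoeff (g \<circ>\<^sub>\<partial> F) 0" if g: "g \<in> ?C" for g
    proof -
      define f where "f = (SOME f. f \<in> ?C \<and> \<pi> f = \<pi> g)"
      have f: "f \<in> ?C" "\<pi> f = \<pi> g"
        using someI[of "\<lambda>f. f \<in> ?C \<and> \<pi> f = \<pi> g" g] g unfolding f_def by auto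
      let ?d = "\<lambda>\<alpha>. f \<alpha> + (-1) * g \<alpha>"
      have d: "?d \<in> ?C" by (rule C_add[OF f(1) C_scale[OF g]])
      have "\<pi> ?d = \<pi> f + scale (-1) (\<pi> g)"
        unfolding add[OF f(1) C_scale[OF g, of "-1"]] \<pi>_scale[OF g] ..
      then have "?d \<in> Ann n F" using f(2) ker[OF d] by simp
      then have "?d \<circ>\<^sub>\<partial> F = 0" by (simp add: Ann_def)
      moreover have "f = (\<lambda>\<alpha>. ?d \<alpha> + g \<alpha>)" by auto
      ultimately have "f \<circ>\<^sub>\<partial> F = g \<circ>\<^sub>\<partial> F" using act_add[of ?d g F] by simp
      then show ?thesis unfolding lam_def f_def by simp
    qed
    have "inverse_system scale n a lam F"
    proof unfold_locales
      show "lam (x + y) = lam x + lam y" for x y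
      proof -
        obtain f g where "f \<in> ?C" "\<pi> f = x" "g \<in> ?C" "\<pi> g = y" using surj by blast
        then show ?thesis
          using lam_\<pi>[OF C_add[of f g]] by (simp add: add act_add dcoeff_add lam_\<pi>[symmetric] del: mps_ring_sel)
      qed
      show "lam (scale c x) = c * lam x" for c x
      proof -
        obtain f where f: "f \<in> ?C" "\<pi> f = x" using surj by blast
        have "dcoeff ((\<lambda>\<alpha>. c * f \<alpha>) \<circ>\<^sub>\<partial> F) 0 = c * dcoeff (f \<circ>\<^sub>\<partial> F) 0"
          by (simp add: dcoeff_act_divisors sum_distrib_left mult.assoc)
        then show ?thesis
          using lam_\<pi>[OF C_scale[OF f(1), of c]] lam_\<pi>[OF f(1)] \<pi>_scale[OF f(1)] f(2) by simp
      qed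
      show "lam (mono_at a \<alpha>) = dcoeff F \<alpha>" if "keys \<alpha> \<subseteq> {1..n}" for \<alpha>
        using lam_\<pi>[OF C_\<delta>[OF that]] \<pi>_\<delta>[OF that] delta_act[of \<alpha> 1 F 0] by (simp add: \<delta>_def)
      show "a i \<in> M" if i: "i \<in> {1..n}" for i
      proof -
        \<comment> \<open>A power of x_i that divides no monomial of \<open>F\<close> annihilates
          \<open>F\<close>; so \<open>a i\<close> is nilpotent and lies in \<open>M\<close>.\<close>
        let ?s = "\<lambda>N. single i N :: nat \<Rightarrow>\<^sub>0 nat"
        have "inj ?s" by (metis injI lookup_single_eq)
        then have "infinite (range ?s)" using finite_imageD by blast
        then obtain N where N: "?s N \<notin> {\<alpha>. \<exists>\<beta>. \<alpha> + \<beta> \<in> keys F}"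
          using finite_divisors[of F] by (metis (no_types, lifting) finite_subset image_subset_iff)
        have "\<delta> (?s N) \<circ>\<^sub>\<partial> F = 0"
          by (rule dcoeff_eqI) (use N in \<open>auto simp: \<delta>_def delta_act dcoeff_eq_0_iff add.commute\<close>)
        moreover have k: "keys (?s N) \<subseteq> {1..n}" using i by auto
        ultimately have "\<pi> (\<delta> (?s N)) = 0" using ker[OF C_\<delta>[OF k]] C_\<delta>[OF k] by (simp add: Ann_def)
        then have "a i ^ N = 0" using \<pi>_\<delta>[OF k] by simp
        then show ?thesis by (rule nilpotent_in_M)
      qed
      show "x = 0" if x: "\<And>y. lam (x * y) = 0" for x
      proof -
        obtain g where g: "g \<in> ?C" "\<pi> g = x" using surj by blast
        have "g \<circ>\<^sub>\<partial> F = 0"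
        proof (rule dcoeff_eqI)
          fix \<gamma>
          show "dcoeff (g \<circ>\<^sub>\<partial> F) \<gamma> = dcoeff 0 \<gamma>"
          proof (cases "keys \<gamma> \<subseteq> {1..n}")
            case True
            \<comment> \<open>The coefficient at \<gamma> is the constant coefficient after a
              further action of x^\<gamma>, hence \<open>lam\<close> of a multiple of
              \<open>x\<close>.\<close>
            have "dcoeff (g \<circ>\<^sub>\<partial> F) \<gamma> = dcoeff (\<delta> \<gamma> \<circ>\<^sub>\<partial> (g \<circ>\<^sub>\<partial> F)) 0"
              by (simp add: \<delta>_def delta_act)
            also have "\<dots> = dcoeff (mps_mult (\<delta> \<gamma>) g \<circ>\<^sub>\<partial> F) 0"
              by (simp only: act_mult)
            also have "\<dots> = lam (\<pi> (mps_mult (\<delta> \<gamma>) g))"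
              using monoid.m_closed[OF ring.axioms(2)[OF cring.axioms(1)[OF cring_mps_ring]] C_\<delta>[OF True] g(1)]
              by (intro lam_\<pi>[symmetric]) (simp only: mps_ring_sel(2))
            also have "\<dots> = lam (x * \<pi> (\<delta> \<gamma>))"
              using mult[OF C_\<delta>[OF True] g(1)] g(2) by (simp add: mult.commute)
            finally show ?thesis using x by simp
          next
            case False
            have "dcoeff F (\<gamma> + \<alpha>) = 0" for \<alpha>
            proof -
              have "\<not> keys (\<gamma> + \<alpha>) \<subseteq> {1..n}" using False by (simp add: keys_add_nat)
              then show ?thesis using F unfolding mpolys_def by (auto simp: dcoeff_eq_0_iff)
            qed
            then show ?thesis by (simp add: dcoeff_act_divisors)
          qed
        qed
        then show ?thesis using ker[OF g(1)] g by (simp add: Ann_def)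
      qed
      let ?S = "{mono_at a \<alpha> |\<alpha>. keys \<alpha> \<subseteq> {1..n}}"
      show "span ?S = UNIV"
      proof (rule UNIV_eq_I[symmetric])
        fix x
        obtain g where g: "g \<in> ?C" "\<pi> g = x" using surj by blast
        \<comment> \<open>Only the coefficients of \<open>g\<close> at divisors of monomials of
          \<open>F\<close> influence the action. Dropping all others changes \<open>g\<close> by an
          annihilator and leaves a finite combination of monomials.\<close>
        let ?T = "{\<alpha>. \<exists>\<beta>. \<alpha> + \<beta> \<in> keys F} \<inter> {\<alpha>. keys \<alpha> \<subseteq> {1..n}}"
        have *: "(\<lambda>\<alpha>. if \<alpha> \<in> T then g \<alpha> else 0) \<in> ?C \<and> \<pi> (\<lambda>\<alpha>. if \<alpha> \<in> T then g \<alpha> else 0) \<in> span ?S"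
          if "finite T" "T \<subseteq> {\<alpha>. keys \<alpha> \<subseteq> {1..n}}" for T
          using that
        proof (induction T)
          case empty
          have "\<pi> (\<lambda>\<alpha>. 0) = 0" using ker[of "\<lambda>_. 0"] by (simp add: Ann_def)
          then show ?case by (simp add: span_zero)
        next
          case (insert \<beta> T)
          let ?g = "\<lambda>\<alpha>. if \<alpha> \<in> T then g \<alpha> else 0"
          have IH: "?g \<in> ?C" "\<pi> ?g \<in> span ?S" and \<beta>: "keys \<beta> \<subseteq> {1..n}"
            using insert by auto
          have eq: "(\<lambda>\<alpha>. if \<alpha> \<in> insert \<beta> T then g \<alpha> else 0) = (\<lambda>\<alpha>. ?g \<alpha> + g \<beta> * \<delta> \<beta> \<alpha>)"
            using insert.hyps by (auto simp: \<delta>_def)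
          have C: "(\<lambda>\<alpha>. g \<beta> * \<delta> \<beta> \<alpha>) \<in> ?C" by (rule C_scale[OF C_\<delta>[OF \<beta>]])
          have "\<pi> (\<lambda>\<alpha>. ?g \<alpha> + g \<beta> * \<delta> \<beta> \<alpha>) = \<pi> ?g + scale (g \<beta>) (mono_at a \<beta>)"
            unfolding add[OF IH(1) C] \<pi>_scale[OF C_\<delta>[OF \<beta>]] \<pi>_\<delta>[OF \<beta>] ..
          also have "\<dots> \<in> span ?S"
          proof -
            have "mono_at a \<beta> \<in> span ?S" using \<beta> by (intro span_base) blast
            then show ?thesis by (rule span_add[OF IH(2) span_scale])
          qed
          finally show ?case unfolding eq using C_add[OF IH(1) C] by blast
        qed
        have finT: "finite ?T" using finite_divisors[of F] by blast
        let ?g = "\<lambda>\<alpha>. if \<alpha> \<in> ?T then g \<alpha> else 0"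
        have gT: "?g \<in> ?C" "\<pi> ?g \<in> span ?S" using *[OF finT] by blast+
        let ?d = "\<lambda>\<alpha>. g \<alpha> + (-1) * ?g \<alpha>"
        have d: "?d \<in> ?C" by (rule C_add[OF g(1) C_scale[OF gT(1)]])
        have "g \<alpha> = 0" if "\<not> keys \<alpha> \<subseteq> {1..n}" for \<alpha>
          using g(1) that by auto
        then have "?d \<circ>\<^sub>\<partial> F = 0"
          by (intro dcoeff_eqI) (auto simp: dcoeff_act_divisors simp del: atLeastAtMost_iff intro!: sum.neutral)
        then have "\<pi> ?d = 0" using ker[OF d] d by (simp add: Ann_def)
        moreover have "\<pi> ?d = \<pi> g + scale (-1) (\<pi> ?g)"
          unfolding add[OF g(1) C_scale[OF gT(1), of "-1"]] \<pi>_scale[OF gT(1)] ..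
        ultimately have "x = \<pi> ?g" using g(2) by simp
        then show "x \<in> span ?S" using gT(2) by simp
      qed
    qed (rule F)
    then show "\<exists>a lam. inverse_system scale n a lam F" by blast
  qed
qed

section \<open>The Hilbert function from the dual functional\<close>

text \<open>Induction in the manner of Gram-Schmidt. If each vector of \<open>V\<close> killed by
  all \<theta>_i with i in J were killed by the new \<theta>_j, then \<theta>_j would be the
  combination of the \<theta>_i with coefficients \<theta>_j(f_i), against independence. A vector
  violating this is rescaled to the new member, and multiples of it correct the old ones.\<close>

lemma (in vector_space) dual_family:
  assumes "finite J" and V: "subspace V"
    and add: "\<And>j x y. \<theta> j (x + y) = \<theta> j x + \<theta> j y"
    and scale: "\<And>j c x. \<theta> j (scale c x) = c * \<theta> j x"
    and indep: "\<And>c j. (\<And>x. x \<in> V \<Longrightarrow> (\<Sum>j\<in>J. c j * \<theta> j x) = 0) \<Longrightarrow> j \<in> J \<Longrightarrow> c j = 0"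
  shows "\<exists>f. (\<forall>j\<in>J. f j \<in> V) \<and> (\<forall>i\<in>J. \<forall>j\<in>J. \<theta> i (f j) = (if i = j then 1 else 0))"
  using assms(1) indep
proof (induction J)
  case (insert j J)
  have sub: "c i = 0" if c: "\<And>x. x \<in> V \<Longrightarrow> (\<Sum>i\<in>J. c i * \<theta> i x) = 0" and i: "i \<in> J" for c i
  proof -
    have "(if i = j then 0 else c i) = 0"
    proof (rule insert.prems)
      fix x assume "x \<in> V"
      have "(\<Sum>i\<in>insert j J. (if i = j then 0 else c i) * \<theta> i x) = (\<Sum>i\<in>J. c i * \<theta> i x)"
        using insert.hyps by (simp, intro sum.cong) auto
      then show "(\<Sum>i\<in>insert j J. (if i = j then 0 else c i) * \<theta> i x) = 0"
        using c[OF \<open>x \<in> V\<close>] by simp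
    qed (use i in simp)
    then show ?thesis using insert.hyps i by (auto split: if_splits)
  qed
  have "\<exists>f. (\<forall>j\<in>J. f j \<in> V) \<and> (\<forall>i\<in>J. \<forall>j\<in>J. \<theta> i (f j) = (if i = j then 1 else 0))"
  proof (rule insert.IH)
    fix c j assume "\<And>x. x \<in> V \<Longrightarrow> (\<Sum>j\<in>J. c j * \<theta> j x) = 0" "j \<in> J"
    then show "c j = 0" by (rule sub)
  qed
  then obtain f where
    f: "\<And>i. i \<in> J \<Longrightarrow> f i \<in> V"
       "\<And>i l. i \<in> J \<Longrightarrow> l \<in> J \<Longrightarrow> \<theta> i (f l) = (if i = l then 1 else 0)"
    by metis
  have sum: "\<theta> i (\<Sum>l\<in>K. h l) = (\<Sum>l\<in>K. \<theta> i (h l))" for i h and K :: "'c set"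
  proof (induction K rule: infinite_finite_induct)
  qed (use scale[of i 0 0] add in simp_all)
  have diff: "\<theta> i (x - y) = \<theta> i x - \<theta> i y" for i x y
    using add[of i x "scale (-1) y"] scale[of i "-1" y] by simp
  have "\<exists>v\<in>V. (\<forall>i\<in>J. \<theta> i v = 0) \<and> \<theta> j v \<noteq> 0"
  proof (rule ccontr)
    assume none: "\<not> ?thesis"
    \<comment> \<open>The absurd equation 1 = 0 is what independence yields at the index
      \<open>j\<close> for the coefficients of \<theta>_j minus the sum of the \<theta>_j(f_i)
      \<theta>_i.\<close>
    have "(if j = j then 1 else - \<theta> j (f j)) = (0 :: 'a)"
    proof (rule insert.prems[where c = "\<lambda>i. if i = j then 1 else - \<theta> j (f i)"])
      fix x assume x: "x \<in> V"
      define w where "w = (\<Sum>l\<in>J. scale (\<theta> l x) (f l))"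
      have "w \<in> V" unfolding w_def using f(1) by (intro sum_scale_mem V)
      then have xw: "x - w \<in> V" using x V subspace_diff by blast
      have "\<theta> i (x - w) = 0" if "i \<in> J" for i
      proof -
        have "\<theta> i w = (\<Sum>l\<in>J. if l = i then \<theta> i x else 0)"
          unfolding w_def sum scale using f(2) that by (intro sum.cong) auto
        then show ?thesis using that insert.hyps by (simp add: diff)
      qed
      then have "\<theta> j (x - w) = 0" using none xw by blast
      then have "\<theta> j x = (\<Sum>l\<in>J. \<theta> l x * \<theta> j (f l))"
        unfolding diff w_def sum scale by simp
      moreover have "(\<Sum>i\<in>J. (if i = j then 1 else - \<theta> j (f i)) * \<theta> i x) =
          (\<Sum>i\<in>J. - (\<theta> i x * \<theta> j (f i)))"
        using insert.hyps by (intro sum.cong) auto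
      ultimately show "(\<Sum>i\<in>insert j J. (if i = j then 1 else - \<theta> j (f i)) * \<theta> i x) = 0"
        using insert.hyps by (simp add: sum_negf)
    qed simp
    then show False by simp
  qed
  then obtain v where v: "v \<in> V" "\<And>i. i \<in> J \<Longrightarrow> \<theta> i v = 0" "\<theta> j v \<noteq> 0" by blast
  define w where "w = scale (1 / \<theta> j v) v"
  have w: "w \<in> V" "\<And>i. i \<in> J \<Longrightarrow> \<theta> i w = 0" "\<theta> j w = 1"
    using v V by (simp_all add: w_def scale subspace_scale)
  let ?f = "\<lambda>i. if i = j then w else f i - scale (\<theta> j (f i)) w"
  have "\<forall>i\<in>insert j J. ?f i \<in> V"
    using f(1) w(1) V by (simp add: subspace_diff subspace_scale)
  moreover have "\<forall>i\<in>insert j J. \<forall>l\<in>insert j J. \<theta> i (?f l) = (if i = l then 1 else 0)"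
    using f(2) w insert.hyps by (auto simp: diff scale)
  ultimately show ?case by (intro exI[of _ ?f] conjI)
qed simp

section \<open>Spanning the powers of the maximal ideal by monomials\<close>

context local_artinian_algebra
begin

definition mono_span :: "(nat \<Rightarrow> 'a) \<Rightarrow> nat \<Rightarrow> nat \<Rightarrow> 'a set" where
  "mono_span a n i = span {mono_at a \<alpha> |\<alpha>. keys \<alpha> \<subseteq> {1..n} \<and> i \<le> expo_deg \<alpha>}"

lemma mono_span_base: "keys \<alpha> \<subseteq> {1..n} \<Longrightarrow> i \<le> expo_deg \<alpha> \<Longrightarrow> mono_at a \<alpha> \<in> mono_span a n i"
  unfolding mono_span_def by (intro span_base) blast

lemma mono_span_induct [consumes 1, case_names add scale mono]:
  assumes "x \<in> mono_span a n i"
    and "\<And>x y. P x \<Longrightarrow> P y \<Longrightarrow> P (x + y)" "\<And>c x. P x \<Longrightarrow> P (scale c x)"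
    and "\<And>\<alpha>. keys \<alpha> \<subseteq> {1..n} \<Longrightarrow> i \<le> expo_deg \<alpha> \<Longrightarrow> P (mono_at a \<alpha>)" and "P 0"
  shows "P x"
proof -
  have "subspace (Collect P)"
    unfolding subspace_def using assms(2,3,5) by auto
  then have "mono_span a n i \<subseteq> Collect P"
    unfolding mono_span_def by (intro span_minimal) (use assms(4) in blast)
  then show ?thesis using assms(1) by blast
qed

lemma subspace_mono_span: "subspace (mono_span a n i)"
  unfolding mono_span_def by (rule subspace_span)

lemma mono_span_mult:
  assumes "x \<in> mono_span a n i" "y \<in> mono_span a n j"
  shows "x * y \<in> mono_span a n (i + j)"
  using assms(1)
proof (induction rule: mono_span_induct)
  case \<alpha>: (mono \<alpha>)
  from assms(2) show ?case
  proof (induction rule: mono_span_induct)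
    case (mono \<beta>)
    have "keys (\<alpha> + \<beta>) \<subseteq> {1..n}"
      unfolding keys_add_nat using \<alpha>(1) mono(1) by (rule Un_least)
    moreover have "i + j \<le> expo_deg (\<alpha> + \<beta>)"
      unfolding expo_deg_add using \<alpha>(2) mono(2) by (rule add_mono)
    ultimately show ?case
      unfolding mono_at_add[symmetric] by (rule mono_span_base)
  qed (use subspace_mono_span[of a n "i + j"] in
      \<open>auto simp: distrib_left scale_mult_right intro: subspace_add subspace_scale subspace_0\<close>)
qed (use subspace_mono_span[of a n "i + j"] in
    \<open>auto simp: distrib_right scale_mult_left intro: subspace_add subspace_scale subspace_0\<close>)

end

context inverse_system
begin

text \<open>Every element is congruent to a scalar modulo the span of the monomials of positive
  degree. That span lies in \<open>M\<close>, and a scalar in \<open>M\<close> is 0, so it is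
  \<open>M\<close> itself; products then give the higher powers.\<close>

lemma Mpow_mono_span: "Mpow i \<subseteq> mono_span a n i"
proof (induction i)
  case 0
  show ?case using span_mono by (simp add: mono_span_def)
next
  case (Suc i)
  have const: "\<exists>c. x - scale c 1 \<in> mono_span a n 1" for x
  proof (induction x rule: mono_induct)
    case (add x y)
    then obtain c d where "x - scale c 1 \<in> mono_span a n 1" "y - scale d 1 \<in> mono_span a n 1" by blast
    then have "(x - scale c 1) + (y - scale d 1) \<in> mono_span a n 1"
      by (rule subspace_add[OF subspace_mono_span])
    then have "x + y - scale (c + d) 1 \<in> mono_span a n 1" by (simp add: scale_left_distrib algebra_simps)
    then show ?case ..
  next
    case (scale d x)
    then obtain c where "x - scale c 1 \<in> mono_span a n 1" by blast
    then have "scale d (x - scale c 1) \<in> mono_span a n 1"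
      by (rule subspace_scale[OF subspace_mono_span])
    then show ?case by (auto simp: scale_right_diff_distrib)
  next
    case (mono \<alpha>)
    show ?case
    proof (cases "\<alpha> = 0")
      case True
      then have "mono_at a \<alpha> - scale 1 1 \<in> mono_span a n 1"
        by (simp add: subspace_0 subspace_mono_span)
      then show ?thesis ..
    next
      case False
      then have "1 \<le> expo_deg \<alpha>" using expo_deg_eq_0_iff[of \<alpha>] by linarith
      then have "mono_at a \<alpha> - scale 0 1 \<in> mono_span a n 1"
        using mono by (simp add: mono_span_base)
      then show ?thesis ..
    qed
  qed
  have subM: "mono_span a n 1 \<subseteq> M"
  proof
    fix x assume "x \<in> mono_span a n 1"
    then show "x \<in> M"
    proof (induction rule: mono_span_induct)
      case (mono \<alpha>)
      then show ?case using mono_Mpow[of \<alpha>] Mpow_antimono[of 1 "expo_deg \<alpha>"] Mpow_1 by auto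
    qed (use subspace_M in \<open>auto intro: subspace_add subspace_scale subspace_0\<close>)
  qed
  have M: "M \<subseteq> mono_span a n 1"
  proof
    fix x assume x: "x \<in> M"
    obtain c where c: "x - scale c 1 \<in> mono_span a n 1" using const by blast
    then have "x - (x - scale c 1) \<in> M" using subM subspace_diff[OF subspace_M x] by blast
    then have "c = 0" by (simp add: scale_one_in_M_iff)
    then show "x \<in> mono_span a n 1" using c by simp
  qed
  show ?case
  proof
    fix x assume "x \<in> Mpow (Suc i)"
    then show "x \<in> mono_span a n (Suc i)"
    proof (induction rule: max_ideal_pow_Suc_induct)
      case (prod y z)
      then show ?case using mono_span_mult[of y a n i z 1] Suc M by auto
    next
      case (sum y z)
      then show ?case by (rule subspace_add[OF subspace_mono_span])
    qed
  qed
qed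

lemma Mpow_subset:
  assumes "subspace S"
    and "\<And>\<alpha>. keys \<alpha> \<subseteq> {1..n} \<Longrightarrow> i \<le> expo_deg \<alpha> \<Longrightarrow> mono_at a \<alpha> \<in> S"
  shows "Mpow i \<subseteq> S"
  by (rule order_trans[OF Mpow_mono_span], unfold mono_span_def, rule span_minimal[OF _ assms(1)])
    (use assms(2) in blast)

lemma Mpow_induct [consumes 1, case_names add scale mono]:
  assumes "x \<in> Mpow i"
    and "\<And>x y. P x \<Longrightarrow> P y \<Longrightarrow> P (x + y)" "\<And>c x. P x \<Longrightarrow> P (scale c x)"
    and "\<And>\<alpha>. keys \<alpha> \<subseteq> {1..n} \<Longrightarrow> i \<le> expo_deg \<alpha> \<Longrightarrow> P (mono_at a \<alpha>)" and "P 0"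
  shows "P x"
  using mono_span_induct[of x a n i P] Mpow_mono_span[of i] assms by blast

end

text \<open>The shape of \<open>F\<close> as rules for \<open>lam\<close>. For k = 2,
  \<open>lam_power_mult\<close> reflects that x_1^2 annihilates F_3; \<open>lam_deg4\<close> that
  F_3 is a cubic; \<open>lam_deg3\<close> that it involves no y_j with j > m;
  \<open>lam_deg2\<close> records the squares. The test monomials of \<open>indep_deg3\<close> are
  the quadratic ones in y_1, ..., y_m because the derivatives of F_3 contain no others.\<close>

locale normal_system = inverse_system scale n a lam F
  for scale :: "'k::field_char_0 \<Rightarrow> 'a::comm_ring_1 \<Rightarrow> 'a" and n a lam F +
  fixes s m :: nat
  assumes s3: "3 \<le> s" and m1: "1 \<le> m" and mn: "m \<le> n"
    and lam_power: "lam (a 1 ^ k) = (if k = s then fact s else 0)"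
    and lam_power_mult: "j \<in> {2..n} \<Longrightarrow> lam (a j * a 1 ^ k) = 0"
    and lam_deg4: "j \<in> {2..n} \<Longrightarrow> keys \<beta> \<subseteq> {1..n} \<Longrightarrow> 3 \<le> expo_deg \<beta> \<Longrightarrow>
      lam (a j * mono_at a \<beta>) = 0"
    and lam_deg3: "j \<in> {m+1..n} \<Longrightarrow> keys \<beta> \<subseteq> {1..n} \<Longrightarrow> 2 \<le> expo_deg \<beta> \<Longrightarrow>
      lam (a j * mono_at a \<beta>) = 0"
    and lam_deg2: "i \<in> {2..n} \<Longrightarrow> j \<in> {2..n} \<Longrightarrow> lam (a i * a j) = (if i = j \<and> m < i then 2 else 0)"
    and indep_deg3: "(\<And>\<beta>. keys \<beta> \<subseteq> {1..m} \<Longrightarrow> expo_deg \<beta> = 2 \<Longrightarrow>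
      (\<Sum>j=2..m. c j * lam (a j * mono_at a \<beta>)) = 0) \<Longrightarrow> j \<in> {2..m} \<Longrightarrow> c j = 0"
begin

lemma one_in: "1 \<in> {1..n}"
  using m1 mn by simp

lemma lam_Mpow3: "j \<in> {2..n} \<Longrightarrow> x \<in> Mpow 3 \<Longrightarrow> lam (a j * x) = 0"
  by (rotate_tac, induction rule: Mpow_induct)
    (simp_all add: distrib_left lam_add scale_mult_right lam_scale lam_deg4)

lemma lam_Mpow2: "j \<in> {m+1..n} \<Longrightarrow> x \<in> Mpow 2 \<Longrightarrow> lam (a j * x) = 0"
  by (rotate_tac, induction rule: Mpow_induct)
    (simp_all add: distrib_left lam_add scale_mult_right lam_scale lam_deg3)

lemma split_index:
  assumes "keys (\<alpha> :: nat \<Rightarrow>\<^sub>0 nat) \<subseteq> {1..n}"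
  obtains "\<alpha> = single 1 (expo_deg \<alpha>)"
  | j \<beta> where "j \<in> {2..n}" "keys \<beta> \<subseteq> {1..n}" "\<alpha> = single j 1 + \<beta>"
      "expo_deg \<alpha> = Suc (expo_deg \<beta>)" "mono_at a \<alpha> = a j * mono_at a \<beta>"
proof (rule expo_single_or_split[of \<alpha> 1])
  fix j \<beta> assume j: "j \<noteq> 1" "\<alpha> = single j 1 + \<beta>"
  then have "j \<in> {2..n}" using assms by (auto simp: keys_add_nat)
  then show thesis
    using that(2)[of j \<beta>] j assms by (simp add: keys_add_nat expo_deg_add mono_at_add)
qed (rule that(1))

lemma a1_power_Mpow: "a 1 ^ k \<in> Mpow k"
  using M_power gen_in_M[OF one_in] .

text \<open>By nondegeneracy an ideal on which \<open>lam\<close> vanishes is 0. A monomial of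
  degree above s is a power of \<open>a 1\<close> beyond s or, since s \<ge> 3, falls under
  \<open>lam_deg4\<close>.\<close>

lemma Mpow_Suc_s: "Mpow (Suc s) = {0}"
proof -
  have "x = 0" if "x \<in> Mpow (Suc s)" for x
  proof (rule zero_if_lam_mono)
    fix \<alpha> :: "nat \<Rightarrow>\<^sub>0 nat" assume \<alpha>: "keys \<alpha> \<subseteq> {1..n}"
    have "x * mono_at a \<alpha> \<in> Mpow (Suc s)" using that by (rule Mpow_absorb)
    then show "lam (x * mono_at a \<alpha>) = 0"
    proof (induction rule: Mpow_induct)
      case (mono \<beta>)
      show ?case
      proof (rule split_index[OF mono(1)])
        assume "\<beta> = single 1 (expo_deg \<beta>)"
        then have "mono_at a \<beta> = a 1 ^ expo_deg \<beta>" using mono_at_single by metis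
        then show ?thesis using lam_power mono(2) by simp
      next
        fix j \<gamma> assume "j \<in> {2..n}" "keys \<gamma> \<subseteq> {1..n}" "expo_deg \<beta> = Suc (expo_deg \<gamma>)"
          "mono_at a \<beta> = a j * mono_at a \<gamma>"
        then show ?thesis using mono(2) s3 lam_deg4[of j \<gamma>] by simp
      qed
    qed (simp_all add: lam_add lam_scale)
  qed
  then show ?thesis using subspace_0[OF subspace_Mpow] by blast
qed

lemma sdeg: "s = sdeg TYPE('a)"
  unfolding sdeg_iff using Mpow_Suc_s a1_power_Mpow[of s] lam_power[of s] by auto

text \<open>Both sides are orthogonal to all monomials of positive degree, so only their values
  under \<open>lam\<close> have to agree.\<close>

lemma mono_deg3:
  assumes j: "j \<in> {2..n}" and \<beta>: "keys \<beta> \<subseteq> {1..n}" "2 \<le> expo_deg \<beta>"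
  shows "a j * mono_at a \<beta> = scale (lam (a j * mono_at a \<beta>) / fact s) (a 1 ^ s)"
proof -
  let ?c = "lam (a j * mono_at a \<beta>) / fact s"
  have "a j * mono_at a \<beta> - scale ?c (a 1 ^ s) = 0"
  proof (rule zero_if_lam_mono)
    fix \<alpha> :: "nat \<Rightarrow>\<^sub>0 nat" assume \<alpha>: "keys \<alpha> \<subseteq> {1..n}"
    have eq: "(a j * mono_at a \<beta> - scale ?c (a 1 ^ s)) * mono_at a \<alpha> + scale ?c (a 1 ^ s * mono_at a \<alpha>) =
        a j * mono_at a (\<beta> + \<alpha>)"
      by (simp add: left_diff_distrib scale_mult_left mono_at_add mult.assoc)
    have "lam ((a j * mono_at a \<beta> - scale ?c (a 1 ^ s)) * mono_at a \<alpha>) + ?c * lam (a 1 ^ s * mono_at a \<alpha>) =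
        lam (a j * mono_at a (\<beta> + \<alpha>))"
      unfolding eq[symmetric] lam_add lam_scale ..
    moreover have "?c * lam (a 1 ^ s * mono_at a \<alpha>) = lam (a j * mono_at a (\<beta> + \<alpha>))"
    proof (cases "\<alpha> = 0")
      case True
      then show ?thesis by (simp add: lam_power[simplified])
    next
      case False
      then have pos: "1 \<le> expo_deg \<alpha>" using expo_deg_eq_0_iff[of \<alpha>] by linarith
      have "a 1 ^ s * mono_at a \<alpha> \<in> Mpow (s + expo_deg \<alpha>)"
        by (intro Mpow_mult a1_power_Mpow mono_Mpow \<alpha>)
      then have "a 1 ^ s * mono_at a \<alpha> = 0"
        using Mpow_antimono[of "Suc s" "s + expo_deg \<alpha>"] Mpow_Suc_s pos by auto
      moreover have "lam (a j * mono_at a (\<beta> + \<alpha>)) = 0"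
        using lam_deg4[OF j, of "\<beta> + \<alpha>"] \<beta> \<alpha> pos by (simp add: keys_add_nat expo_deg_add)
      ultimately show ?thesis by simp
    qed
    ultimately show "lam ((a j * mono_at a \<beta> - scale ?c (a 1 ^ s)) * mono_at a \<alpha>) = 0" by simp
  qed
  then show ?thesis by simp
qed

text \<open>By \<open>mono_deg3\<close> the monomials containing another generator are multiples of
  a_1^s, so a_1^i alone generates M^i modulo M^(i+1). It is not in M^(i+1), since multiplication by
  a_1^(s-i) would put a_1^s into M^(s+1) = 0.\<close>

lemma hilbert_ge3:
  assumes i: "3 \<le> i" "i \<le> s"
  shows "hilbert scale i = 1"
proof -
  have "hilbert scale i = card {0::nat}"
  proof (rule hilbert_family[where f = "\<lambda>_. a 1 ^ i"])
    fix c and j :: nat assume j: "j \<in> {0}" and "(\<Sum>j\<in>{0::nat}. scale (c j) (a 1 ^ i)) \<in> Mpow (Suc i)"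
    then have "scale (c 0) (a 1 ^ i) * a 1 ^ (s - i) \<in> Mpow (Suc i + (s - i))"
      by (intro Mpow_mult a1_power_Mpow) simp
    then have "scale (c 0) (a 1 ^ s) = 0"
      using i Mpow_Suc_s by (simp add: scale_mult_left flip: power_add)
    then have "lam (scale (c 0) (a 1 ^ s)) = 0" by (simp only: lam_0)
    then have "c 0 * fact s = 0" using lam_power[of s] by (simp only: lam_scale if_True simp_thms)
    then show "c j = 0" using j by simp
  next
    let ?S = "{v. \<exists>c. v - (\<Sum>j\<in>{0::nat}. scale (c j) (a 1 ^ i)) \<in> Mpow (Suc i)}"
    have "Mpow i \<subseteq> ?S"
    proof (rule Mpow_subset[OF subspace_mod_family[OF subspace_Mpow]])
      fix \<alpha> :: "nat \<Rightarrow>\<^sub>0 nat" assume mono: "keys \<alpha> \<subseteq> {1..n}" "i \<le> expo_deg \<alpha>"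
      have pw: "scale e (a 1 ^ k) \<in> ?S" if "i \<le> k" for e k
      proof (cases "k = i")
        case True
        then show ?thesis by (intro CollectI exI[of _ "\<lambda>_. e"]) (simp add: subspace_0 subspace_Mpow)
      next
        case False
        then have "a 1 ^ k \<in> Mpow (Suc i)"
          using that a1_power_Mpow[of k] Mpow_antimono[of "Suc i" k] by auto
        then show ?thesis by (intro CollectI exI[of _ "\<lambda>_. 0"]) (simp add: subspace_scale subspace_Mpow)
      qed
      show "mono_at a \<alpha> \<in> ?S"
      proof (rule split_index[OF mono(1)])
        assume "\<alpha> = single 1 (expo_deg \<alpha>)"
        then have "mono_at a \<alpha> = a 1 ^ expo_deg \<alpha>" using mono_at_single by metis
        then show ?thesis using pw[OF mono(2), of 1] by simp
      next
        fix j \<gamma> assume j: "j \<in> {2..n}" "keys \<gamma> \<subseteq> {1..n}" "expo_deg \<alpha> = Suc (expo_deg \<gamma>)"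
          "mono_at a \<alpha> = a j * mono_at a \<gamma>"
        then have "2 \<le> expo_deg \<gamma>" using mono(2) i(1) by simp
        from mono_deg3[OF j(1,2) this] show ?thesis
          unfolding j(4) by (rule ssubst[where P = "\<lambda>v. v \<in> ?S"]) (rule pw[OF i(2)])
      qed
    qed
    moreover fix v assume "v \<in> Mpow i"
    ultimately show "\<exists>c. v - (\<Sum>j\<in>{0::nat}. scale (c j) (a 1 ^ i)) \<in> Mpow (Suc i)" by blast
  qed (simp_all add: a1_power_Mpow[simplified])
  then show ?thesis by simp
qed

lemma indep_Mpow2:
  assumes "\<And>x. x \<in> Mpow 2 \<Longrightarrow> (\<Sum>j=2..m. c j * lam (a j * x)) = 0" and j: "j \<in> {2..m}"
  shows "c j = 0"
proof (rule indep_deg3[OF _ j])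
  fix \<beta> :: "nat \<Rightarrow>\<^sub>0 nat" assume "keys \<beta> \<subseteq> {1..m}" "expo_deg \<beta> = 2"
  then have "mono_at a \<beta> \<in> Mpow 2"
    using mono_Mpow[of \<beta>] mn by (metis atLeastatMost_subset_iff le_refl order_trans)
  then show "(\<Sum>j=2..m. c j * lam (a j * mono_at a \<beta>)) = 0" by (rule assms(1))
qed

text \<open>M^2/M^3 is dual to the span of m functionals on M^2: the pairings with a_1^(s-2) and
  with a_2, ..., a_m. They are independent and their common kernel is exactly M^3, so dual vectors
  form a basis modulo M^3.\<close>

lemma hilbert_2: "hilbert scale 2 = m"
proof -
  define \<theta> where "\<theta> = (\<lambda>j x. if j = 1 then lam (a 1 ^ (s - 2) * x) else lam (a j * x))"
  have \<theta>_add: "\<theta> j (x + y) = \<theta> j x + \<theta> j y" for j x y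
    by (simp add: \<theta>_def distrib_left lam_add)
  have \<theta>_scale: "\<theta> j (scale c x) = c * \<theta> j x" for j c x
    by (simp add: \<theta>_def scale_mult_right lam_scale)
  have \<theta>_diff: "\<theta> j (x - y) = \<theta> j x - \<theta> j y" for j x y
    using \<theta>_add[of j x "scale (-1) y"] \<theta>_scale[of j "-1" y] by simp
  have \<theta>_sum: "\<theta> j (\<Sum>l\<in>K. h l) = (\<Sum>l\<in>K. \<theta> j (h l))" for j h and K :: "nat set"
    using \<theta>_scale[of j 0 0] by (induction K rule: infinite_finite_induct) (simp_all add: \<theta>_add)
  have a1sq: "a 1 ^ (s - 2) * a 1 ^ 2 = a 1 ^ s"
  proof -
    have "s - 2 + 2 = s" using s3 by simp
    then show ?thesis by (metis power_add)
  qed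
  have "\<exists>f. (\<forall>j\<in>{1..m}. f j \<in> Mpow 2) \<and> (\<forall>i\<in>{1..m}. \<forall>j\<in>{1..m}. \<theta> i (f j) = (if i = j then 1 else 0))"
  proof (rule dual_family[OF _ subspace_Mpow])
    fix c j assume c: "\<And>x. x \<in> Mpow 2 \<Longrightarrow> (\<Sum>j=1..m. c j * \<theta> j x) = 0" and j: "j \<in> {1..m}"
    have split: "(\<Sum>j=1..m. c j * \<theta> j x) = c 1 * lam (a 1 ^ (s - 2) * x) + (\<Sum>j=2..m. c j * lam (a j * x))" for x
    proof -
      have "{1..m} = insert 1 {2..m}" using m1 by auto
      then have "(\<Sum>j=1..m. c j * \<theta> j x) = c 1 * \<theta> 1 x + (\<Sum>j=2..m. c j * \<theta> j x)" by simp
      also have "(\<Sum>j=2..m. c j * \<theta> j x) = (\<Sum>j=2..m. c j * lam (a j * x))"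
        by (intro sum.cong) (auto simp: \<theta>_def)
      finally show ?thesis by (simp add: \<theta>_def)
    qed
    \<comment> \<open>Testing on a_1^2 isolates the coefficient of the first functional; the others
      are independent by \<open>indep_Mpow2\<close>.\<close>
    have "(\<Sum>j=2..m. c j * lam (a j * a 1 ^ 2)) = 0"
      using lam_power_mult mn by (intro sum.neutral) auto
    then have "c 1 * fact s = 0"
      using split[of "a 1 ^ 2"] c[OF a1_power_Mpow] lam_power[of s] a1sq by simp
    then have c1: "c 1 = 0" by simp
    show "c j = 0"
    proof (cases "j = 1")
      case False
      then have "j \<in> {2..m}" using j by auto
      then show ?thesis
        using c split c1 by (intro indep_Mpow2[of c]) auto
    qed (use c1 in simp)
  qed (simp_all add: \<theta>_add \<theta>_scale)
  then obtain f where f: "\<And>j. j \<in> {1..m} \<Longrightarrow> f j \<in> Mpow 2"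
    "\<And>i j. i \<in> {1..m} \<Longrightarrow> j \<in> {1..m} \<Longrightarrow> \<theta> i (f j) = (if i = j then 1 else 0)" by blast
  have \<theta>_f: "\<theta> i (\<Sum>j=1..m. scale (c j) (f j)) = c i" if "i \<in> {1..m}" for i c
  proof -
    have "\<theta> i (\<Sum>j=1..m. scale (c j) (f j)) = (\<Sum>j=1..m. if j = i then c i else 0)"
      unfolding \<theta>_sum \<theta>_scale using f(2)[OF that] by (intro sum.cong) auto
    then show ?thesis using that by simp
  qed
  have \<theta>_Mpow3: "\<theta> i x = 0" if "x \<in> Mpow 3" "i \<in> {1..m}" for i x
  proof (cases "i = 1")
    case True
    have "a 1 ^ (s - 2) * x \<in> Mpow (s - 2 + 3)" by (intro Mpow_mult a1_power_Mpow that)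
    then show ?thesis using True s3 Mpow_Suc_s by (simp add: \<theta>_def)
  next
    case False
    then show ?thesis using lam_Mpow3[of i x] that mn by (simp add: \<theta>_def)
  qed
  have ker: "x \<in> Mpow 3" if x: "x \<in> Mpow 2" and 0: "\<And>i. i \<in> {1..m} \<Longrightarrow> \<theta> i x = 0" for x
  proof -
    \<comment> \<open>The combination of a_1^3, ..., a_1^s with the same pairings as
      \<open>x\<close> against a_1^t for t \<le> s - 3. For larger t the pairing with
      \<open>w\<close> is 0; that with \<open>x\<close> is 0 by the first functional if t = s - 2
      and by degree beyond. So x - w is orthogonal to all powers of \<open>a 1\<close>.\<close>
    define w where "w = (\<Sum>i=3..s. scale (lam (x * a 1 ^ (s - i)) / fact s) (a 1 ^ i))"
    have w: "w \<in> Mpow 3"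
      unfolding w_def
    proof (intro sum_scale_mem subspace_Mpow)
      fix i assume "i \<in> {3..s}"
      then show "a 1 ^ i \<in> Mpow 3" using a1_power_Mpow[of i] Mpow_antimono[of 3 i] by auto
    qed
    then have xw: "x - w \<in> Mpow 2"
      using x Mpow_antimono[of 2 3] by (intro subspace_diff[OF subspace_Mpow]) auto
    have lam_diff: "lam (y - z) = lam y - lam z" for y z
      using lam_add[of y "scale (-1) z"] lam_scale[of "-1" z] by simp
    have "x - w = 0"
    proof (rule zero_if_lam_mono)
      fix \<beta> :: "nat \<Rightarrow>\<^sub>0 nat" assume \<beta>: "keys \<beta> \<subseteq> {1..n}"
      show "lam ((x - w) * mono_at a \<beta>) = 0"
      proof (rule split_index[OF \<beta>])
        define t where "t = expo_deg \<beta>"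
        assume "\<beta> = single 1 (expo_deg \<beta>)"
        then have m: "mono_at a \<beta> = a 1 ^ t" unfolding t_def using mono_at_single by metis
        have "lam (w * a 1 ^ t) = (\<Sum>i=3..s. lam (x * a 1 ^ (s - i)) / fact s * lam (a 1 ^ (i + t)))"
          by (simp add: w_def sum_distrib_right lam_sum scale_mult_left lam_scale power_add)
        also have "\<dots> = (\<Sum>i=3..s. if i = s - t \<and> t \<le> s then lam (x * a 1 ^ t) else 0)"
          using lam_power by (intro sum.cong) auto
        also have "\<dots> = lam (x * a 1 ^ t)"
        proof (cases "t \<le> s - 3")
          case True
          then have "t \<le> s" "s - t \<in> {3..s}" using s3 by auto
          then show ?thesis by simp
        next
          case False
          have z: "lam (x * a 1 ^ t) = 0"
          proof (cases "t = s - 2")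
            case True
            then show ?thesis using 0[of 1] m1 by (simp add: \<theta>_def mult.commute)
          next
            case False
            then have "Suc s \<le> 2 + t" using \<open>\<not> t \<le> s - 3\<close> by linarith
            moreover have "x * a 1 ^ t \<in> Mpow (2 + t)" by (intro Mpow_mult x a1_power_Mpow)
            ultimately have "x * a 1 ^ t = 0"
              using Mpow_antimono[of "Suc s" "2 + t"] Mpow_Suc_s by blast
            then show ?thesis by simp
          qed
          show ?thesis unfolding z by simp
        qed
        finally show ?thesis unfolding m by (simp add: left_diff_distrib lam_diff)
      next
        fix j \<gamma> assume j: "j \<in> {2..n}" "keys \<gamma> \<subseteq> {1..n}"
          "mono_at a \<beta> = a j * mono_at a \<gamma>"
        show ?thesis
        proof (cases "\<gamma> = 0")
          case True
          have "lam (a j * w) = 0" using lam_Mpow3[OF j(1) w] .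
          moreover have "lam (a j * x) = 0"
          proof (cases "j \<le> m")
            case True
            then show ?thesis using 0[of j] j(1) by (auto simp: \<theta>_def)
          next
            case False
            then show ?thesis using lam_Mpow2[OF _ x, of j] j(1) by simp
          qed
          ultimately show ?thesis
            using True j(3) by (simp add: algebra_simps lam_diff)
        next
          case False
          then have "1 \<le> expo_deg \<gamma>" using expo_deg_eq_0_iff[of \<gamma>] by linarith
          then have "(x - w) * mono_at a \<gamma> \<in> Mpow 3"
            using Mpow_mult[OF xw mono_Mpow[OF j(2)]] Mpow_antimono[of 3 "2 + expo_deg \<gamma>"] by auto
          from lam_Mpow3[OF j(1) this] show ?thesis by (simp add: j(3) ac_simps)
        qed
      qed
    qed
    then show ?thesis using w by simp
  qed
  have "hilbert scale 2 = card {1..m}"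
  proof (rule hilbert_family[where f = f])
    fix c j assume w: "(\<Sum>j=1..m. scale (c j) (f j)) \<in> Mpow (Suc 2)" and j: "j \<in> {1..m}"
    moreover have "Suc 2 = (3 :: nat)" by simp
    ultimately have "(\<Sum>j=1..m. scale (c j) (f j)) \<in> Mpow 3" by metis
    from \<theta>_Mpow3[OF this j] show "c j = 0" unfolding \<theta>_f[OF j] .
  next
    fix v assume v: "v \<in> Mpow 2"
    let ?w = "\<Sum>j=1..m. scale (\<theta> j v) (f j)"
    have "v - ?w \<in> Mpow 3"
    proof (rule ker)
      show "v - ?w \<in> Mpow 2"
        using f(1) by (intro subspace_diff[OF subspace_Mpow v] sum_scale_mem subspace_Mpow)
    qed (simp only: \<theta>_diff \<theta>_f diff_self)
    then show "\<exists>c. v - (\<Sum>j=1..m. scale (c j) (f j)) \<in> Mpow (Suc 2)" by auto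
  qed (use f(1) in auto)
  then show ?thesis by simp
qed

text \<open>A combination of generators lying in M^2 is tested successively: pairing with a_1^(s-1)
  gives the first coefficient, pairing with a_j for j > m gives the j-th because a_j is orthogonal
  to M^2, and quadratic monomials settle the rest.\<close>

lemma hilbert_1: "hilbert scale 1 = n"
proof -
  have "hilbert scale 1 = card {1..n}"
  proof (rule hilbert_family[where f = a])
    let ?S = "{v. \<exists>c. v - (\<Sum>j=1..n. scale (c j) (a j)) \<in> Mpow (Suc 1)}"
    have "Mpow 1 \<subseteq> ?S"
    proof (rule Mpow_subset[OF subspace_mod_family[OF subspace_Mpow]])
      fix \<alpha> :: "nat \<Rightarrow>\<^sub>0 nat" assume mono: "keys \<alpha> \<subseteq> {1..n}" "1 \<le> expo_deg \<alpha>"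
      from mono(2) have "\<alpha> \<noteq> 0" by auto
      then obtain i \<beta> where \<beta>: "\<alpha> = single i 1 + \<beta>" by (rule expo_nonzero_split)
      show "mono_at a \<alpha> \<in> ?S"
      proof (cases "\<beta> = 0")
        case True
        then have i: "i \<in> {1..n}" using mono(1) \<beta> by simp
        have "(\<Sum>j=1..n. scale (if j = i then 1 else 0) (a j)) = (\<Sum>j=1..n. if j = i then a i else 0)"
          by (intro sum.cong) auto
        then have "mono_at a \<alpha> - (\<Sum>j=1..n. scale (if j = i then 1 else 0) (a j)) = 0"
          using i True \<beta> by simp
        then show ?thesis by (intro CollectI exI[of _ "\<lambda>j. if j = i then 1 else 0"]) (simp only: subspace_0 subspace_Mpow)
      next
        case False
        then have "2 \<le> expo_deg \<alpha>" using \<beta> expo_deg_eq_0_iff[of \<beta>] by (simp add: expo_deg_add del: expo_deg_eq_0_iff)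
        then have "mono_at a \<alpha> \<in> Mpow (Suc 1)"
          using mono_Mpow[OF mono(1)] Mpow_antimono[of "Suc 1" "expo_deg \<alpha>"] by auto
        then show ?thesis by (intro CollectI exI[of _ "\<lambda>_. 0"]) simp
      qed
    qed
    moreover fix v assume "v \<in> Mpow 1"
    ultimately show "\<exists>c. v - (\<Sum>j=1..n. scale (c j) (a j)) \<in> Mpow (Suc 1)" by blast
  next
    fix c j assume "(\<Sum>j=1..n. scale (c j) (a j)) \<in> Mpow (Suc 1)" and j: "j \<in> {1..n}"
    then have x: "(\<Sum>j=1..n. scale (c j) (a j)) \<in> Mpow 2" by (simp add: numeral_2_eq_2)
    have split1: "{1..n} = insert 1 {2..n}" using m1 mn by auto
    have lam_x: "lam ((\<Sum>j=1..n. scale (c j) (a j)) * y) = c 1 * lam (a 1 * y) + (\<Sum>j=2..n. c j * lam (a j * y))" for y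
      unfolding split1 by (simp add: sum_distrib_right distrib_right lam_add lam_sum scale_mult_left lam_scale)
    have "(\<Sum>j=1..n. scale (c j) (a j)) * a 1 ^ (s - 1) \<in> Mpow (2 + (s - 1))"
      by (intro Mpow_mult x a1_power_Mpow)
    then have "c 1 * lam (a 1 * a 1 ^ (s - 1)) + (\<Sum>j=2..n. c j * lam (a j * a 1 ^ (s - 1))) = 0"
      unfolding lam_x[symmetric] using s3 Mpow_Suc_s by simp
    moreover have "a 1 * a 1 ^ (s - 1) = a 1 ^ s"
      using s3 by (simp flip: power_Suc)
    ultimately have c1: "c 1 = 0" using lam_power[of s] lam_power_mult by simp
    have ch: "c j = 0" if j: "j \<in> {m+1..n}" for j
    proof -
      have "0 = (\<Sum>i=2..n. c i * lam (a i * a j))"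
        using lam_x[of "a j"] lam_Mpow2[OF j x] c1 by (simp add: mult.commute)
      also have "\<dots> = (\<Sum>i=2..n. if i = j then 2 * c j else 0)"
        using j m1 lam_deg2[of _ j] by (intro sum.cong) auto
      also have "\<dots> = 2 * c j" using j m1 by simp
      finally show ?thesis by simp
    qed
    have lam_x': "lam ((\<Sum>j=1..n. scale (c j) (a j)) * y) = (\<Sum>j=2..m. c j * lam (a j * y))" for y
    proof -
      have "(\<Sum>j=2..n. c j * lam (a j * y)) = (\<Sum>j=2..m. c j * lam (a j * y))"
        using ch mn by (intro sum.mono_neutral_right) auto
      then show ?thesis using lam_x[of y] c1 by simp
    qed
    have "c j = 0" if j: "j \<in> {2..m}" for j
    proof (rule indep_deg3[OF _ j])
      fix \<beta> :: "nat \<Rightarrow>\<^sub>0 nat" assume \<beta>: "keys \<beta> \<subseteq> {1..m}" "expo_deg \<beta> = 2"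
      then have \<beta>n: "keys \<beta> \<subseteq> {1..n}" using mn by fastforce
      \<comment> \<open>A quadratic monomial other than a_1^2 contains some a_l with l \<ge> 2. The
        combination times the other factor lies in M^3, to which a_l is orthogonal.\<close>
      have "lam ((\<Sum>j=1..n. scale (c j) (a j)) * mono_at a \<beta>) = 0"
      proof (rule split_index[OF \<beta>n])
        assume "\<beta> = single 1 (expo_deg \<beta>)"
        then have "mono_at a \<beta> = a 1 ^ 2" using mono_at_single \<beta>(2) by metis
        then show ?thesis using lam_x[of "a 1 ^ 2"] c1 lam_power_mult by simp
      next
        fix l \<gamma> assume l: "l \<in> {2..n}" "keys \<gamma> \<subseteq> {1..n}"
          "expo_deg \<beta> = Suc (expo_deg \<gamma>)" "mono_at a \<beta> = a l * mono_at a \<gamma>"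
        have "(\<Sum>j=1..n. scale (c j) (a j)) * mono_at a \<gamma> \<in> Mpow (2 + expo_deg \<gamma>)"
          using x mono_Mpow[OF l(2)] by (rule Mpow_mult)
        moreover have "2 + expo_deg \<gamma> = 3" using l(3) \<beta>(2) by simp
        ultimately have "(\<Sum>j=1..n. scale (c j) (a j)) * mono_at a \<gamma> \<in> Mpow 3" by metis
        from lam_Mpow3[OF l(1) this] show ?thesis by (simp only: l(4) ac_simps)
      qed
      then show "(\<Sum>j=2..m. c j * lam (a j * mono_at a \<beta>)) = 0" using lam_x' by simp
    qed
    then show "c j = 0" using c1 ch j by (cases "j = 1"; cases "j \<le> m") auto
  qed (auto intro: gen_in_M simp: Mpow_1)
  then show ?thesis by simp
qed

end

section \<open>Polynomials in normal form\<close>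

lemma eq_0_iff_dcoeff: "F = 0 \<longleftrightarrow> (\<forall>\<gamma>. dcoeff F \<gamma> = 0)"
proof
  assume "\<forall>\<gamma>. dcoeff F \<gamma> = 0"
  then show "F = 0" by (intro dcoeff_eqI) simp
qed simp

lemma yvar_power: "yvar i ^ k = single (single i k) (1 :: 'k::field)"
proof (induction k)
  case (Suc k)
  then show ?case by (simp add: yvar_def mult_single flip: single_add)
qed simp

lemma dcoeff_single:
  "dcoeff (single \<beta> c) \<alpha> = (if \<alpha> = \<beta> then expo_fact \<beta> * c else 0)"
  by (auto simp: dcoeff_def lookup_single when_def)

text \<open>The constants are s! and 2!, the factors between ordinary and divided coefficients of
  y_1^s and y_j^2.\<close>

lemma dcoeff_normal_form:
  "dcoeff (yvar 1 ^ s + G + (\<Sum>j=m+1..n. yvar j ^ 2)) \<alpha> =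
     (if \<alpha> = single 1 s then fact s else 0) + dcoeff G \<alpha> +
     (if \<exists>j\<in>{m+1..n}. \<alpha> = single j 2 then 2 else 0 :: 'k::field_char_0)"
proof -
  have "(\<Sum>j=m+1..n. dcoeff (yvar j ^ 2) \<alpha>) =
      (if \<exists>j\<in>{m+1..n}. \<alpha> = single j 2 then 2 else 0 :: 'k)"
  proof (cases "\<exists>j\<in>{m+1..n}. \<alpha> = single j 2")
    case True
    then obtain l where l: "l \<in> {m+1..n}" "\<alpha> = single l 2" by blast
    have "l = j" if "single l (2::nat) = single j 2" for j
      using that by (metis lookup_single_eq lookup_single_not_eq zero_neq_numeral)
    then have "(\<Sum>j=m+1..n. dcoeff (yvar j ^ 2) \<alpha>) = (\<Sum>j=m+1..n. if j = l then 2 else 0 :: 'k)"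
      by (intro sum.cong) (auto simp: yvar_power dcoeff_single l(2))
    also have "\<dots> = 2" using l(1) by simp
    finally show ?thesis using True by simp
  next
    case False
    then have "(\<Sum>j=m+1..n. dcoeff (yvar j ^ 2) \<alpha>) = (0 :: 'k)"
      by (intro sum.neutral) (auto simp: yvar_power dcoeff_single)
    with False show ?thesis by simp
  qed
  then show ?thesis
    by (simp add: dcoeff_add dcoeff_sum yvar_power[of _ s] dcoeff_single)
qed

lemma xvar_sq: "xvar i [^]\<^bsub>mps_ring n\<^esub> (2::nat) =
    (\<lambda>\<alpha>. if \<alpha> = single i 2 then 1 else (0 :: 'k::field))"
proof -
  let ?R = "mps_ring n :: 'k mps ring"
  have one: "\<one>\<^bsub>?R\<^esub> \<otimes>\<^bsub>?R\<^esub> f = f" for f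
    unfolding mps_ring_sel(2,3) mps_mult_const by simp
  have "xvar i [^]\<^bsub>?R\<^esub> (2::nat) = \<one>\<^bsub>?R\<^esub> \<otimes>\<^bsub>?R\<^esub> xvar i \<otimes>\<^bsub>?R\<^esub> xvar i"
    by (simp add: nat_pow_def numeral_2_eq_2 del: mps_ring_sel)
  also have "\<dots> = xvar i \<otimes>\<^bsub>?R\<^esub> xvar i"
    unfolding one ..
  also have "\<dots> = (\<lambda>\<alpha>. if \<alpha> = single i 1 + single i 1 then 1 * 1 else 0)"
    unfolding mps_ring_sel(2) xvar_def mps_mult_delta ..
  also have "single i 1 + single i 1 = single i (2::nat)"
    by (simp add: numeral_2_eq_2 flip: single_add)
  finally show ?thesis unfolding mult_1 .
qed

lemma xvar_sq_act_eq_0_iff: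
  fixes G :: "'k::field_char_0 mpoly"
  shows "(xvar i [^]\<^bsub>mps_ring n\<^esub> (2::nat)) \<circ>\<^sub>\<partial> G = 0 \<longleftrightarrow> (\<forall>\<gamma>. dcoeff G (\<gamma> + single i 2) = 0)"
proof -
  have "dcoeff ((xvar i [^]\<^bsub>mps_ring n\<^esub> (2::nat)) \<circ>\<^sub>\<partial> G) \<gamma> = dcoeff G (\<gamma> + single i 2)" for \<gamma>
    unfolding xvar_sq delta_act by simp
  then show ?thesis unfolding eq_0_iff_dcoeff by simp
qed

text \<open>Differentiation by x_j shifts divided coefficients by one unit in j, so a vanishing
  combination of derivatives is a system of scalar equations indexed by \<gamma>.\<close>

lemma lin_indep_family_iff:
  fixes G :: "'k::field_char_0 mpoly"
  shows "lin_indep_family (\<lambda>j. xvar j \<circ>\<^sub>\<partial> G) J \<longleftrightarrow>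
    (\<forall>c. (\<forall>\<gamma>. (\<Sum>j\<in>J. c j * dcoeff G (\<gamma> + single j 1)) = 0) \<longrightarrow> (\<forall>j\<in>J. c j = 0))"
proof -
  have "dcoeff (\<Sum>j\<in>J. cst (c j) * (xvar j \<circ>\<^sub>\<partial> G)) \<gamma> =
      (\<Sum>j\<in>J. c j * dcoeff G (\<gamma> + single j 1))" for c \<gamma>
    by (simp add: dcoeff_sum dcoeff_cst_mult act_xvar dcoeff_pdiff)
  then have "(\<Sum>j\<in>J. cst (c j) * (xvar j \<circ>\<^sub>\<partial> G)) = 0 \<longleftrightarrow>
      (\<forall>\<gamma>. (\<Sum>j\<in>J. c j * dcoeff G (\<gamma> + single j 1)) = 0)" for c
    unfolding eq_0_iff_dcoeff by simp
  then show ?thesis unfolding lin_indep_family_def by simp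
qed

lemma dcoeff_homogeneous: "homogeneous d G \<Longrightarrow> expo_deg \<alpha> \<noteq> d \<Longrightarrow> dcoeff G \<alpha> = 0"
  unfolding homogeneous_def expo_deg_def by (auto simp: dcoeff_eq_0_iff)

lemma dcoeff_mpolys: "G \<in> mpolys n \<Longrightarrow> \<not> keys \<alpha> \<subseteq> {1..n} \<Longrightarrow> dcoeff G \<alpha> = 0"
  unfolding mpolys_def by (auto simp: dcoeff_eq_0_iff)

lemma normal_form_mpolys:
  fixes G :: "'k::field_char_0 mpoly"
  assumes "G \<in> mpolys m" "1 \<le> m" "m \<le> n"
  shows "yvar 1 ^ s + G + (\<Sum>j=m+1..n. yvar j ^ 2) \<in> mpolys n"
  unfolding mpolys_def
proof (intro CollectI ballI)
  fix \<alpha> assume "\<alpha> \<in> keys (yvar 1 ^ s + G + (\<Sum>j=m+1..n. yvar j ^ 2))"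
  then have "dcoeff (yvar 1 ^ s + G + (\<Sum>j=m+1..n. yvar j ^ 2)) \<alpha> \<noteq> 0" by (simp add: dcoeff_eq_0_iff)
  then consider "\<alpha> = single 1 s" | "dcoeff G \<alpha> \<noteq> 0"
    | j where "j \<in> {m+1..n}" "\<alpha> = single j 2"
    unfolding dcoeff_normal_form by (auto split: if_splits)
  then show "keys \<alpha> \<subseteq> {1..n}"
  proof cases
    case 2
    then have "keys \<alpha> \<subseteq> {1..m}" using dcoeff_mpolys[OF assms(1)] by blast
    then show ?thesis using assms(3) by fastforce
  qed (use assms in auto)
qed

lemma single_add_neq:
  fixes \<beta> :: "nat \<Rightarrow>\<^sub>0 nat"
  assumes "i \<noteq> j"
  shows "single j 1 + \<beta> \<noteq> single i k"
proof
  assume "single j 1 + \<beta> = single i k"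
  then have "lookup (single j 1 + \<beta>) j = lookup (single i k) j"
    by simp
  then show False using assms by (simp add: lookup_add lookup_single_not_eq)
qed

text \<open>The three summands of the polynomial have disjoint supports, which makes each rule
  readable from one of them. This holds even for s = 3: as x_1^2 annihilates \<open>G\<close>, the
  monomial y_1^3 does not occur in it.\<close>

lemma normal_form_normal_system:
  fixes scale :: "'k::field_char_0 \<Rightarrow> 'a::comm_ring_1 \<Rightarrow> 'a" and G :: "'k mpoly"
  assumes sys: "inverse_system scale n a lam (yvar 1 ^ s + G + (\<Sum>j=m+1..n. yvar j ^ 2))"
    and s3: "3 \<le> s" and m1: "1 \<le> m" and mn: "m \<le> n"
    and G: "G \<in> mpolys m" "homogeneous 3 G" "(xvar 1 [^]\<^bsub>mps_ring n\<^esub> (2::nat)) \<circ>\<^sub>\<partial> G = 0"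
    and indep: "lin_indep_family (\<lambda>j. xvar j \<circ>\<^sub>\<partial> G) {2..m}"
  shows "normal_system scale n a lam (yvar 1 ^ s + G + (\<Sum>j=m+1..n. yvar j ^ 2)) s m"
proof -
  interpret inverse_system scale n a lam "yvar 1 ^ s + G + (\<Sum>j=m+1..n. yvar j ^ 2)" by (rule sys)
  note nf = dcoeff_normal_form
  have x1: "dcoeff G (\<gamma> + single 1 2) = 0" for \<gamma>
    using G(3) unfolding xvar_sq_act_eq_0_iff by blast
  note neq = single_add_neq
  have deg_neq: "\<alpha> \<noteq> single i k" if "expo_deg \<alpha> \<noteq> k" for \<alpha> i k
    using that by auto
  have lam_split: "lam (a j * mono_at a \<beta>) =
      dcoeff G (single j 1 + \<beta>) +
      (if \<exists>i\<in>{m+1..n}. single j 1 + \<beta> = single i 2 then 2 else 0)"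
    if "j \<in> {2..n}" "keys \<beta> \<subseteq> {1..n}" for j \<beta>
  proof -
    have "keys (single j 1 + \<beta>) \<subseteq> {1..n}"
      using that by (auto simp: keys_add_nat)
    from lam_mono[OF this] show ?thesis
      unfolding nf using neq[of 1 j \<beta> s] that by (simp add: mono_at_add)
  qed
  have key1: "keys (single 1 k :: nat \<Rightarrow>\<^sub>0 nat) \<subseteq> {1..n}" for k
    using m1 mn by auto
  have G1: "dcoeff G (single 1 k) = 0" for k
  proof (cases "k = 3")
    case True
    then have "single 1 k = single 1 1 + single 1 (2::nat)"
      using True by (simp add: numeral_2_eq_2 numeral_3_eq_3 flip: single_add)
    then show ?thesis using x1 by metis
  qed (use G(2) in \<open>simp add: dcoeff_homogeneous\<close>)
  have sq_deg: "\<not> (\<exists>i\<in>{m+1..n}. single j 1 + \<beta> = single i 2)"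
    if "expo_deg \<beta> \<noteq> 1" for j \<beta>
    using that deg_neq[of "single j 1 + \<beta>" 2] by (auto simp: expo_deg_add)
  show ?thesis
  proof unfold_locales
    show "lam (a 1 ^ k) = (if k = s then fact s else 0)" for k
    proof -
      have "lam (a 1 ^ k) = dcoeff (yvar 1 ^ s + G + (\<Sum>j=m+1..n. yvar j ^ 2)) (single 1 k)"
        using lam_mono[OF key1[of k]] by (simp only: mono_at_single)
      moreover have "\<not> (\<exists>j\<in>{m+1..n}. single 1 k = single j (2::nat))"
      proof
        assume "\<exists>j\<in>{m+1..n}. single 1 k = single j (2::nat)"
        then obtain j where "j \<in> {m+1..n}" and eq: "single 1 k = single j (2::nat)" by blast
        then have "j \<noteq> 1" using m1 by simp
        moreover have "lookup (single 1 k) j = (2::nat)" unfolding eq by simp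
        ultimately show False by (simp add: lookup_single_not_eq)
      qed
      moreover have "single (1::nat) k = single 1 s \<longleftrightarrow> k = s"
        by (metis lookup_single_eq)
      ultimately show ?thesis unfolding nf using G1[of k] by (simp del: One_nat_def)
    qed
    show "lam (a j * a 1 ^ k) = 0" if j: "j \<in> {2..n}" for j k
    proof -
      have "dcoeff G (single j 1 + single 1 k) = 0"
      proof (cases "k = 2")
        case False
        then show ?thesis by (intro dcoeff_homogeneous[OF G(2)]) (simp add: expo_deg_add)
      qed (simp only: x1)
      moreover have "single j 1 + single 1 k \<noteq> single i (2::nat)" for i
      proof (cases "i = j \<and> k = 1")
        case True
        then show ?thesis using neq[of j 1 "single j 1" 2] j by (simp add: add.commute)
      next
        case False
        then show ?thesis
          using neq[of i j "single 1 k" 2]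
            deg_neq[of "single j 1 + single 1 k" 2 i]
          by (auto simp: expo_deg_add)
      qed
      ultimately show ?thesis using lam_split[OF j key1[of k]] by simp
    qed
    show "lam (a j * mono_at a \<beta>) = 0"
      if "j \<in> {2..n}" "keys \<beta> \<subseteq> {1..n}" "3 \<le> expo_deg \<beta>" for j \<beta>
    proof -
      have "dcoeff G (single j 1 + \<beta>) = 0"
        using that by (intro dcoeff_homogeneous[OF G(2)]) (simp add: expo_deg_add)
      then show ?thesis using lam_split[OF that(1,2)] sq_deg[of \<beta> j] that(3) by simp
    qed
    show "lam (a j * mono_at a \<beta>) = 0"
      if "j \<in> {m+1..n}" "keys \<beta> \<subseteq> {1..n}" "2 \<le> expo_deg \<beta>" for j \<beta>
    proof -
      have "dcoeff G (single j 1 + \<beta>) = 0"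
        using that by (intro dcoeff_mpolys[OF G(1)]) (simp add: keys_add_nat)
      moreover have "j \<in> {2..n}" using that m1 by simp
      ultimately show ?thesis using lam_split[of j \<beta>] sq_deg[of \<beta> j] that by simp
    qed
    show "lam (a i * a j) = (if i = j \<and> m < i then 2 else 0)" if ij: "i \<in> {2..n}" "j \<in> {2..n}" for i j
    proof -
      have "dcoeff G (single i 1 + single j 1) = 0"
        by (intro dcoeff_homogeneous[OF G(2)]) (simp add: expo_deg_add)
      moreover have "(\<exists>l\<in>{m+1..n}. single i 1 + single j 1 = single l (2::nat)) \<longleftrightarrow> i = j \<and> m < i"
      proof
        assume "\<exists>l\<in>{m+1..n}. single i 1 + single j 1 = single l (2::nat)"
        then obtain l where l: "l \<in> {m+1..n}" "single i 1 + single j 1 = single l (2::nat)"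
          by blast
        then have "l = i" "l = j"
          using neq[of l i "single j 1" 2] neq[of l j "single i 1" 2]
          by (auto simp: add.commute)
        then show "i = j \<and> m < i" using l(1) by simp
      next
        assume "i = j \<and> m < i"
        then show "\<exists>l\<in>{m+1..n}. single i 1 + single j 1 = single l (2::nat)"
          using ij by (intro bexI[of _ i]) (auto simp: numeral_2_eq_2 simp flip: single_add)
      qed
      moreover have "keys (single j (1::nat)) \<subseteq> {1..n}" using ij by auto
      ultimately show ?thesis using lam_split[OF ij(1), of "single j 1"] by simp
    qed
    show "c j = 0"
      if c: "\<And>\<beta>. keys \<beta> \<subseteq> {1..m} \<Longrightarrow> expo_deg \<beta> = 2 \<Longrightarrow> (\<Sum>j=2..m. c j * lam (a j * mono_at a \<beta>)) = 0"
        and j: "j \<in> {2..m}" for c j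
    proof -
      \<comment> \<open>If \<gamma> is not a quadratic exponent in the first \<open>m\<close>
        variables, every term vanishes; so the test monomials at hand decide all equations.\<close>
      have "(\<Sum>j\<in>{2..m}. c j * dcoeff G (\<gamma> + single j 1)) = 0" for \<gamma>
      proof (cases "keys \<gamma> \<subseteq> {1..m} \<and> expo_deg \<gamma> = 2")
        case True
        then have "keys \<gamma> \<subseteq> {1..n}" using mn by fastforce
        then have "(\<Sum>j=2..m. c j * lam (a j * mono_at a \<gamma>)) =
            (\<Sum>j\<in>{2..m}. c j * dcoeff G (\<gamma> + single j 1))"
          using lam_split[of _ \<gamma>] sq_deg[of \<gamma>] True mn by (intro sum.cong) (auto simp: add.commute)
        then show ?thesis using c True by simp
      next
        case False
        have "dcoeff G (\<gamma> + single j 1) = 0" for j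
        proof (cases "expo_deg \<gamma> = 2")
          case True
          then have "\<not> keys (\<gamma> + single j 1) \<subseteq> {1..m}"
            using False by (auto simp: keys_add_nat)
          then show ?thesis by (rule dcoeff_mpolys[OF G(1)])
        next
          case False
          then show ?thesis by (intro dcoeff_homogeneous[OF G(2)]) (simp add: expo_deg_add)
        qed
        then show ?thesis by simp
      qed
      then show ?thesis using indep j unfolding lin_indep_family_iff by blast
    qed
  qed (use s3 m1 mn in auto)
qed

section \<open>A functional adapted to a power basis\<close>

lemma (in vector_space) functional_extend:
  assumes "independent B"
  shows "\<exists>\<phi>. (\<forall>x y. \<phi> (x + y) = \<phi> x + \<phi> y) \<and> (\<forall>c x. \<phi> (scale c x) = c * \<phi> x) \<and> (\<forall>x\<in>B. \<phi> x = f x)"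
proof -
  interpret p: vector_space_pair scale "(*) :: 'a \<Rightarrow> 'a \<Rightarrow> 'a"
    by unfold_locales (simp_all add: algebra_simps)
  obtain \<phi> where "Vector_Spaces.linear scale (*) \<phi>" "\<forall>x\<in>B. \<phi> x = f x"
    using p.linear_independent_extend[OF assms] by blast
  then show ?thesis unfolding Vector_Spaces.linear_iff by blast
qed

text \<open>Orthogonal sets of this kind are independent, so there is one of greatest size. If it
  does not span, its complement in \<open>E\<close> contains a nonisotropic vector: otherwise
  polarisation makes the form vanish on the complement, against nondegeneracy. The length is 2
  rather than 1 because it has to be 2! times the coefficient 1 of y_j^2.\<close>

lemma orthonormal_spanning:
  fixes scale :: "'k::{alg_closed_field,field_char_0} \<Rightarrow> 'b::ab_group_add \<Rightarrow> 'b"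
  assumes "vector_space scale" and E: "module.subspace scale E"
    and D: "finite D" "E \<subseteq> module.span scale D"
    and sym: "\<And>x y. \<beta> x y = \<beta> y x"
    and add: "\<And>x y z. \<beta> (x + y) z = \<beta> x z + \<beta> y z"
    and scl: "\<And>c x y. \<beta> (scale c x) y = c * \<beta> x y"
    and nondeg: "\<And>x. x \<in> E \<Longrightarrow> (\<And>y. y \<in> E \<Longrightarrow> \<beta> x y = 0) \<Longrightarrow> x = 0"
  shows "\<exists>Q. finite Q \<and> Q \<subseteq> E \<and> (\<forall>x\<in>Q. \<forall>y\<in>Q. \<beta> x y = (if x = y then 2 else 0)) \<and>
    E \<subseteq> module.span scale Q"
proof -
  interpret vector_space scale by fact
  have zero: "\<beta> 0 y = 0" for y using scl[of 0 0 y] by simp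
  have diff: "\<beta> (x - y) z = \<beta> x z - \<beta> y z" for x y z
    using add[of x "scale (-1) y" z] scl[of "-1" y z] by simp
  have sum: "\<beta> (\<Sum>i\<in>I. f i) y = (\<Sum>i\<in>I. \<beta> (f i) y)" for I :: "'b set" and f y
    by (induction I rule: infinite_finite_induct) (simp_all add: zero add)
  let ?P = "\<lambda>Q. Q \<subseteq> E \<and> (\<forall>x\<in>Q. \<forall>y\<in>Q. \<beta> x y = (if x = y then 2 else 0))"
  have comb: "\<beta> (\<Sum>x\<in>S. scale (u x) x) y = (if y \<in> S then 2 * u y else 0)"
    if Q: "?P Q" and S: "finite S" "S \<subseteq> Q" and y: "y \<in> Q" for Q S u y
  proof -
    have "\<beta> (\<Sum>x\<in>S. scale (u x) x) y = (\<Sum>x\<in>S. if x = y then 2 * u y else 0)"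
      unfolding sum scl using Q S y by (intro sum.cong) auto
    then show ?thesis using S(1) by simp
  qed
  have ind: "independent Q" if Q: "?P Q" for Q
    unfolding independent_explicit_finite_subsets
  proof (intro allI impI ballI)
    fix S u y assume S: "S \<subseteq> Q" "finite S" "(\<Sum>x\<in>S. scale (u x) x) = 0" "y \<in> S"
    then have "2 * u y = \<beta> 0 y" using comb[OF Q S(2,1), of y u] by auto
    then show "u y = 0" by (simp add: zero)
  qed
  have bound: "finite Q \<and> card Q \<le> card D" if Q: "?P Q" for Q
    using independent_span_bound[OF D(1) ind[OF Q]] Q D(2) by blast
  obtain Q where Q: "?P Q" and max: "\<And>R. ?P R \<Longrightarrow> card R \<le> card Q"
  proof -
    have "\<exists>Q. ?P Q \<and> (\<forall>R. ?P R \<longrightarrow> card R \<le> card Q)"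
      by (rule ex_has_greatest_nat[of ?P "{}" card "Suc (card D)"]) (use bound in \<open>auto simp: less_Suc_eq_le\<close>)
    then show ?thesis using that by blast
  qed
  have fin: "finite Q" using bound[OF Q] by blast
  define pr where "pr = (\<lambda>x. x - (\<Sum>q\<in>Q. scale (\<beta> x q / 2) q))"
  have pr_E: "pr x \<in> E" if "x \<in> E" for x
    unfolding pr_def using Q that by (intro subspace_diff[OF E] sum_scale_mem E) auto
  have pr_Q: "\<beta> (pr x) q = 0" if "q \<in> Q" for x q
    unfolding pr_def diff using comb[OF Q fin _ that, of "\<lambda>q. \<beta> x q / 2"] that by simp
  have pr_0: "pr e = 0" if e: "e \<in> E" for e
  proof (rule ccontr)
    assume ne: "pr e \<noteq> 0"
    have "\<exists>x\<in>E. (\<forall>q\<in>Q. \<beta> x q = 0) \<and> \<beta> x x \<noteq> 0"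
    proof (rule ccontr)
      assume no: "\<not> ?thesis"
      have null: "\<beta> x x = 0" if "x \<in> E" "\<forall>q\<in>Q. \<beta> x q = 0" for x using no that by blast
      have pair: "\<beta> x y = 0" if xy: "x \<in> E" "\<forall>q\<in>Q. \<beta> x q = 0" "y \<in> E" "\<forall>q\<in>Q. \<beta> y q = 0" for x y
      proof -
        have "\<beta> (x + y) (x + y) = 0"
          using xy by (intro null) (auto simp: add intro: subspace_add[OF E])
        then have "\<beta> x x + \<beta> y y + 2 * \<beta> x y = 0"
          using add[of x y "x + y"] sym[of x "x + y"] sym[of y "x + y"] sym[of x y] add[of x y x] add[of x y y]
          by (simp add: ac_simps)
        then show ?thesis using null[OF xy(1,2)] null[OF xy(3,4)] by simp
      qed
      have "\<beta> (pr e) y = 0" if y: "y \<in> E" for y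
      proof -
        have "\<beta> (pr e) (pr y) = 0" using pr_E pr_Q e y by (intro pair) auto
        moreover have "\<beta> (\<Sum>q\<in>Q. scale (\<beta> y q / 2) q) (pr e) = 0"
          unfolding sum scl using pr_Q sym by (intro sum.neutral) simp
        moreover have "\<beta> (pr y) (pr e) = \<beta> y (pr e) - \<beta> (\<Sum>q\<in>Q. scale (\<beta> y q / 2) q) (pr e)"
          unfolding diff[symmetric] by (rule arg_cong[of _ _ "\<lambda>x. \<beta> x (pr e)"]) (simp add: pr_def)
        ultimately show ?thesis
          using sym[of "pr e" y] sym[of "pr e" "pr y"] by (metis diff_zero)
      qed
      then show False using nondeg[OF pr_E[OF e]] ne by blast
    qed
    then obtain x where x: "x \<in> E" "\<forall>q\<in>Q. \<beta> x q = 0" "\<beta> x x \<noteq> 0" by blast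
    \<comment> \<open>Rescaling a nonisotropic vector to length 2 takes a square root, available
      over an algebraically closed field.\<close>
    obtain c where c: "c ^ 2 = 2 / \<beta> x x" using nth_root_exists[of 2 "2 / \<beta> x x"] by auto
    define y where "y = scale c x"
    have y: "y \<in> E" "\<And>q. q \<in> Q \<Longrightarrow> \<beta> y q = 0"
      unfolding y_def using x E by (simp_all add: scl subspace_scale)
    have "\<beta> y y = c * (c * \<beta> x x)"
      unfolding y_def scl by (rule arg_cong[OF trans[OF sym scl]])
    also have "\<dots> = c ^ 2 * \<beta> x x" by (simp add: power2_eq_square)
    also have "\<dots> = 2" unfolding c using x(3) by simp
    finally have yy: "\<beta> y y = 2" .
    have "y \<notin> Q" using y(2)[of y] yy by auto
    moreover have "\<beta> q y = 0" if "q \<in> Q" for q using y(2)[OF that] sym by metis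
    then have "?P (insert y Q)" using Q y yy \<open>y \<notin> Q\<close> by auto
    ultimately show False using max[of "insert y Q"] fin by simp
  qed
  have "E \<subseteq> span Q"
  proof
    fix e assume "e \<in> E"
    then have "e = (\<Sum>q\<in>Q. scale (\<beta> e q / 2) q)" using pr_0[of e] by (simp add: pr_def)
    also have "\<dots> \<in> span Q" by (intro sum_scale_mem subspace_span span_base)
    finally show "e \<in> span Q" .
  qed
  with Q fin show ?thesis by blast
qed

section \<open>Nonvanishing powers, functionals and generators in characteristic zero\<close>

locale gorenstein_char_0 = gorenstein_local_artinian_algebra scale
  for scale :: "'k::{alg_closed_field,field_char_0} \<Rightarrow> 'a::comm_ring_1 \<Rightarrow> 'a"
begin

text \<open>A functional with value 1 on a nonzero \<open>v k\<close> would turn the identity into a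
  nonzero scalar polynomial vanishing on the whole infinite field.\<close>

lemma coeffs_eq_0:
  assumes 0: "\<And>t. (\<Sum>k\<le>e. scale (t ^ k) (v k)) = 0" and k: "k \<le> e"
  shows "v k = 0"
proof (rule ccontr)
  assume "v k \<noteq> 0"
  then have "independent {v k}" by simp
  then obtain \<phi> where \<phi>: "\<And>x y. \<phi> (x + y) = \<phi> x + \<phi> y" "\<And>c x. \<phi> (scale c x) = c * \<phi> x" "\<phi> (v k) = 1"
    using functional_extend[of "{v k}" "\<lambda>_. 1"] by auto
  have sum: "\<phi> (\<Sum>i\<in>I. f i) = (\<Sum>i\<in>I. \<phi> (f i))" for I :: "nat set" and f
    using \<phi>(2)[of 0 0] by (induction I rule: infinite_finite_induct) (simp_all add: \<phi>(1))
  define p where "p = (\<Sum>i\<le>e. monom (\<phi> (v i)) i)"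
  have "poly p t = 0" for t
  proof -
    have "poly p t = \<phi> (\<Sum>i\<le>e. scale (t ^ i) (v i))"
      by (simp add: p_def poly_sum poly_monom sum \<phi>(2) mult.commute)
    then show ?thesis using 0[of t] \<phi>(2)[of 0 0] by simp
  qed
  then have "p = 0" using poly_all_0_iff_0 by blast
  moreover have "coeff p k = \<phi> (v k)" using k by (simp add: p_def coeff_sum)
  ultimately show False using \<phi>(3) by simp
qed

lemma of_nat_mult_eq_scale: "of_nat j * x = scale (of_nat j) x"
  by (induction j) (simp_all add: distrib_right scale_left_distrib)

text \<open>Polarisation: if all \<open>s\<close>-th powers of elements of \<open>M\<close> vanished, then comparing
  coefficients of \<open>t\<close> in \<open>(x + t z)\<^sup>e y = 0\<close> would turn the factors \<open>x\<close> into
  arbitrary elements of \<open>M\<close> one by one.\<close>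

lemma exists_power_nonzero:
  assumes "Mpow s \<noteq> {0}"
  shows "\<exists>x\<in>M. x ^ s \<noteq> 0"
proof (rule ccontr)
  assume "\<not> ?thesis"
  then have pow: "x ^ s = 0" if "x \<in> M" for x using that by blast
  have *: "x \<in> M \<Longrightarrow> y \<in> Mpow j \<Longrightarrow> x ^ (s - j) * y = 0" if "j \<le> s" for j x y
    using that
  proof (induction j arbitrary: x y)
    case (Suc j)
    define e where "e = s - j"
    have e: "e = Suc (s - Suc j)" using Suc.prems(3) by (simp add: e_def)
    from Suc.prems(2) show ?case
    proof (induction rule: max_ideal_pow_Suc_induct)
      case (prod y z)
      define v where "v = (\<lambda>k. of_nat (e choose k) * z ^ k * x ^ (e - k) * y)"
      have "v 1 = 0"
      proof (rule coeffs_eq_0)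
        fix t
        have "scale t z + x \<in> M"
          using Suc.prems(1) prod(2) by (intro subspace_add[OF subspace_M] subspace_scale[OF subspace_M])
        then have "(scale t z + x) ^ e * y = 0"
          using Suc.IH[of "scale t z + x" y] Suc.prems(3) prod(1) by (simp add: e_def)
        moreover have "scale t z ^ k = scale (t ^ k) (z ^ k)" for k
          by (induction k) (simp_all add: scale_mult_left scale_mult_right)
        ultimately show "(\<Sum>k\<le>e. scale (t ^ k) (v k)) = 0"
          by (simp add: binomial_ring v_def sum_distrib_right scale_mult_left scale_mult_right)
      qed (use e in simp)
      \<comment> \<open>The coefficient of t is e x^(e-1) z y, and characteristic 0 allows e to be
        cancelled.\<close>
      then have "scale (of_nat e) (x ^ (s - Suc j) * (y * z)) = 0"
        using e by (simp add: v_def of_nat_mult_eq_scale[symmetric] ac_simps del: of_nat_Suc)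
      then show ?case using e by (simp del: of_nat_Suc)
    next
      case (sum y z)
      then show ?case by (simp add: distrib_left)
    qed
  qed (use pow in simp)
  have "y = 0" if "y \<in> Mpow s" for y
    using *[of s 0 y] that subspace_0[OF subspace_M] by simp
  then show False using assms subspace_0[OF subspace_Mpow] by blast
qed

text \<open>Descending induction from M^(s+1) = 0. The power x^i is not in M^(i+1), as multiplying
  by x^(s-i) would give x^s = 0; so it generates the one-dimensional quotient.\<close>

lemma power_basis:
  assumes x: "x \<in> M" "x ^ s \<noteq> 0" and s: "Mpow (Suc s) = {0}"
    and H: "\<And>i. 3 \<le> i \<Longrightarrow> i \<le> s \<Longrightarrow> hilbert scale i = 1"
    and i: "3 \<le> i" "i \<le> Suc s"
  shows "Mpow i \<subseteq> span ((\<lambda>k. x ^ k) ` {i..s})"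
  using i(2,1)
proof (induction rule: inc_induct)
  case base
  show ?case using s by simp
next
  case (step i)
  show ?case
  proof
    fix v assume v: "v \<in> Mpow i"
    have "x ^ i \<notin> Mpow (Suc i)"
    proof
      assume "x ^ i \<in> Mpow (Suc i)"
      then have "x ^ i * x ^ (s - i) \<in> Mpow (Suc i + (s - i))"
        using M_power[OF x(1)] by (rule Mpow_mult)
      then show False using x(2) s step.hyps by (simp flip: power_add)
    qed
    then obtain c where c: "v - scale c (x ^ i) \<in> Mpow (Suc i)"
      using quotient_dim_eq_1D[OF subspace_Mpow subspace_Mpow Mpow_Suc_subset _ M_power[OF x(1)] _ v]
        H[of i] step unfolding hilbert_def by auto
    have "(\<lambda>k. x ^ k) ` {Suc i..s} \<subseteq> (\<lambda>k. x ^ k) ` {i..s}" by (intro image_mono) auto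
    from order_trans[OF step.IH span_mono[OF this]]
    have "Mpow (Suc i) \<subseteq> span ((\<lambda>k. x ^ k) ` {i..s})" using step.prems by simp
    then have "v - scale c (x ^ i) \<in> span ((\<lambda>k. x ^ k) ` {i..s})" using c by blast
    moreover have "scale c (x ^ i) \<in> span ((\<lambda>k. x ^ k) ` {i..s})"
      using step.hyps by (intro span_scale span_base) auto
    ultimately show "v \<in> span ((\<lambda>k. x ^ k) ` {i..s})"
      by (metis diff_add_cancel span_add)
  qed
qed

text \<open>It suffices that 1, x, ..., x^s are independent. In a relation, multiplication by
  x^(s-k) kills the powers above k, those below have coefficient 0 by induction, and the k-th
  coefficient is left in front of x^s.\<close>

lemma power_functional:
  assumes x: "x \<in> M" "x ^ s \<noteq> 0" and s: "Mpow (Suc s) = {0}"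
  shows "\<exists>lam. (\<forall>y z. lam (y + z) = lam y + lam z) \<and> (\<forall>c y. lam (scale c y) = c * lam y) \<and>
    (\<forall>k. lam (x ^ k) = (if k = s then fact s else 0))"
proof -
  have big: "x ^ k = 0" if "s < k" for k
    using M_power[OF x(1), of k] Mpow_antimono[of "Suc s" k] s that by auto
  have inj: "inj_on (\<lambda>k. x ^ k) {..s}"
  proof (rule linorder_inj_onI)
    fix i j assume ij: "i < j" "i \<in> {..s}"
    show "x ^ i \<noteq> x ^ j"
    proof
      assume "x ^ i = x ^ j"
      then have "x ^ (i + (s - i)) = x ^ (j + (s - i))" by (simp only: power_add)
      then show False using x(2) big[of "j + (s - i)"] ij by simp
    qed
  qed auto
  have "independent ((\<lambda>k. x ^ k) ` {..s})"
  proof (rule independent_if_scalars_zero)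
    fix f y assume "(\<Sum>y\<in>(\<lambda>k. x ^ k) ` {..s}. scale (f y) y) = 0" and y: "y \<in> (\<lambda>k. x ^ k) ` {..s}"
    then have 0: "(\<Sum>k\<le>s. scale (f (x ^ k)) (x ^ k)) = 0" by (simp add: sum.reindex[OF inj])
    have "k \<le> s \<Longrightarrow> f (x ^ k) = 0" for k
    proof (induction k rule: less_induct)
      case (less k)
      have "0 = (\<Sum>l\<le>s. scale (f (x ^ l)) (x ^ (l + (s - k))))"
        using arg_cong[OF 0, of "\<lambda>y. y * x ^ (s - k)"]
        by (simp add: sum_distrib_right scale_mult_left power_add)
      also have "\<dots> = (\<Sum>l\<le>s. if l = k then scale (f (x ^ k)) (x ^ s) else 0)"
      proof (intro sum.cong refl)
        fix l assume "l \<in> {..s}"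
        then show "scale (f (x ^ l)) (x ^ (l + (s - k))) = (if l = k then scale (f (x ^ k)) (x ^ s) else 0)"
          using less.IH[of l] less.prems big[of "l + (s - k)"] by (cases l k rule: linorder_cases) auto
      qed
      finally show ?case using less.prems x(2) by simp
    qed
    then show "f y = 0" using y by auto
  qed simp
  from functional_extend[OF this, of "\<lambda>y. if y = x ^ s then fact s else 0"]
  obtain lam where "\<forall>y z. lam (y + z) = lam y + lam z" "\<forall>c y. lam (scale c y) = c * lam y"
    "\<forall>y\<in>(\<lambda>k. x ^ k) ` {..s}. lam y = (if y = x ^ s then fact s else 0)"
    by blast
  then have lam: "\<And>y z. lam (y + z) = lam y + lam z" "\<And>c y. lam (scale c y) = c * lam y"
    "\<And>k. k \<le> s \<Longrightarrow> lam (x ^ k) = (if x ^ k = x ^ s then fact s else 0)"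
    by simp_all
  have "lam (x ^ k) = (if k = s then fact s else 0)" for k
  proof (cases "k \<le> s")
    case True
    then have "x ^ k = x ^ s \<longleftrightarrow> k = s" using inj by (auto dest: inj_onD)
    then show ?thesis using lam(3)[OF True] by simp
  next
    case False
    then show ?thesis using big[of k] lam(2)[of 0 0] by simp
  qed
  then show ?thesis using lam(1,2) by blast
qed

text \<open>For y \<noteq> 0 there is j with y M^j \<noteq> 0 and y M^(j+1) = 0. Hence some nonzero
  y z lies in the socle, which is the line through x^s, where \<open>lam\<close> does not
  vanish.\<close>

lemma functional_nondegenerate:
  assumes x: "x \<in> M" and s: "Mpow (Suc s) = {0}"
    and lam_scale: "\<And>c y. lam (scale c y) = c * lam y" and lam: "lam (x ^ s) \<noteq> 0"
    and y: "\<And>z. lam (y * z) = 0"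
  shows "y = 0"
proof (rule ccontr)
  assume "y \<noteq> 0"
  let ?P = "\<lambda>i. \<forall>z\<in>Mpow i. y * z = 0"
  obtain N where "Mpow N = {0}" using Mpow_eventually_0 by blast
  then have "?P N" by simp
  moreover have "\<not> ?P 0" using \<open>y \<noteq> 0\<close> by (metis UNIV_I max_ideal_pow_0 mult.right_neutral)
  ultimately have "\<exists>j<N. (\<forall>i\<le>j. \<not> ?P i) \<and> ?P (Suc j)" by (rule ex_least_nat_less)
  then obtain j where j: "\<not> ?P j" and L: "?P (Suc j)" by blast
  from j obtain z where z: "z \<in> Mpow j" "y * z \<noteq> 0" by blast
  have yz: "y * z \<in> socle"
    unfolding socle_def using max_ideal_pow_prod[OF z(1)] L by (auto simp: mult.assoc)
  have xs: "x ^ s \<in> socle"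
    unfolding socle_def using max_ideal_pow_prod[OF M_power[OF x, of s]] s by auto
  obtain B where B: "B \<subseteq> socle" "independent B" "socle \<subseteq> span B" "card B = dim (socle :: 'a set)"
    using basis_exists by blast
  then obtain b where b: "B = {b}" using socle_dim by (metis card_1_singletonE)
  obtain c d where c: "y * z = scale c b" and d: "x ^ s = scale d b"
    using B(3) yz xs unfolding b span_singleton by blast
  have "d \<noteq> 0" using lam d lam_scale[of 0 0] by auto
  then have "y * z = scale (c / d) (x ^ s)" unfolding c d by simp
  moreover have "c \<noteq> 0" using c z(2) by auto
  ultimately show False using y[of z] lam lam_scale[of "c / d" "x ^ s"] \<open>d \<noteq> 0\<close> by simp
qed

text \<open>Nakayama for a nilpotent ideal: generators modulo M^2 approximate elements of M^i by
  monomials up to an error in M^(i+1), and descending induction from a vanishing power removes the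
  error. For i = 0 the approximation is the scalar residue.\<close>

lemma generators_span:
  assumes a: "\<And>i. i \<in> {1..n} \<Longrightarrow> a i \<in> M"
    and gen: "\<And>x. x \<in> M \<Longrightarrow> \<exists>c. x - (\<Sum>i=1..n. scale (c i) (a i)) \<in> Mpow 2"
  shows "Mpow i \<subseteq> mono_span a n i"
proof -
  have mono: "mono_span a n j \<subseteq> mono_span a n i" if "i \<le> j" for i j
    unfolding mono_span_def using that by (intro span_mono) auto
  have sub: "mono_span a n i \<subseteq> Mpow i" for i
  proof
    fix x assume "x \<in> mono_span a n i"
    then show "x \<in> Mpow i"
    proof (induction rule: mono_span_induct)
      case (mono \<alpha>)
      then show ?case using mono_at_Mpow[of n a \<alpha>] a Mpow_antimono[of i "expo_deg \<alpha>"] by auto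
    qed (use subspace_Mpow in \<open>auto intro: subspace_add subspace_scale subspace_0\<close>)
  qed
  have M: "\<exists>y\<in>mono_span a n 1. x - y \<in> Mpow 2" if x: "x \<in> M" for x
  proof -
    obtain c where c: "x - (\<Sum>i=1..n. scale (c i) (a i)) \<in> Mpow 2" using gen[OF x] by blast
    moreover have "(\<Sum>i=1..n. scale (c i) (a i)) \<in> mono_span a n 1"
    proof (intro sum_scale_mem subspace_mono_span)
      fix i assume "i \<in> {1..n}"
      then show "a i \<in> mono_span a n 1"
        using mono_span_base[of "single i 1" n 1 a] by simp
    qed
    ultimately show ?thesis by blast
  qed
  have approx: "\<exists>y\<in>mono_span a n i. x - y \<in> Mpow (Suc i)" if "x \<in> Mpow i" for x i
    using that
  proof (induction i arbitrary: x)
    case 0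
    obtain c where "x - scale c 1 \<in> M" using residue by blast
    moreover have "scale c 1 \<in> mono_span a n 0"
      using mono_span_base[of 0 n 0 a] by (intro subspace_scale subspace_mono_span) simp
    ultimately show ?case by (auto simp: Mpow_1)
  next
    case (Suc i)
    from Suc.prems show ?case
    proof (induction rule: max_ideal_pow_Suc_induct)
      case (prod y z)
      obtain u where u: "u \<in> mono_span a n i" "y - u \<in> Mpow (Suc i)" using Suc.IH prod(1) by blast
      obtain w where w: "w \<in> mono_span a n 1" "z - w \<in> Mpow 2" using M prod(2) by blast
      have "y * z - u * w = y * (z - w) + (y - u) * w" by (simp add: algebra_simps)
      moreover have "y * (z - w) \<in> Mpow (Suc (Suc i))"
        using Mpow_mult[OF prod(1) w(2)] by simp
      moreover have "(y - u) * w \<in> Mpow (Suc (Suc i))"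
        using Mpow_mult[OF u(2), of w 1] sub w(1) by auto
      ultimately have "y * z - u * w \<in> Mpow (Suc (Suc i))"
        by (simp add: subspace_add[OF subspace_Mpow])
      moreover have "u * w \<in> mono_span a n (Suc i)" using mono_span_mult[OF u(1) w(1)] by simp
      ultimately show ?case by blast
    next
      case (sum y z)
      then obtain u w where uw: "u \<in> mono_span a n (Suc i)" "y - u \<in> Mpow (Suc (Suc i))"
        "w \<in> mono_span a n (Suc i)" "z - w \<in> Mpow (Suc (Suc i))" by blast
      have "(y - u) + (z - w) \<in> Mpow (Suc (Suc i))"
        using uw by (intro subspace_add[OF subspace_Mpow])
      then have "y + z - (u + w) \<in> Mpow (Suc (Suc i))" by (simp add: algebra_simps)
      moreover have "u + w \<in> mono_span a n (Suc i)"
        using uw by (intro subspace_add[OF subspace_mono_span])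
      ultimately show ?case by blast
    qed
  qed
  obtain N where N: "Mpow N = {0}" using Mpow_eventually_0 by blast
  show ?thesis
  proof (cases "i \<le> N")
    case True
    then show ?thesis
    proof (induction rule: inc_induct)
      case base
      show ?case using N subspace_0[OF subspace_mono_span] by simp
    next
      case (step i)
      show ?case
      proof
        fix x assume "x \<in> Mpow i"
        then obtain y where y: "y \<in> mono_span a n i" "x - y \<in> Mpow (Suc i)" using approx by blast
        then have "x - y \<in> mono_span a n i" using step.IH mono[of i "Suc i"] by auto
        then have "(x - y) + y \<in> mono_span a n i" using y(1) by (rule subspace_add[OF subspace_mono_span])
        then show "x \<in> mono_span a n i" by simp
      qed
    qed
  next
    case False
    then show ?thesis
      using Mpow_antimono[of N i] N subspace_0[OF subspace_mono_span, of a n i] by auto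
  qed
qed

end

section \<open>The normal form\<close>

lemma (in vector_space) independent_family:
  assumes "independent B" "bij_betw u J B" "finite J"
    and 0: "(\<Sum>j\<in>J. scale (c j) (u j)) = 0" and j: "j \<in> J"
  shows "c j = 0"
proof -
  have inj: "inj_on u J" and B: "u ` J = B" using assms(2) by (auto simp: bij_betw_def)
  have "(\<Sum>b\<in>B. scale (c (the_inv_into J u b)) b) = (\<Sum>j\<in>J. scale (c j) (u j))"
    unfolding B[symmetric] by (subst sum.reindex[OF inj]) (auto intro!: sum.cong simp: the_inv_into_f_f[OF inj])
  then have "(\<Sum>b\<in>B. scale (c (the_inv_into J u b)) b) = 0" using 0 by simp
  moreover have "finite B" using B assms(3) by blast
  then have "\<forall>w. (\<Sum>b\<in>B. scale (w b) b) = 0 \<longrightarrow> (\<forall>b\<in>B. w b = 0)"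
    using assms(1) unfolding independent_explicit_finite_subsets by blast
  from spec[OF this, of "\<lambda>b. c (the_inv_into J u b)"]
  have "(\<Sum>b\<in>B. scale (c (the_inv_into J u b)) b) = 0 \<longrightarrow> (\<forall>b\<in>B. c (the_inv_into J u b) = 0)" .
  ultimately have "\<forall>b\<in>B. c (the_inv_into J u b) = 0" by (rule rev_mp)
  from bspec[OF this, of "u j"] show ?thesis using j B the_inv_into_f_f[OF inj j] by auto
qed

text \<open>H(3) = ... = H(s) = 1 enters through \<open>Mpow3\<close>. The numbers n and m are not
  parameters: the construction of a basis produces them as cardinalities and recognises them as
  values of the Hilbert function.\<close>

locale stretched = gorenstein_char_0 scale
  for scale :: "'k::{alg_closed_field,field_char_0} \<Rightarrow> 'a::comm_ring_1 \<Rightarrow> 'a" +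
  fixes s :: nat and x :: 'a and lam :: "'a \<Rightarrow> 'k"
  assumes s3: "3 \<le> s" and x_M: "x \<in> M" and Mpow_Suc_s: "Mpow (Suc s) = {0}"
    and Mpow3: "Mpow 3 \<subseteq> span ((\<lambda>k. x ^ k) ` {3..s})"
    and lam_add: "lam (y + z) = lam y + lam z"
    and lam_scale: "lam (scale c y) = c * lam y"
    and lam_power: "lam (x ^ k) = (if k = s then fact s else 0)"
    and nondegenerate: "(\<And>z. lam (y * z) = 0) \<Longrightarrow> y = 0"
begin

lemma lam_0 [simp]: "lam 0 = 0"
  using lam_scale[of 0 0] by simp

lemma lam_sum: "lam (\<Sum>i\<in>I. f i) = (\<Sum>i\<in>I. lam (f i))"
  by (induction I rule: infinite_finite_induct) (simp_all add: lam_add)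

lemma lam_diff: "lam (y - z) = lam y - lam z"
  using lam_add[of y "scale (-1) z"] lam_scale[of "-1" z] by simp

lemma x_power: "x ^ k \<in> Mpow k"
  using M_power[OF x_M] .

lemma lam_high: "y \<in> Mpow i \<Longrightarrow> z \<in> Mpow j \<Longrightarrow> s < i + j \<Longrightarrow> lam (y * z) = 0"
  using Mpow_mult[of y i z j] Mpow_antimono[of "Suc s" "i + j"] Mpow_Suc_s by auto

definition V :: "'a set" where
  "V = {v. \<forall>k. lam (x ^ k * v) = 0}"

text \<open>Orthogonal projection onto \<open>V\<close> along the powers of \<open>x\<close>. The
  coefficients are explained by duality: x^i and x^j pair to s! if i + j = s and to 0
  otherwise.\<close>

definition pr :: "'a \<Rightarrow> 'a" where
  "pr y = y - (\<Sum>i\<le>s. scale (lam (y * x ^ (s - i)) / fact s) (x ^ i))"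

lemma subspace_V: "subspace V"
  unfolding subspace_def V_def by (simp add: distrib_left lam_add scale_mult_right lam_scale)

lemma V_mult: "v \<in> V \<Longrightarrow> v * x \<in> V"
  unfolding V_def
proof clarify
  fix k assume "\<forall>k. lam (x ^ k * v) = 0"
  then have "lam (x ^ Suc k * v) = 0" by blast
  then show "lam (x ^ k * (v * x)) = 0" by (simp add: ac_simps)
qed

lemma lam_V_power: "v \<in> V \<Longrightarrow> lam (v * x ^ k) = 0"
  unfolding V_def by (simp add: mult.commute)

lemma lam_V_span: "v \<in> V \<Longrightarrow> w \<in> span (range (\<lambda>k. x ^ k)) \<Longrightarrow> lam (v * w) = 0"
  by (rotate_tac, induction w rule: span_induct_alt)
    (auto simp: distrib_left lam_add scale_mult_right lam_scale lam_V_power)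

lemma pr_V: "pr y \<in> V"
  unfolding V_def
proof (intro CollectI allI)
  fix k
  have "lam (x ^ k * (\<Sum>i\<le>s. scale (lam (y * x ^ (s - i)) / fact s) (x ^ i))) =
      (\<Sum>i\<le>s. lam (y * x ^ (s - i)) / fact s * lam (x ^ (k + i)))"
    by (simp add: sum_distrib_left lam_sum scale_mult_right lam_scale power_add)
  also have "\<dots> = (\<Sum>i\<le>s. if i = s - k \<and> k \<le> s then lam (y * x ^ k) else 0)"
    using lam_power by (intro sum.cong) auto
  also have "\<dots> = lam (x ^ k * y)"
  proof (cases "k \<le> s")
    case False
    then have "lam (x ^ k * y) = 0" using lam_high[OF x_power[of k], of y 0] by simp
    with False show ?thesis by simp
  qed (simp add: mult.commute)
  finally show "lam (x ^ k * pr y) = 0"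
    unfolding pr_def right_diff_distrib lam_diff by simp
qed

lemma span_powers: "y - pr y \<in> span (range (\<lambda>k. x ^ k))"
  unfolding pr_def by (simp, intro sum_scale_mem subspace_span span_base) simp

text \<open>The algebra is the orthogonal sum of \<open>V\<close> and the span of the powers of
  \<open>x\<close>, so the form stays nondegenerate on \<open>V\<close>.\<close>

lemma V_nondegenerate:
  assumes v: "v \<in> V" and 0: "\<And>w. w \<in> V \<Longrightarrow> lam (v * w) = 0"
  shows "v = 0"
proof (rule nondegenerate)
  fix z
  have "lam (v * z) = lam (v * pr z) + lam (v * (z - pr z))"
    by (simp add: lam_add[symmetric] distrib_left[symmetric])
  then show "lam (v * z) = 0"
    using 0[OF pr_V] lam_V_span[OF v span_powers] by simp
qed

lemma lam_V_Mpow3: "v \<in> V \<Longrightarrow> y \<in> Mpow 3 \<Longrightarrow> lam (v * y) = 0"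
  using lam_V_span[of v y] Mpow3 span_mono[of "(\<lambda>k. x ^ k) ` {3..s}" "range (\<lambda>k. x ^ k)"] by blast

text \<open>M^3 is orthogonal to \<open>V\<close>, so an element of both is orthogonal to all of
  \<open>V\<close>.\<close>

lemma V_Mpow3: "v \<in> V \<Longrightarrow> v \<in> Mpow 3 \<Longrightarrow> v = 0"
  using V_nondegenerate[of v] lam_V_Mpow3 by (metis mult.commute)

text \<open>Multiplication by x^s kills \<open>M\<close>; hence the pairing of v with x^s is s!
  times the residue of v, and on \<open>V\<close> it is 0.\<close>

lemma V_M: "v \<in> V \<Longrightarrow> v \<in> M"
proof -
  assume v: "v \<in> V"
  obtain c where c: "v - scale c 1 \<in> M" using residue by blast
  have "lam (x ^ s * (v - scale c 1)) = 0"
    using lam_high[OF x_power, of "v - scale c 1" 1 s] c by (simp add: Mpow_1)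
  moreover have "lam (x ^ s * v) = 0" using v by (simp add: V_def)
  ultimately have "c * fact s = 0"
    using lam_power[of s] by (simp add: right_diff_distrib lam_diff scale_mult_right lam_scale)
  then show "v \<in> M" using c by simp
qed

text \<open>The coefficient of x^0 in y - pr y is a multiple of lam(y x^s), and y x^s lies in
  M^(s+1) = 0. So a factor x comes out.\<close>

lemma M_decomp:
  assumes "y \<in> M"
  obtains z where "y = x * z + pr y" "z \<in> span (range (\<lambda>k. x ^ k))"
proof -
  let ?c = "\<lambda>i. lam (y * x ^ (s - i)) / fact s"
  have "?c 0 = 0" using lam_high[of y 1 "x ^ s" s] assms x_power by (simp add: Mpow_1)
  moreover have "{..s} = insert 0 {1..s}" by auto
  ultimately have "y - pr y = (\<Sum>i=1..s. scale (?c i) (x ^ i))"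
    by (simp add: pr_def)
  also have "\<dots> = (\<Sum>i=1..s. x * scale (?c i) (x ^ (i - 1)))"
    by (intro sum.cong) (auto simp: scale_mult_right simp flip: power_Suc)
  also have "\<dots> = x * (\<Sum>i=1..s. scale (?c i) (x ^ (i - 1)))"
    by (simp add: sum_distrib_left)
  finally have "y = x * (\<Sum>i=1..s. scale (?c i) (x ^ (i - 1))) + pr y" by (simp add: algebra_simps)
  moreover have "(\<Sum>i=1..s. scale (?c i) (x ^ (i - 1))) \<in> span (range (\<lambda>k. x ^ k))"
    by (intro sum_scale_mem subspace_span span_base) simp
  ultimately show ?thesis using that by blast
qed

lemma span_powers_decomp:
  assumes "z \<in> span (range (\<lambda>k. x ^ k))"
  obtains c w where "z = scale c 1 + x * w"
proof -
  have "\<exists>c w. z = scale c 1 + x * w"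
    using assms
  proof (induction z rule: span_induct_alt)
    case base
    have "0 = scale 0 1 + x * 0" by simp
    then show ?case by blast
  next
    case (step d y z)
    then obtain k c w where k: "y = x ^ k" "z = scale c 1 + x * w" by blast
    show ?case
    proof (cases k)
      case 0
      then have "scale d y + z = scale (d + c) 1 + x * w"
        using k by (simp add: scale_left_distrib add.assoc)
      then show ?thesis by blast
    next
      case (Suc l)
      then have "scale d y + z = scale c 1 + x * (scale d (x ^ l) + w)"
        using k by (simp add: distrib_left scale_mult_right algebra_simps)
      then show ?thesis by blast
    qed
  qed
  then show ?thesis using that by blast
qed

text \<open>In other words, M^2 is the sum of k x^2, V \<inter> M^2 and M^3. A linear term d x of y
  would be seen by the pairing with x^(s-1), which is 0 because x^(s-1) carries M^2 into M^(s+1) =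
  0.\<close>

lemma Mpow2_decomp:
  assumes "y \<in> Mpow 2"
  obtains c z where "y = scale c (x ^ 2) + z + pr y" "z \<in> Mpow 3" "pr y \<in> Mpow 2"
proof -
  have "y \<in> M" using assms Mpow_antimono[of 1 2] Mpow_1 by auto
  then obtain z where z: "y = x * z + pr y" "z \<in> span (range (\<lambda>k. x ^ k))" by (rule M_decomp)
  obtain d w where dw: "z = scale d 1 + x * w" using z(2) by (rule span_powers_decomp)
  obtain e v where ev: "w = scale e 1 + (w - scale e 1)" "w - scale e 1 \<in> M" using residue[of w] by auto
  have "lam (y * x ^ (s - 1)) = 0"
    using lam_high[OF assms x_power[of "s - 1"]] s3 by simp
  have "x * z = scale d x + x ^ 2 * w"
    unfolding dw by (simp add: distrib_left scale_mult_right power2_eq_square mult.assoc)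
  then have y: "y = scale d x + x ^ 2 * w + pr y" using z(1) by simp
  have "lam (y * x ^ (s - 1)) = d * lam (x * x ^ (s - 1)) + lam (x ^ 2 * w * x ^ (s - 1)) + lam (pr y * x ^ (s - 1))"
    by (subst y) (simp add: distrib_right lam_add scale_mult_left lam_scale)
  moreover have "lam (x ^ 2 * w * x ^ (s - 1)) = 0"
    using lam_high[OF Mpow_absorb(2)[OF x_power[of 2], of w] x_power[of "s - 1"]] s3 by simp
  moreover have "x * x ^ (s - 1) = x ^ s" using s3 by (simp flip: power_Suc)
  ultimately have "d * fact s = 0"
    using \<open>lam (y * x ^ (s - 1)) = 0\<close> lam_power[of s] lam_V_power[OF pr_V] by simp
  then have y: "y = x ^ 2 * w + pr y" using y by simp
  also have "x ^ 2 * w = scale e (x ^ 2) + x ^ 2 * (w - scale e 1)"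
    by (simp add: right_diff_distrib scale_mult_right)
  finally have "y = scale e (x ^ 2) + x ^ 2 * (w - scale e 1) + pr y" .
  moreover have "x ^ 2 * (w - scale e 1) \<in> Mpow 3"
    using max_ideal_pow_prod[OF x_power[of 2] ev(2)] by simp
  moreover have "pr y \<in> Mpow 2"
  proof -
    have "pr y = y - x ^ 2 * w" using y by (metis add_diff_cancel_left')
    then show ?thesis
      using subspace_diff[OF subspace_Mpow assms Mpow_absorb(2)[OF x_power[of 2], of w]] by simp
  qed
  ultimately show ?thesis using that by blast
qed

lemma U_mult_x: "u \<in> V \<Longrightarrow> u \<in> Mpow 2 \<Longrightarrow> u * x = 0"
  using V_Mpow3[OF V_mult] max_ideal_pow_prod[OF _ x_M, of u 2] by simp

text \<open>On a product p z of elements of \<open>M\<close>, write z = x w + pr z. The first part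
  is killed since u x = 0; the second is the pairing of pr z in \<open>V\<close> with u p in
  M^3.\<close>

lemma U_isotropic:
  assumes u: "u \<in> V" "u \<in> Mpow 2" and "y \<in> Mpow 2"
  shows "lam (u * y) = 0"
proof -
  have "y \<in> Mpow (Suc 1)" using assms(3) by (simp add: numeral_2_eq_2)
  then show ?thesis
  proof (induction rule: max_ideal_pow_Suc_induct)
    case (prod p z)
    obtain w where w: "z = x * w + pr z" using M_decomp[OF prod(2)] by blast
    have "u * (p * z) = (u * x) * (p * w) + pr z * (u * p)"
      by (subst w) (simp add: algebra_simps)
    moreover have "u * p \<in> Mpow 3" using Mpow_mult[OF u(2) prod(1)] by simp
    ultimately show ?case using U_mult_x[OF u] lam_V_Mpow3[OF pr_V] by simp
  qed (simp add: distrib_left lam_add)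
qed

text \<open>A nondegenerate space containing an isotropic subspace splits off hyperbolic pairs, and
  what is left has an orthogonal basis. The elements x, p_j, q_j represent a basis of M/M^2, while
  x^2 and the u_j represent one of M^2/M^3; hence p_2, ..., p_m, the partners of the u_j, account
  for m.\<close>

lemma normal_basis:
  obtains n m a where "1 \<le> m" "m \<le> n" "hilbert scale 1 = n" "hilbert scale 2 = m"
    "a 1 = x" "\<And>j. j \<in> {2..n} \<Longrightarrow> a j \<in> V"
    "\<And>i j. i \<in> {2..n} \<Longrightarrow> j \<in> {2..n} \<Longrightarrow> lam (a i * a j) = (if i = j \<and> m < i then 2 else 0)"
    "\<And>j y. j \<in> {m+1..n} \<Longrightarrow> y \<in> Mpow 2 \<Longrightarrow> lam (a j * y) = 0"
    "\<And>c j. (\<And>y. y \<in> Mpow 2 \<Longrightarrow> lam ((\<Sum>j=2..m. scale (c j) (a j)) * y) = 0) \<Longrightarrow> j \<in> {2..m} \<Longrightarrow> c j = 0"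
    "\<And>y. y \<in> M \<Longrightarrow> \<exists>c. y - (\<Sum>j=1..n. scale (c j) (a j)) \<in> Mpow 2"
proof -
  obtain D where D: "finite D" "span D = UNIV" by (rule finite_spanning)
  define U where "U = V \<inter> Mpow 2"
  have subU: "subspace U" unfolding U_def by (intro subspace_inter subspace_V subspace_Mpow)
  obtain B where B: "B \<subseteq> U" "independent B" "U \<subseteq> span B" using basis_exists by metis
  have finB: "finite B" using independent_span_bound[OF D(1) B(2)] D(2) by simp
  \<comment> \<open>The extra 1 counts x^2 beside the basis of U in degree 2, and frees the index 1
    for \<open>x\<close>.\<close>
  define m where "m = card B + 1"
  define J where "J = {2..m}"
  have finJ: "finite J" by (simp add: J_def)
  have "card J = card B" by (simp add: J_def m_def)
  then obtain u where u: "bij_betw u J B" using finite_same_card_bij[OF finJ finB] by blast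
  have uU: "u j \<in> U" if "j \<in> J" for j using u B(1) that by (auto simp: bij_betw_def)
  have uV: "u j \<in> V" and uM2: "u j \<in> Mpow 2" if "j \<in> J" for j using uU[OF that] by (auto simp: U_def)
  have uu: "lam (u i * u j) = 0" if "i \<in> J" "j \<in> J" for i j
    using U_isotropic uV uM2 that by blast
  have U_rep: "\<exists>c. y = (\<Sum>j\<in>J. scale (c j) (u j))" if "y \<in> V" "y \<in> Mpow 2" for y
  proof -
    have "y \<in> span (u ` J)" using that B(3) u by (auto simp: U_def bij_betw_def)
    then show ?thesis by (rule span_familyE[OF finJ]) blast
  qed
  have "\<exists>p. (\<forall>j\<in>J. p j \<in> V) \<and> (\<forall>i\<in>J. \<forall>j\<in>J. lam (u i * p j) = (if i = j then 1 else 0))"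
  proof (rule dual_family[OF finJ subspace_V])
    fix c j assume c: "\<And>v. v \<in> V \<Longrightarrow> (\<Sum>j\<in>J. c j * lam (u j * v)) = 0" and j: "j \<in> J"
    have "(\<Sum>j\<in>J. scale (c j) (u j)) = 0"
    proof (rule V_nondegenerate)
      show "(\<Sum>j\<in>J. scale (c j) (u j)) \<in> V" using uV by (intro sum_scale_mem subspace_V)
      show "lam ((\<Sum>j\<in>J. scale (c j) (u j)) * w) = 0" if "w \<in> V" for w
        using c[OF that] by (simp add: sum_distrib_right lam_sum scale_mult_left lam_scale)
    qed
    then show "c j = 0" using independent_family[OF B(2) u finJ] j by blast
  qed (simp_all add: distrib_left lam_add scale_mult_right lam_scale)
  then obtain p' where p': "\<And>j. j \<in> J \<Longrightarrow> p' j \<in> V"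
    "\<And>i j. i \<in> J \<Longrightarrow> j \<in> J \<Longrightarrow> lam (u i * p' j) = (if i = j then 1 else 0)" by blast
  \<comment> \<open>Subtracting elements of the isotropic U keeps duality with the u_j. Half of the
    Gram matrix of the p' is removed through each of the two factors, which makes all products p_i
    p_j pair to 0.\<close>
  define p where "p = (\<lambda>j. p' j - (\<Sum>l\<in>J. scale (lam (p' j * p' l) / 2) (u l)))"
  have pV: "p j \<in> V" if "j \<in> J" for j
    unfolding p_def using p'(1) uV that by (intro subspace_diff[OF subspace_V] sum_scale_mem subspace_V)
  have lam_comb: "lam (y * (\<Sum>l\<in>J. scale (c l) (f l))) = (\<Sum>l\<in>J. c l * lam (y * f l))" for y c and f :: "nat \<Rightarrow> 'a" and J
    by (simp add: sum_distrib_left lam_sum scale_mult_right lam_scale)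
  have up: "lam (u i * p j) = (if i = j then 1 else 0)" if ij: "i \<in> J" "j \<in> J" for i j
    unfolding p_def right_diff_distrib lam_diff lam_comb using p'(2)[OF ij] uu[OF ij(1)] by simp
  have pp: "lam (p i * p j) = 0" if ij: "i \<in> J" "j \<in> J" for i j
  proof -
    have "lam (p i * p j) = lam (p i * p' j) - (\<Sum>l\<in>J. lam (p' j * p' l) / 2 * lam (p i * u l))"
      unfolding p_def right_diff_distrib lam_diff lam_comb ..
    also have "(\<Sum>l\<in>J. lam (p' j * p' l) / 2 * lam (p i * u l)) = (\<Sum>l\<in>J. if l = i then lam (p' j * p' i) / 2 else 0)"
      using up ij by (intro sum.cong) (auto simp: mult.commute)
    also have "\<dots> = lam (p' j * p' i) / 2" using ij finJ by simp
    also have "lam (p i * p' j) = lam (p' j * p' i) - (\<Sum>l\<in>J. lam (p' i * p' l) / 2 * lam (p' j * u l))"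
      unfolding p_def mult.commute[of _ "p' j"] right_diff_distrib lam_diff lam_comb ..
    also have "(\<Sum>l\<in>J. lam (p' i * p' l) / 2 * lam (p' j * u l)) = (\<Sum>l\<in>J. if l = j then lam (p' i * p' j) / 2 else 0)"
      using p'(2) ij by (intro sum.cong) (auto simp: mult.commute)
    also have "\<dots> = lam (p' j * p' i) / 2" using ij finJ by (simp add: mult.commute)
    finally show ?thesis by simp
  qed
  define E where "E = {v \<in> V. \<forall>j\<in>J. lam (v * u j) = 0 \<and> lam (v * p j) = 0}"
  have subE: "subspace E"
    unfolding subspace_def E_def using subspace_V
    by (auto simp: subspace_def distrib_right lam_add scale_mult_left lam_scale)
  \<comment> \<open>Projection along hyperbolic pairs: the coefficient of u_l is the pairing with
    its partner p_l, and conversely.\<close>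
  define prE where "prE = (\<lambda>v. v - (\<Sum>l\<in>J. scale (lam (v * p l)) (u l)) - (\<Sum>l\<in>J. scale (lam (v * u l)) (p l)))"
  have prE: "prE v \<in> E" if v: "v \<in> V" for v
  proof -
    have "prE v \<in> V"
      unfolding prE_def using v uV pV by (intro subspace_diff[OF subspace_V] sum_scale_mem subspace_V)
    moreover have "lam (u j * prE v) = 0" if j: "j \<in> J" for j
    proof -
      have "(\<Sum>l\<in>J. lam (v * p l) * lam (u j * u l)) = 0" using uu[OF j] by simp
      moreover have "(\<Sum>l\<in>J. lam (v * u l) * lam (u j * p l)) = (\<Sum>l\<in>J. if l = j then lam (v * u j) else 0)"
        using up[OF j] by (intro sum.cong) auto
      ultimately show ?thesis
        unfolding prE_def right_diff_distrib lam_diff lam_comb using j finJ by (simp add: mult.commute)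
    qed
    moreover have "lam (p j * prE v) = 0" if j: "j \<in> J" for j
    proof -
      have "(\<Sum>l\<in>J. lam (v * p l) * lam (p j * u l)) = (\<Sum>l\<in>J. if l = j then lam (v * p j) else 0)"
        using up[OF _ j] by (intro sum.cong) (auto simp: mult.commute)
      moreover have "(\<Sum>l\<in>J. lam (v * u l) * lam (p j * p l)) = 0" using pp[OF j] by simp
      ultimately show ?thesis
        unfolding prE_def right_diff_distrib lam_diff lam_comb using j finJ by (simp add: mult.commute)
    qed
    ultimately show ?thesis unfolding E_def by (simp add: mult.commute)
  qed
  \<comment> \<open>As an orthogonal summand of \<open>V\<close>, the space \<open>E\<close>
    inherits nondegeneracy.\<close>
  have "\<exists>Q. finite Q \<and> Q \<subseteq> E \<and> (\<forall>y\<in>Q. \<forall>z\<in>Q. lam (y * z) = (if y = z then 2 else 0)) \<and> E \<subseteq> span Q"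
  proof (rule orthonormal_spanning[where scale = scale and D = D])
    show "vector_space scale" by (rule vector_space_axioms)
    show "e = 0" if e: "e \<in> E" and 0: "\<And>y. y \<in> E \<Longrightarrow> lam (e * y) = 0" for e
    proof (rule V_nondegenerate)
      show "e \<in> V" using e by (simp add: E_def)
      fix w assume "w \<in> V"
      have "lam (e * prE w) = 0" using 0 prE[OF \<open>w \<in> V\<close>] by blast
      moreover have "lam (e * prE w) = lam (e * w)"
        unfolding prE_def right_diff_distrib lam_diff lam_comb using e by (simp add: E_def)
      ultimately show "lam (e * w) = 0" by simp
    qed
  qed (use D subE in \<open>simp_all add: mult.commute distrib_left lam_add scale_mult_right lam_scale\<close>)
  then obtain Q where Q: "finite Q" "Q \<subseteq> E" "\<And>y z. y \<in> Q \<Longrightarrow> z \<in> Q \<Longrightarrow> lam (y * z) = (if y = z then 2 else 0)"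
    "E \<subseteq> span Q" by blast
  define n where "n = m + card Q"
  define K where "K = {m+1..n}"
  have finK: "finite K" by (simp add: K_def)
  have "card K = card Q" by (simp add: K_def n_def)
  then obtain q where q: "bij_betw q K Q" using finite_same_card_bij[OF finK Q(1)] by blast
  have qE: "q j \<in> E" if "j \<in> K" for j using q Q(2) that by (auto simp: bij_betw_def)
  have qq: "lam (q i * q j) = (if i = j then 2 else 0)" if ij: "i \<in> K" "j \<in> K" for i j
  proof -
    have "q i \<in> Q" "q j \<in> Q" "q i = q j \<longleftrightarrow> i = j"
      using q ij by (auto simp: bij_betw_def dest: inj_onD)
    then show ?thesis using Q(3) by simp
  qed
  have qu: "lam (q i * u j) = 0" and qp: "lam (q i * p j) = 0" if "i \<in> K" "j \<in> J" for i j
    using qE[OF that(1)] that(2) by (auto simp: E_def)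
  have qV: "q j \<in> V" if "j \<in> K" for j using qE[OF that] by (simp add: E_def)
  define a where "a = (\<lambda>j. if j = 1 then x else if j \<le> m then p j else q j)"
  have a1: "a 1 = x" and aJ: "\<And>j. j \<in> J \<Longrightarrow> a j = p j" and aK: "\<And>j. j \<in> K \<Longrightarrow> a j = q j"
    by (auto simp: a_def J_def K_def m_def)
  have JK: "{1..n} = insert 1 (J \<union> K)" "1 \<notin> J \<union> K" "J \<inter> K = {}" "{2..n} = J \<union> K"
    by (auto simp: J_def K_def m_def n_def)
  have sum_a: "(\<Sum>j=1..n. scale (c j) (a j)) =
      scale (c 1) x + ((\<Sum>j\<in>J. scale (c j) (p j)) + (\<Sum>j\<in>K. scale (c j) (q j)))" for c
    unfolding JK(1) using JK finJ finK
    by (simp add: a1[simplified] sum.union_disjoint aJ aK)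
  have aV: "a j \<in> V" if "j \<in> {2..n}" for j
    using that unfolding JK(4) using aJ aK pV qV by auto
  \<comment> \<open>M^2 is made of x^2, M^3 and U. The first two are orthogonal to q_j because it
    lies in \<open>V\<close>, the last because it lies in \<open>E\<close>.\<close>
  have lam_q_Mpow2: "lam (q j * y) = 0" if j: "j \<in> K" and y: "y \<in> Mpow 2" for j y
  proof -
    obtain c z where z: "y = scale c (x ^ 2) + z + pr y" "z \<in> Mpow 3" "pr y \<in> Mpow 2"
      using y by (rule Mpow2_decomp)
    obtain d where d: "pr y = (\<Sum>j\<in>J. scale (d j) (u j))" using U_rep[OF pr_V z(3)] by blast
    have "lam (q j * y) = c * lam (q j * x ^ 2) + lam (q j * z) + lam (q j * pr y)"
      by (subst z(1)) (simp add: distrib_left lam_add scale_mult_right lam_scale)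
    moreover have "lam (q j * pr y) = 0" unfolding d lam_comb using qu[OF j] by simp
    ultimately show ?thesis using lam_V_power[OF qV[OF j]] lam_V_Mpow3[OF qV[OF j] z(2)] by simp
  qed
  \<comment> \<open>Split y into a multiple of x and pr y. Modulo M^2 the former leaves d x, the
    latter its components along the p_j and q_j; x^2 w and the components along the u_j are in
    M^2.\<close>
  have gen: "\<exists>c. y - (\<Sum>j=1..n. scale (c j) (a j)) \<in> Mpow 2" if y: "y \<in> M" for y
  proof -
    obtain z where z: "y = x * z + pr y" "z \<in> span (range (\<lambda>k. x ^ k))" using y by (rule M_decomp)
    obtain d w where dw: "z = scale d 1 + x * w" using z(2) by (rule span_powers_decomp)
    have "prE (pr y) \<in> span (q ` K)" using prE[OF pr_V] Q(4) q by (auto simp: bij_betw_def)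
    then obtain e where e: "prE (pr y) = (\<Sum>j\<in>K. scale (e j) (q j))" by (rule span_familyE[OF finK])
    define v where "v = pr y"
    define c where "c = (\<lambda>j. if j = 1 then d else if j \<in> J then lam (v * u j) else e j)"
    have arith: "y - t = t4 + t1" if "t = t0 + (t2 + t3)" "v = t1 + t2 + t3" "y = t0 + t4 + v" for t t0 t1 t2 t3 t4
      using that by (simp add: algebra_simps)
    have "(\<Sum>j=1..n. scale (c j) (a j)) =
        scale d x + ((\<Sum>j\<in>J. scale (lam (v * u j)) (p j)) + (\<Sum>j\<in>K. scale (e j) (q j)))"
    proof -
      have "(\<Sum>j\<in>J. scale (c j) (p j)) = (\<Sum>j\<in>J. scale (lam (v * u j)) (p j))"
        using JK by (intro sum.cong) (auto simp: c_def)
      moreover have "(\<Sum>j\<in>K. scale (c j) (q j)) = (\<Sum>j\<in>K. scale (e j) (q j))"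
        using JK by (intro sum.cong) (auto simp: c_def)
      ultimately show ?thesis unfolding sum_a by (simp add: c_def)
    qed
    moreover have "v = (\<Sum>l\<in>J. scale (lam (v * p l)) (u l)) + (\<Sum>l\<in>J. scale (lam (v * u l)) (p l)) + (\<Sum>j\<in>K. scale (e j) (q j))"
      using e unfolding v_def[symmetric] prE_def by (simp add: algebra_simps)
    moreover have "y = scale d x + x ^ 2 * w + v"
      using z(1) unfolding dw v_def by (simp add: distrib_left scale_mult_right power2_eq_square mult.assoc)
    ultimately have "y - (\<Sum>j=1..n. scale (c j) (a j)) = x ^ 2 * w + (\<Sum>l\<in>J. scale (lam (v * p l)) (u l))"
      by (rule arith)
    also have "\<dots> \<in> Mpow 2"
      using uM2 x_power[of 2] by (intro subspace_add[OF subspace_Mpow] sum_scale_mem subspace_Mpow Mpow_absorb)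
    finally show ?thesis by blast
  qed
  have xs1: "x * x ^ (s - 1) = x ^ s" using s3 by (simp flip: power_Suc)
  have H1: "hilbert scale 1 = card {1..n}"
  proof (rule hilbert_family[where f = a])
    show "a j \<in> Mpow 1" if "j \<in> {1..n}" for j
      using that x_M V_M[OF aV[of j]] by (cases "j = 1") (auto simp: Mpow_1 a1[simplified])
    show "\<exists>c. v - (\<Sum>j=1..n. scale (c j) (a j)) \<in> Mpow (Suc 1)" if "v \<in> Mpow 1" for v
      using gen[of v] that by (simp add: Mpow_1 numeral_2_eq_2)
    fix c j assume "(\<Sum>j=1..n. scale (c j) (a j)) \<in> Mpow (Suc 1)" and j: "j \<in> {1..n}"
    then have y: "(\<Sum>j=1..n. scale (c j) (a j)) \<in> Mpow 2" by (simp add: numeral_2_eq_2)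
    define v where "v = (\<Sum>j\<in>J. scale (c j) (p j)) + (\<Sum>j\<in>K. scale (c j) (q j))"
    have vV: "v \<in> V"
      unfolding v_def using pV qV by (intro subspace_add[OF subspace_V] sum_scale_mem subspace_V)
    \<comment> \<open>Pairing with x^(s-1) isolates the coefficient of x. Then v is in M^2, to which
      all u_i and q_i are orthogonal; these pairings give the coefficients of the p_i and
      q_i.\<close>
    have "lam ((scale (c 1) x + v) * x ^ (s - 1)) = 0"
      using lam_high[OF y x_power[of "s - 1"]] s3 unfolding sum_a v_def by simp
    then have "c 1 * fact s = 0"
      using lam_V_power[OF vV] xs1 lam_power[of s]
      by (simp add: distrib_right lam_add scale_mult_left lam_scale)
    then have c1: "c 1 = 0" by simp
    then have vM2: "v \<in> Mpow 2" using y unfolding sum_a v_def by simp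
    have lam_v: "lam (w * v) = (\<Sum>j\<in>J. c j * lam (w * p j)) + (\<Sum>j\<in>K. c j * lam (w * q j))" for w
      unfolding v_def distrib_left lam_add lam_comb ..
    have cJ: "c i = 0" if i: "i \<in> J" for i
    proof -
      have "0 = lam (u i * v)" using U_isotropic[OF uV[OF i] uM2[OF i] vM2] by simp
      also have "\<dots> = (\<Sum>j\<in>J. if j = i then c i else 0) + (\<Sum>j\<in>K. 0)"
        unfolding lam_v using up[OF i] qu[OF _ i]
        by (intro arg_cong2[where f = "(+)"] sum.cong) (auto simp: mult.commute)
      finally show ?thesis using i finJ by simp
    qed
    have cK: "c i = 0" if i: "i \<in> K" for i
    proof -
      have "0 = lam (q i * v)" using lam_q_Mpow2[OF i vM2] by simp
      also have "\<dots> = (\<Sum>j\<in>J. 0) + (\<Sum>j\<in>K. if j = i then 2 * c i else 0)"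
        unfolding lam_v using qp[OF i] qq[OF i]
        by (intro arg_cong2[where f = "(+)"] sum.cong) auto
      finally show ?thesis using i finK by simp
    qed
    show "c j = 0" using j c1 cJ cK unfolding JK(1) by auto
  qed simp
  have H2: "hilbert scale 2 = card (insert 1 J)"
  proof (rule hilbert_family[where f = "\<lambda>j. if j = 1 then x ^ 2 else u j"])
    have sum_f: "(\<Sum>j\<in>insert 1 J. scale (c j) (if j = 1 then x ^ 2 else u j)) =
        scale (c 1) (x ^ 2) + (\<Sum>j\<in>J. scale (c j) (u j))" for c
    proof -
      have "(\<Sum>j\<in>J. scale (c j) (if j = 1 then x ^ 2 else u j)) = (\<Sum>j\<in>J. scale (c j) (u j))"
        using JK(2) by (intro sum.cong) auto
      then show ?thesis using JK(2) finJ by simp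
    qed
    show "(if j = 1 then x ^ 2 else u j) \<in> Mpow 2" if "j \<in> insert 1 J" for j
      using that uM2 x_power[of 2] by auto
    show "\<exists>c. v - (\<Sum>j\<in>insert 1 J. scale (c j) (if j = 1 then x ^ 2 else u j)) \<in> Mpow (Suc 2)"
      if v: "v \<in> Mpow 2" for v
    proof -
      obtain c z where z: "v = scale c (x ^ 2) + z + pr v" "z \<in> Mpow 3" "pr v \<in> Mpow 2"
        using v by (rule Mpow2_decomp)
      obtain d where d: "pr v = (\<Sum>j\<in>J. scale (d j) (u j))" using U_rep[OF pr_V z(3)] by blast
      define e where "e = (\<lambda>j. if j = 1 then c else d j)"
      have "(\<Sum>j\<in>J. scale (e j) (u j)) = (\<Sum>j\<in>J. scale (d j) (u j))"
        using JK(2) by (intro sum.cong) (auto simp: e_def)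
      then have "(\<Sum>j\<in>insert 1 J. scale (e j) (if j = 1 then x ^ 2 else u j)) = scale c (x ^ 2) + pr v"
        unfolding sum_f d by (simp add: e_def)
      then have "v - (\<Sum>j\<in>insert 1 J. scale (e j) (if j = 1 then x ^ 2 else u j)) = z"
        using z(1) by (metis (no_types, lifting) add.assoc add.commute add_diff_cancel_left')
      then show ?thesis using z(2) by (intro exI[of _ e]) simp
    qed
    fix c j assume "(\<Sum>j\<in>insert 1 J. scale (c j) (if j = 1 then x ^ 2 else u j)) \<in> Mpow (Suc 2)"
      and j: "j \<in> insert 1 J"
    then have y: "scale (c 1) (x ^ 2) + (\<Sum>j\<in>J. scale (c j) (u j)) \<in> Mpow 3" unfolding sum_f by simp
    define v where "v = (\<Sum>j\<in>J. scale (c j) (u j))"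
    have vV: "v \<in> V" unfolding v_def using uV by (intro sum_scale_mem subspace_V)
    \<comment> \<open>Pairing with x^(s-2) isolates the coefficient of x^2; the remaining v is in V
      \<inter> M^3 = 0, and the u_j are independent.\<close>
    have "lam ((scale (c 1) (x ^ 2) + v) * x ^ (s - 2)) = 0"
      using lam_high[OF y x_power[of "s - 2"]] s3 unfolding v_def by simp
    moreover have "2 + (s - 2) = s" using s3 by simp
    then have "x ^ 2 * x ^ (s - 2) = x ^ s" by (metis power_add)
    ultimately have "c 1 * fact s = 0"
      using lam_V_power[OF vV] lam_power[of s]
      by (simp add: distrib_right lam_add scale_mult_left lam_scale)
    then have c1: "c 1 = 0" by simp
    then have "v = 0" using V_Mpow3[OF vV] y unfolding v_def by simp
    then have "c i = 0" if "i \<in> J" for i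
      using independent_family[OF B(2) u finJ _ that, of c] unfolding v_def by blast
    then show "c j = 0" using j c1 by auto
  qed (simp add: finJ)
  have cardm: "card (insert 1 J) = m" using JK(2) finJ by (simp add: J_def m_def)
  show ?thesis
  proof (rule that[of m n a])
    show "1 \<le> m" "m \<le> n" by (simp_all add: m_def n_def)
    show "hilbert scale 1 = n" using H1 by simp
    show "hilbert scale 2 = m" using H2 cardm by simp
    show "lam (a i * a j) = (if i = j \<and> m < i then 2 else 0)" if ij: "i \<in> {2..n}" "j \<in> {2..n}" for i j
    proof -
      have "i \<in> J \<or> i \<in> K" "j \<in> J \<or> j \<in> K" using ij unfolding JK(4) by auto
      moreover have "l \<in> J \<Longrightarrow> \<not> m < l" "l \<in> K \<Longrightarrow> m < l" for l by (auto simp: J_def K_def)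
      ultimately show ?thesis
        using pp[of i j] qp[of i j] qp[of j i] qq[of i j] aJ aK by (auto simp: mult.commute)
    qed
    show "lam (a j * y) = 0" if "j \<in> {m+1..n}" "y \<in> Mpow 2" for j y
      using lam_q_Mpow2[of j y] aK[of j] that by (simp add: K_def)
    show "c j = 0" if c: "\<And>y. y \<in> Mpow 2 \<Longrightarrow> lam ((\<Sum>j=2..m. scale (c j) (a j)) * y) = 0"
      and j: "j \<in> {2..m}" for c j
    proof -
      have jJ: "j \<in> J" using j by (simp add: J_def)
      \<comment> \<open>The test element u_j belongs to M^2 and is dual to a_j = p_j.\<close>
      have "0 = lam (u j * (\<Sum>l\<in>J. scale (c l) (p l)))"
        using c[OF uM2[OF jJ]] aJ by (simp add: J_def mult.commute)
      also have "\<dots> = (\<Sum>l\<in>J. if l = j then c j else 0)"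
        unfolding lam_comb using up[OF jJ] by (intro sum.cong) auto
      finally show ?thesis using jJ finJ by simp
    qed
  qed (use a1 aV gen in auto)
qed

end

section \<open>The cubic form and the isomorphism\<close>

context stretched
begin

text \<open>The polynomial is forced by the basis, its divided coefficients being the values of
  \<open>lam\<close> on monomials. \<open>G\<close> collects the cubic monomials in the first
  \<open>m\<close> variables; all others turn out to contribute only y_1^s and the squares.\<close>

lemma exists_normal_form:
  assumes n: "hilbert scale 1 = n" and m: "hilbert scale 2 = m"
  shows "\<exists>G. G \<in> mpolys m \<and> homogeneous 3 G \<and> (xvar 1 [^]\<^bsub>mps_ring n\<^esub> (2::nat)) \<circ>\<^sub>\<partial> G = 0 \<and>
    lin_indep_family (\<lambda>j. xvar j \<circ>\<^sub>\<partial> G) {2..m} \<and>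
    iso_mps_quotient scale n (Ann n (yvar 1 ^ s + G + (\<Sum>j=m+1..n. yvar j ^ 2)))"
proof (rule normal_basis)
  fix n' m' a
  assume "hilbert scale 1 = n'" "hilbert scale 2 = m'" and "1 \<le> m'" "m' \<le> n'" and a1: "a 1 = x"
    and "\<And>j. j \<in> {2..n'} \<Longrightarrow> a j \<in> V"
    and "\<And>i j. i \<in> {2..n'} \<Longrightarrow> j \<in> {2..n'} \<Longrightarrow> lam (a i * a j) = (if i = j \<and> m' < i then 2 else 0)"
    and "\<And>j y. j \<in> {m'+1..n'} \<Longrightarrow> y \<in> Mpow 2 \<Longrightarrow> lam (a j * y) = 0"
    and "\<And>c j. (\<And>y. y \<in> Mpow 2 \<Longrightarrow> lam ((\<Sum>j=2..m'. scale (c j) (a j)) * y) = 0) \<Longrightarrow> j \<in> {2..m'} \<Longrightarrow> c j = 0"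
    and "\<And>y. y \<in> M \<Longrightarrow> \<exists>c. y - (\<Sum>j=1..n'. scale (c j) (a j)) \<in> Mpow 2"
  then have m1: "1 \<le> m" and mn: "m \<le> n"
    and aV: "\<And>j. j \<in> {2..n} \<Longrightarrow> a j \<in> V"
    and aa: "\<And>i j. i \<in> {2..n} \<Longrightarrow> j \<in> {2..n} \<Longrightarrow> lam (a i * a j) = (if i = j \<and> m < i then 2 else 0)"
    and a_Mpow2: "\<And>j y. j \<in> {m+1..n} \<Longrightarrow> y \<in> Mpow 2 \<Longrightarrow> lam (a j * y) = 0"
    and indep: "\<And>c j. (\<And>y. y \<in> Mpow 2 \<Longrightarrow> lam ((\<Sum>j=2..m. scale (c j) (a j)) * y) = 0) \<Longrightarrow> j \<in> {2..m} \<Longrightarrow> c j = 0"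
    and gen: "\<And>y. y \<in> M \<Longrightarrow> \<exists>c. y - (\<Sum>j=1..n. scale (c j) (a j)) \<in> Mpow 2"
    using n m by simp_all
  have aM: "a i \<in> M" if "i \<in> {1..n}" for i
  proof (cases "i = 1")
    case False
    then show ?thesis using that by (intro V_M aV) auto
  qed (simp only: a1 x_M)
  have mono_Mpow: "mono_at a \<alpha> \<in> Mpow (expo_deg \<alpha>)" if "keys \<alpha> \<subseteq> {1..n}" for \<alpha>
    using aM that by (rule mono_at_Mpow)
  have span: "Mpow i \<subseteq> mono_span a n i" for i
    using aM gen by (rule generators_span)
  \<comment> \<open>The cube y_1^3 is excluded because its value, 3! if s = 3 and 0 otherwise, is
    accounted for by y_1^s.\<close>
  define T where "T = {\<alpha>. keys \<alpha> \<subseteq> {1..m} \<and> expo_deg \<alpha> = 3 \<and> \<alpha> \<noteq> single 1 3}"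
  have finT: "finite T"
    unfolding T_def by (rule finite_subset[OF _ finite_bounded_expos[of m 3]]) auto
  define G where "G = (\<Sum>\<alpha>\<in>T. single \<alpha> (lam (mono_at a \<alpha>) / expo_fact \<alpha>))"
  have dG: "dcoeff G \<alpha> = (if \<alpha> \<in> T then lam (mono_at a \<alpha>) else 0)" for \<alpha>
  proof -
    have "dcoeff G \<alpha> = (\<Sum>\<beta>\<in>T. if \<alpha> = \<beta> then lam (mono_at a \<beta>) else 0)"
      unfolding G_def dcoeff_sum dcoeff_single by (intro sum.cong) auto
    then show ?thesis using finT by simp
  qed
  have G_keys: "\<alpha> \<in> T" if "\<alpha> \<in> keys G" for \<alpha>
    using that dG[of \<alpha>] dcoeff_eq_0_iff[of G \<alpha>] by (simp split: if_splits)
  have G: "G \<in> mpolys m"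
    unfolding mpolys_def using G_keys by (auto simp: T_def)
  have hom: "homogeneous 3 G"
    unfolding homogeneous_def using G_keys by (auto simp: T_def expo_deg_def)
  have sq: "(xvar 1 [^]\<^bsub>mps_ring n\<^esub> (2::nat)) \<circ>\<^sub>\<partial> G = 0"
    unfolding xvar_sq_act_eq_0_iff
  proof
    fix \<gamma>
    show "dcoeff G (\<gamma> + single 1 2) = 0"
    proof (cases "\<gamma> + single 1 2 \<in> T")
      case True
      then have deg: "expo_deg \<gamma> = 1" and keys: "keys \<gamma> \<subseteq> {1..m}"
        and ne: "\<gamma> + single 1 2 \<noteq> single 1 3"
        by (auto simp: T_def expo_deg_add keys_add_nat)
      have "\<gamma> \<noteq> 0" using deg by auto
      then obtain i \<beta> where "\<gamma> = single i 1 + \<beta>" by (rule expo_nonzero_split)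
      then have \<gamma>: "\<gamma> = single i 1" using deg by (simp add: expo_deg_add)
      \<comment> \<open>In a monomial y_1^2 y_i other than y_1^3 the element a_i lies in
        \<open>V\<close>, hence is orthogonal to x^2.\<close>
      have "i \<noteq> 1"
        using ne unfolding \<gamma> by (auto simp: numeral_2_eq_2 numeral_3_eq_3 simp flip: single_add)
      then have "a i \<in> V" using keys mn unfolding \<gamma> by (intro aV) auto
      then have "lam (mono_at a (\<gamma> + single 1 2)) = 0"
        unfolding \<gamma> mono_at_add mono_at_single a1 power_one_right by (rule lam_V_power)
      then show ?thesis by (simp add: dG)
    qed (simp add: dG)
  qed
  have in_T: "\<gamma> + single j 1 \<in> T"
    if "j \<in> {2..m}" "keys \<gamma> \<subseteq> {1..m}" "expo_deg \<gamma> = 2" for \<gamma> j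
    using that single_add_neq[of 1 j \<gamma> 3] by (auto simp: T_def keys_add_nat expo_deg_add add.commute)
  have lin: "lin_indep_family (\<lambda>j. xvar j \<circ>\<^sub>\<partial> G) {2..m}"
    unfolding lin_indep_family_iff
  proof (intro allI impI ballI)
    fix c j assume c: "\<forall>\<gamma>. (\<Sum>j\<in>{2..m}. c j * dcoeff G (\<gamma> + single j 1)) = 0" and j: "j \<in> {2..m}"
    define w where "w = (\<Sum>j=2..m. scale (c j) (a j))"
    have wV: "w \<in> V" unfolding w_def using aV mn by (intro sum_scale_mem subspace_V) auto
    have wM: "w \<in> M" using wV by (rule V_M)
    \<comment> \<open>The hypothesis covers quadratic monomials in the first \<open>m\<close>
      variables. Monomials of higher degree lie in M^3, orthogonal to w; a quadratic one containing
      a_l with l > m leaves a_l times an element of M^2.\<close>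
    have "lam (w * y) = 0" if y: "y \<in> Mpow 2" for y
    proof -
      have "y \<in> mono_span a n 2" using span[of 2] y by blast
      then show ?thesis
      proof (induction rule: mono_span_induct)
        case (mono \<alpha>)
        show ?case
        proof (cases "expo_deg \<alpha> = 2")
          case False
          then have "mono_at a \<alpha> \<in> Mpow 3"
            using mono_Mpow[OF mono(1)] Mpow_antimono[of 3 "expo_deg \<alpha>"] mono(2) by auto
          then show ?thesis by (rule lam_V_Mpow3[OF wV])
        next
          case deg: True
          show ?thesis
          proof (cases "keys \<alpha> \<subseteq> {1..m}")
            case True
            have "lam (w * mono_at a \<alpha>) = (\<Sum>j=2..m. c j * lam (a j * mono_at a \<alpha>))"
              by (simp add: w_def sum_distrib_right lam_sum scale_mult_left lam_scale)
            also have "\<dots> = (\<Sum>j\<in>{2..m}. c j * dcoeff G (\<alpha> + single j 1))"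
              using in_T[OF _ True deg] by (intro sum.cong) (auto simp: dG mono_at_add mult.commute)
            finally show ?thesis using c by simp
          next
            case False
            then obtain l where l: "l \<in> keys \<alpha>" "l \<in> {m+1..n}"
              using mono(1) by fastforce
            then obtain \<beta> where \<beta>: "\<alpha> = single l 1 + \<beta>" using expo_split by blast
            then have "expo_deg \<beta> = 1" "keys \<beta> \<subseteq> {1..n}"
              using deg mono(1) by (auto simp: expo_deg_add keys_add_nat)
            then have "mono_at a \<beta> * w \<in> Mpow 2"
              using max_ideal_pow_prod[OF mono_Mpow[of \<beta>] wM] by (simp add: numeral_2_eq_2)
            from a_Mpow2[OF l(2) this] show ?thesis by (simp add: \<beta> mono_at_add ac_simps)
          qed
        qed
      qed (simp_all add: distrib_left lam_add scale_mult_right lam_scale)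
    qed
    then show "c j = 0" using indep[OF _ j] unfolding w_def by blast
  qed
  have "inverse_system scale n a lam (yvar 1 ^ s + G + (\<Sum>j=m+1..n. yvar j ^ 2))"
  proof unfold_locales
    show "span {mono_at a \<alpha> |\<alpha>. keys \<alpha> \<subseteq> {1..n}} = UNIV"
      using span[of 0] by (simp add: mono_span_def top.extremum_unique)
    show "yvar 1 ^ s + G + (\<Sum>j=m+1..n. yvar j ^ 2) \<in> mpolys n"
      using G m1 mn by (rule normal_form_mpolys)
    show "lam (mono_at a \<alpha>) = dcoeff (yvar 1 ^ s + G + (\<Sum>j=m+1..n. yvar j ^ 2)) \<alpha>"
      if \<alpha>: "keys \<alpha> \<subseteq> {1..n}" for \<alpha>
    proof (rule expo_single_or_split[of \<alpha> 1])
      define k where "k = expo_deg \<alpha>"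
      assume "\<alpha> = single 1 (expo_deg \<alpha>)"
      then have ak: "\<alpha> = single 1 k" by (simp add: k_def)
      have "lam (mono_at a \<alpha>) = (if k = s then fact s else 0)"
        unfolding ak mono_at_single a1 by (rule lam_power)
      moreover have "\<alpha> = single 1 s \<longleftrightarrow> k = s"
        unfolding ak by (metis lookup_single_eq)
      moreover have "\<alpha> \<notin> T" unfolding ak T_def by auto
      moreover have "\<not> (\<exists>j\<in>{m+1..n}. \<alpha> = single j 2)"
      proof
        assume "\<exists>j\<in>{m+1..n}. \<alpha> = single j 2"
        then obtain j where j: "j \<in> {m+1..n}" "single 1 k = single j (2::nat)"
          unfolding ak by blast
        then have "lookup (single 1 k) j = (2::nat)" by simp
        then show False using j(1) m1 by (simp add: lookup_single_not_eq)
      qed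
      ultimately show ?thesis unfolding dcoeff_normal_form dG by simp
    next
      fix j \<beta> assume "j \<noteq> 1" and \<alpha>\<beta>: "\<alpha> = single j 1 + \<beta>"
      then have j: "j \<in> {2..n}" and \<beta>: "keys \<beta> \<subseteq> {1..n}"
        using \<alpha> by (auto simp: keys_add_nat)
      have mono: "mono_at a \<alpha> = a j * mono_at a \<beta>" by (simp add: \<alpha>\<beta> mono_at_add)
      have deg: "expo_deg \<alpha> = Suc (expo_deg \<beta>)" by (simp add: \<alpha>\<beta> expo_deg_add)
      have 1: "\<alpha> \<noteq> single 1 s"
        unfolding \<alpha>\<beta> using single_add_neq[of 1 j \<beta> s] \<open>j \<noteq> 1\<close> by simp
      have sq: "expo_deg \<beta> = 1" if "\<exists>l\<in>{m+1..n}. \<alpha> = single l 2"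
      proof -
        have "expo_deg \<alpha> = 2" using that by auto
        then show ?thesis using deg by simp
      qed
      \<comment> \<open>With a_j split off, j \<ge> 2, the degree of the cofactor decides: linear
        monomials vanish as \<open>V\<close> is orthogonal to 1, quadratic ones give the squares,
        cubic ones define \<open>G\<close>, and higher ones vanish as \<open>V\<close> is orthogonal
        to M^3.\<close>
      consider "\<beta> = 0" | "expo_deg \<beta> = 1" | "expo_deg \<beta> = 2" | "3 \<le> expo_deg \<beta>"
      proof -
        have "expo_deg \<beta> = 0 \<or> expo_deg \<beta> = 1 \<or> expo_deg \<beta> = 2 \<or> 3 \<le> expo_deg \<beta>" by linarith
        then show ?thesis using that unfolding expo_deg_eq_0_iff by blast
      qed
      then show ?thesis
      proof cases
        case 1
        then have "lam (mono_at a \<alpha>) = 0" using lam_V_power[OF aV[OF j], of 0] by (simp add: mono)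
        moreover have "\<alpha> \<notin> T" using deg 1 by (simp add: T_def)
        ultimately show ?thesis
          unfolding dcoeff_normal_form dG using sq 1 \<open>\<alpha> \<noteq> _\<close> by auto
      next
        case 2
        then have "\<beta> \<noteq> 0" by auto
        then obtain i \<delta> where "\<beta> = single i 1 + \<delta>" by (rule expo_nonzero_split)
        then have i: "\<beta> = single i 1" using 2 by (simp add: expo_deg_add)
        have "\<alpha> \<notin> T" using deg 2 by (simp add: T_def)
        moreover have "(\<exists>l\<in>{m+1..n}. \<alpha> = single l 2) \<longleftrightarrow> i = j \<and> m < i"
        proof
          assume "\<exists>l\<in>{m+1..n}. \<alpha> = single l 2"
          then obtain l where l: "l \<in> {m+1..n}" "single j 1 + single i 1 = single l (2::nat)"
            unfolding \<alpha>\<beta> i by blast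
          then have "l = j" "l = i"
            using single_add_neq[of l j "single i 1" 2] single_add_neq[of l i "single j 1" 2]
            by (auto simp: add.commute)
          then show "i = j \<and> m < i" using l(1) by simp
        next
          assume "i = j \<and> m < i"
          then show "\<exists>l\<in>{m+1..n}. \<alpha> = single l 2"
            unfolding \<alpha>\<beta> i using j by (intro bexI[of _ i]) (auto simp: numeral_2_eq_2 simp flip: single_add)
        qed
        moreover have "lam (mono_at a \<alpha>) = (if i = j \<and> m < i then 2 else 0)"
        proof (cases "i = 1")
          case True
          then have "lam (mono_at a \<alpha>) = 0"
            unfolding mono i mono_at_single True a1 by (intro lam_V_power aV j)
          then show ?thesis using True m1 by simp
        next
          case False
          then have "i \<in> {2..n}" using \<beta> i by auto
          then show ?thesis unfolding mono i using aa[OF j, of i] by auto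
        qed
        ultimately show ?thesis
          unfolding dcoeff_normal_form dG using 1 by simp
      next
        case 3
        have "lam (mono_at a \<alpha>) = (if \<alpha> \<in> T then lam (mono_at a \<alpha>) else 0)"
        proof (cases "\<alpha> \<in> T")
          case False
          moreover have "\<alpha> \<noteq> single 1 3"
            unfolding \<alpha>\<beta> using single_add_neq[of 1 j \<beta> 3] \<open>j \<noteq> 1\<close> by simp
          \<comment> \<open>A cubic monomial missing from \<open>T\<close> contains a variable
            beyond \<open>m\<close>, whose a_l is orthogonal to the quadratic cofactor in
            M^2.\<close>
          ultimately obtain l where l: "l \<in> keys \<alpha>" "l \<in> {m+1..n}"
            using \<alpha> deg 3 by (fastforce simp: T_def)
          then obtain \<delta> where \<delta>: "\<alpha> = single l 1 + \<delta>" using expo_split by blast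
          then have "expo_deg \<delta> = 2" "keys \<delta> \<subseteq> {1..n}"
            using deg 3 \<alpha> by (auto simp: expo_deg_add keys_add_nat)
          then have "mono_at a \<delta> \<in> Mpow 2" using mono_Mpow[of \<delta>] by simp
          from a_Mpow2[OF l(2) this] show ?thesis using False by (simp add: \<delta> mono_at_add)
        qed simp
        then show ?thesis
          unfolding dcoeff_normal_form dG using sq 3 1 by auto
      next
        case 4
        then have "mono_at a \<beta> \<in> Mpow 3"
          using mono_Mpow[OF \<beta>] Mpow_antimono[of 3 "expo_deg \<beta>"] by auto
        then have "lam (mono_at a \<alpha>) = 0" unfolding mono by (rule lam_V_Mpow3[OF aV[OF j]])
        moreover have "\<alpha> \<notin> T" using deg 4 by (simp add: T_def)
        ultimately show ?thesis
          unfolding dcoeff_normal_form dG using sq 4 1 by auto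
      qed
    qed
  qed (use aM lam_add lam_scale nondegenerate in auto)
  then have "iso_mps_quotient scale n (Ann n (yvar 1 ^ s + G + (\<Sum>j=m+1..n. yvar j ^ 2)))"
    by (rule inverse_system.iso_mps_quotient)
  with G hom sq lin show ?thesis by blast
qed

end

theorem theoremA:
  fixes scale :: "'k::{alg_closed_field, field_char_0} \<Rightarrow> 'a::comm_ring_1 \<Rightarrow> 'a"
    and n m s :: nat
  assumes "gorenstein_local_artinian_algebra scale"
    and "3 \<le> s" and "1 \<le> m" and "m \<le> n"
  shows "(hilbert scale 1 = n \<and> hilbert scale 2 = m \<and> (\<forall>i\<in>{3..s}. hilbert scale i = 1) \<and>
            s = sdeg TYPE('a))
     \<longleftrightarrow>
         (\<exists>F F\<^sub>3 :: 'k mpoly.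
            F\<^sub>3 \<in> mpolys m \<and> homogeneous 3 F\<^sub>3 \<and>
            (xvar 1 [^]\<^bsub>mps_ring n\<^esub> (2::nat)) \<circ>\<^sub>\<partial> F\<^sub>3 = 0 \<and>
            lin_indep_family (\<lambda>j. xvar j \<circ>\<^sub>\<partial> F\<^sub>3) {2..m} \<and>
            F = yvar 1 ^ s + F\<^sub>3 + (\<Sum>j=m+1..n. yvar j ^ 2) \<and>
            iso_mps_quotient scale n (Ann n F))"
    (is "?H \<longleftrightarrow> ?N")
proof
  interpret gorenstein_local_artinian_algebra scale by fact
  interpret gorenstein_char_0 scale by unfold_locales
  assume H: ?H
  then have s: "Mpow s \<noteq> {0}" "Mpow (Suc s) = {0}" using sdeg_iff by blast+
  obtain x where x: "x \<in> M" "x ^ s \<noteq> 0" using exists_power_nonzero[OF s(1)] by blast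
  obtain lam where lam: "\<And>y z. lam (y + z) = lam y + lam z" "\<And>c y. lam (scale c y) = c * lam y"
    "\<And>k. lam (x ^ k) = (if k = s then fact s else 0)"
    using power_functional[OF x s(2)] by blast
  have "stretched scale s x lam"
  proof unfold_locales
    show "Mpow 3 \<subseteq> span ((\<lambda>k. x ^ k) ` {3..s})"
      using power_basis[OF x s(2)] H \<open>3 \<le> s\<close> by simp
    \<comment> \<open>In characteristic 0 the value s! at x^s is nonzero, so \<open>lam\<close> does
      not vanish on the socle.\<close>
    show "y = 0" if "\<And>z. lam (y * z) = 0" for y
      using functional_nondegenerate[OF x(1) s(2) lam(2)] lam(3)[of s] that by simp
  qed (use x s lam \<open>3 \<le> s\<close> in auto)
  from stretched.exists_normal_form[OF this] H show ?N by blast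
next
  assume ?N
  then obtain G :: "'k mpoly" where G: "G \<in> mpolys m" "homogeneous 3 G"
      "(xvar 1 [^]\<^bsub>mps_ring n\<^esub> (2::nat)) \<circ>\<^sub>\<partial> G = 0" "lin_indep_family (\<lambda>j. xvar j \<circ>\<^sub>\<partial> G) {2..m}"
    and iso: "iso_mps_quotient scale n (Ann n (yvar 1 ^ s + G + (\<Sum>j=m+1..n. yvar j ^ 2)))"
    by blast
  obtain a lam where "inverse_system scale n a lam (yvar 1 ^ s + G + (\<Sum>j=m+1..n. yvar j ^ 2))"
    using iso_imp_inverse_system[OF gorenstein_local_artinian_algebra.axioms(1)[OF assms(1)] iso
        normal_form_mpolys[OF G(1) assms(3,4)]] by blast
  then interpret normal_system scale n a lam "yvar 1 ^ s + G + (\<Sum>j=m+1..n. yvar j ^ 2)" s m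
    using assms(2-4) G by (rule normal_form_normal_system)
  show ?H using hilbert_1 hilbert_2 hilbert_ge3 sdeg by simp
qed

end
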